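(* Let $\mathcal{A}$ be an essentially small abelian length category and let $\mathcal{T}\in\mathsf{tors}\,\mathcal{A}$. Taking brick labels gives a bijection $$\{\text{Hasse arrows in }\mathsf{tors}\,\mathcal{A}\text{ starting at }\mathcal{T}\}\to\mathsf{sim}(\mathsf{W}_L(\mathcal{T})).$$ Moreover, the map $\mathcal{W}\mapsto\mathcal{T}\cap{}^\perp\mathcal{W}$ induces a bijection $$\mathsf{Serre}(\mathsf{W}_L(\mathcal{T}))\to\{\mathcal{U}\in\mathsf{tors}\,\mathcal{A}\mid[\mathcal{U},\mathcal{T}]\text{ is a wide interval}\}.$$
   Context: All subcategories are full and closed under isomorphism. An abelian length category is an abelian category in which every object has a finite composition series. For a subcategory $\mathcal{X}\subseteq\mathcal{A}$: $\mathcal{X}^\perp=\{Y\mid \mathrm{Hom}_{\mathcal{A}}(X,Y)=0\ \forall X\in\mathcal{X}\}$ and ${}^\perp\mathcal{X}=\{Y\mid \mathrm{Hom}_{\mathcal{A}}(Y,X)=0\ \forall X\in\mathcal{X}\}$. A torsion class is a subcategory closed under extensions and factor objects; $\mathsf{tors}\,\mathcal{A}$ is the set of torsion classes in $\mathcal{A}$, ordered by inclusion. A wide subcategory is one closed under kernels, cokernels and extensions in $\mathcal{A}$; it is itself an abelian length category. For $\mathcal{T}\in\mathsf{tors}\,\mathcal{A}$, the left wide subcategory is $$\mathsf{W}_L(\mathcal{T})=\{X\in\mathcal{T}\mid\text{for all }Y\in\mathcal{T}\text{ and all }g\colon Y\to X,\ \mathrm{Ker}\,g\in\mathcal{T}\},$$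 which is known to be a wide subcategory of $\mathcal{A}$. For a wide subcategory $\mathcal{W}$, $\mathsf{sim}\,\mathcal{W}$ is the set of isomorphism classes of simple objects of the abelian category $\mathcal{W}$, and $\mathsf{Serre}(\mathcal{W})$ is the set of Serre subcategories of $\mathcal{W}$ (closed under extensions, factor objects and subobjects in $\mathcal{W}$). For $\mathcal{U}\subseteq\mathcal{T}$ in $\mathsf{tors}\,\mathcal{A}$, $[\mathcal{U},\mathcal{T}]$ denotes the interval of torsion classes between $\mathcal{U}$ and $\mathcal{T}$; it is a wide interval if $\mathcal{U}^\perp\cap\mathcal{T}$ is a wide subcategory of $\mathcal{A}$. (Writing $[\mathcal{U},\mathcal{T}]$ presupposes $\mathcal{U}\subseteq\mathcal{T}$.) There is a Hasse arrow $\mathcal{V}_1\to\mathcal{V}_2$ in $\mathsf{tors}\,\mathcal{A}$ iff $\mathcal{V}_2\subsetneq\mathcal{V}_1$ and no torsion class lies strictly between them. A brick is an object whose endomorphism ring is a division ring. It is known that there is a Hasse arrow $\mathcal{V}_1\to\mathcal{V}_2$ (for $\mathcal{V}_2\subseteq\mathcal{V}_1$) iff $\mathcal{V}_2^\perp\cap\mathcal{V}_1$ contains exactly one brick up to isomorphism; the isomorphism class of this brick is the brick label of the arrow. *)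

theory Defs
  imports "HOL-Algebra.Ring"
begin

text \<open>
  Categories are given by a set of objects and a set of arrows; the hom-sets are abelian groups.
  Every such category is small relative to the types of its objects and arrows, which is the
  form that essential smallness takes here.
\<close>

record ('o, 'm) ab_category =
  Obj :: "'o set"
  Arr :: "'m set"
  Dom :: "'m \<Rightarrow> 'o"
  Cod :: "'m \<Rightarrow> 'o"
  Ident :: "'o \<Rightarrow> 'm"
  Comp :: "'m \<Rightarrow> 'm \<Rightarrow> 'm"  (infixr "\<cdot>\<index>" 70)
  Plus :: "'m \<Rightarrow> 'm \<Rightarrow> 'm"
  Zero :: "'o \<Rightarrow> 'o \<Rightarrow> 'm"

definition Hom :: "('o, 'm) ab_category \<Rightarrow> 'o \<Rightarrow> 'o \<Rightarrow> 'm set" where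
  "Hom C X Y = {f \<in> Arr C. Dom C f = X \<and> Cod C f = Y}"

definition hom_group :: "('o, 'm) ab_category \<Rightarrow> 'o \<Rightarrow> 'o \<Rightarrow> 'm monoid" where
  "hom_group C X Y = \<lparr>carrier = Hom C X Y, monoid.mult = Plus C, one = Zero C X Y\<rparr>"

locale preadditive_category =
  fixes C :: "('o, 'm) ab_category" (structure)
  assumes Dom_Obj: "f \<in> Arr C \<Longrightarrow> Dom C f \<in> Obj C"
    and Cod_Obj: "f \<in> Arr C \<Longrightarrow> Cod C f \<in> Obj C"
    and Ident_Hom: "X \<in> Obj C \<Longrightarrow> Ident C X \<in> Hom C X X"
    and Comp_Hom: "f \<in> Hom C X Y \<Longrightarrow> g \<in> Hom C Y Z \<Longrightarrow> g \<cdot> f \<in> Hom C X Z"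
    and Comp_Ident: "f \<in> Hom C X Y \<Longrightarrow> f \<cdot> Ident C X = f"
    and Ident_Comp: "f \<in> Hom C X Y \<Longrightarrow> Ident C Y \<cdot> f = f"
    and Comp_assoc: "f \<in> Hom C W X \<Longrightarrow> g \<in> Hom C X Y \<Longrightarrow> h \<in> Hom C Y Z
      \<Longrightarrow> (h \<cdot> g) \<cdot> f = h \<cdot> (g \<cdot> f)"
    and Hom_comm_group: "X \<in> Obj C \<Longrightarrow> Y \<in> Obj C \<Longrightarrow> comm_group (hom_group C X Y)"
    and Comp_Plus: "f \<in> Hom C X Y \<Longrightarrow> f' \<in> Hom C X Y \<Longrightarrow> g \<in> Hom C Y Z
      \<Longrightarrow> g \<cdot> Plus C f f' = Plus C (g \<cdot> f) (g \<cdot> f')"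
    and Plus_Comp: "f \<in> Hom C X Y \<Longrightarrow> g \<in> Hom C Y Z \<Longrightarrow> g' \<in> Hom C Y Z
      \<Longrightarrow> Plus C g g' \<cdot> f = Plus C (g \<cdot> f) (g' \<cdot> f)"

definition zero_obj :: "('o, 'm) ab_category \<Rightarrow> 'o \<Rightarrow> bool" where
  "zero_obj C Z \<longleftrightarrow> Z \<in> Obj C \<and>
     (\<forall>X \<in> Obj C. (\<exists>!f. f \<in> Hom C Z X) \<and> (\<exists>!f. f \<in> Hom C X Z))"

definition biproduct ::
    "('o, 'm) ab_category \<Rightarrow> 'o \<Rightarrow> 'o \<Rightarrow> 'o \<Rightarrow> 'm \<Rightarrow> 'm \<Rightarrow> 'm \<Rightarrow> 'm \<Rightarrow> bool" where
  "biproduct C X Y P i j p q \<longleftrightarrow>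
     P \<in> Obj C \<and> i \<in> Hom C X P \<and> j \<in> Hom C Y P \<and> p \<in> Hom C P X \<and> q \<in> Hom C P Y \<and>
     p \<cdot>\<^bsub>C\<^esub> i = Ident C X \<and> q \<cdot>\<^bsub>C\<^esub> j = Ident C Y \<and>
     p \<cdot>\<^bsub>C\<^esub> j = Zero C Y X \<and> q \<cdot>\<^bsub>C\<^esub> i = Zero C X Y \<and>
     Plus C (i \<cdot>\<^bsub>C\<^esub> p) (j \<cdot>\<^bsub>C\<^esub> q) = Ident C P"

definition monic :: "('o, 'm) ab_category \<Rightarrow> 'm \<Rightarrow> bool" where
  "monic C m \<longleftrightarrow> m \<in> Arr C \<and>
     (\<forall>X \<in> Obj C. \<forall>g \<in> Hom C X (Dom C m). \<forall>h \<in> Hom C X (Dom C m).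
        m \<cdot>\<^bsub>C\<^esub> g = m \<cdot>\<^bsub>C\<^esub> h \<longrightarrow> g = h)"

definition epic :: "('o, 'm) ab_category \<Rightarrow> 'm \<Rightarrow> bool" where
  "epic C e \<longleftrightarrow> e \<in> Arr C \<and>
     (\<forall>X \<in> Obj C. \<forall>g \<in> Hom C (Cod C e) X. \<forall>h \<in> Hom C (Cod C e) X.
        g \<cdot>\<^bsub>C\<^esub> e = h \<cdot>\<^bsub>C\<^esub> e \<longrightarrow> g = h)"

definition iso_arr :: "('o, 'm) ab_category \<Rightarrow> 'm \<Rightarrow> bool" where
  "iso_arr C f \<longleftrightarrow> f \<in> Arr C \<and>
     (\<exists>g \<in> Hom C (Cod C f) (Dom C f).
        g \<cdot>\<^bsub>C\<^esub> f = Ident C (Dom C f) \<and> f \<cdot>\<^bsub>C\<^esub> g = Ident C (Cod C f))"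

definition isomorphic :: "('o, 'm) ab_category \<Rightarrow> 'o \<Rightarrow> 'o \<Rightarrow> bool" where
  "isomorphic C X Y \<longleftrightarrow> (\<exists>f \<in> Hom C X Y. iso_arr C f)"

definition iso_class :: "('o, 'm) ab_category \<Rightarrow> 'o \<Rightarrow> 'o set" where
  "iso_class C X = {Y \<in> Obj C. isomorphic C X Y}"

definition is_kernel :: "('o, 'm) ab_category \<Rightarrow> 'm \<Rightarrow> 'm \<Rightarrow> bool" where
  "is_kernel C k f \<longleftrightarrow> k \<in> Arr C \<and> f \<in> Arr C \<and> Cod C k = Dom C f \<and>
     f \<cdot>\<^bsub>C\<^esub> k = Zero C (Dom C k) (Cod C f) \<and>
     (\<forall>X \<in> Obj C. \<forall>g \<in> Hom C X (Dom C f). f \<cdot>\<^bsub>C\<^esub> g = Zero C X (Cod C f) \<longrightarrow>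
        (\<exists>!h. h \<in> Hom C X (Dom C k) \<and> k \<cdot>\<^bsub>C\<^esub> h = g))"

definition is_cokernel :: "('o, 'm) ab_category \<Rightarrow> 'm \<Rightarrow> 'm \<Rightarrow> bool" where
  "is_cokernel C c f \<longleftrightarrow> c \<in> Arr C \<and> f \<in> Arr C \<and> Dom C c = Cod C f \<and>
     c \<cdot>\<^bsub>C\<^esub> f = Zero C (Dom C f) (Cod C c) \<and>
     (\<forall>X \<in> Obj C. \<forall>g \<in> Hom C (Cod C f) X. g \<cdot>\<^bsub>C\<^esub> f = Zero C (Dom C f) X \<longrightarrow>
        (\<exists>!h. h \<in> Hom C (Cod C c) X \<and> h \<cdot>\<^bsub>C\<^esub> c = g))"

definition short_exact :: "('o, 'm) ab_category \<Rightarrow> 'm \<Rightarrow> 'm \<Rightarrow> bool" where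
  "short_exact C f g \<longleftrightarrow> is_kernel C f g \<and> is_cokernel C g f"

locale abelian_category = preadditive_category +
  assumes ex_zero_obj: "\<exists>Z. zero_obj C Z"
    and ex_biproduct: "X \<in> Obj C \<Longrightarrow> Y \<in> Obj C \<Longrightarrow> \<exists>P i j p q. biproduct C X Y P i j p q"
    and ex_kernel: "f \<in> Arr C \<Longrightarrow> \<exists>k. is_kernel C k f"
    and ex_cokernel: "f \<in> Arr C \<Longrightarrow> \<exists>c. is_cokernel C c f"
    and monic_normal: "monic C m \<Longrightarrow> \<exists>f. is_kernel C m f"
    and epic_normal: "epic C e \<Longrightarrow> \<exists>f. is_cokernel C e f"

definition simple_obj :: "('o, 'm) ab_category \<Rightarrow> 'o \<Rightarrow> bool" where
  "simple_obj C X \<longleftrightarrow> X \<in> Obj C \<and> \<not> zero_obj C X \<and>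
     (\<forall>m. monic C m \<and> Cod C m = X \<longrightarrow> zero_obj C (Dom C m) \<or> iso_arr C m)"

definition has_composition_series :: "('o, 'm) ab_category \<Rightarrow> 'o \<Rightarrow> bool" where
  "has_composition_series C X \<longleftrightarrow>
     (\<exists>(n::nat) (F :: nat \<Rightarrow> 'o) (m :: nat \<Rightarrow> 'm). zero_obj C (F 0) \<and> F n = X \<and>
        (\<forall>k<n. m k \<in> Hom C (F k) (F (Suc k)) \<and> monic C (m k) \<and>
           (\<exists>c. is_cokernel C c (m k) \<and> simple_obj C (Cod C c))))"

locale abelian_length_category = abelian_category +
  assumes finite_length: "X \<in> Obj C \<Longrightarrow> has_composition_series C X"

text \<open>
  A full subcategory closed under isomorphism is identified with its set of objects. It is required
  to be nonempty: otherwise the empty set would be a torsion class below the zero subcategory.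
\<close>

definition subcategory :: "('o, 'm) ab_category \<Rightarrow> 'o set \<Rightarrow> bool" where
  "subcategory C S \<longleftrightarrow> S \<noteq> {} \<and> S \<subseteq> Obj C \<and> (\<forall>X \<in> S. \<forall>Y \<in> Obj C. isomorphic C X Y \<longrightarrow> Y \<in> S)"

definition full_sub :: "('o, 'm) ab_category \<Rightarrow> 'o set \<Rightarrow> ('o, 'm) ab_category" where
  "full_sub C S = C\<lparr>Obj := S, Arr := {f \<in> Arr C. Dom C f \<in> S \<and> Cod C f \<in> S}\<rparr>"

definition closed_extensions :: "('o, 'm) ab_category \<Rightarrow> 'o set \<Rightarrow> bool" where
  "closed_extensions C S \<longleftrightarrow>
     (\<forall>f g. short_exact C f g \<and> Dom C f \<in> S \<and> Cod C g \<in> S \<longrightarrow> Cod C f \<in> S)"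

definition closed_factors :: "('o, 'm) ab_category \<Rightarrow> 'o set \<Rightarrow> bool" where
  "closed_factors C S \<longleftrightarrow> (\<forall>e. epic C e \<and> Dom C e \<in> S \<longrightarrow> Cod C e \<in> S)"

definition closed_subobjects :: "('o, 'm) ab_category \<Rightarrow> 'o set \<Rightarrow> bool" where
  "closed_subobjects C S \<longleftrightarrow> (\<forall>m. monic C m \<and> Cod C m \<in> S \<longrightarrow> Dom C m \<in> S)"

definition closed_kernels :: "('o, 'm) ab_category \<Rightarrow> 'o set \<Rightarrow> bool" where
  "closed_kernels C S \<longleftrightarrow>
     (\<forall>k f. is_kernel C k f \<and> Dom C f \<in> S \<and> Cod C f \<in> S \<longrightarrow> Dom C k \<in> S)"

definition closed_cokernels :: "('o, 'm) ab_category \<Rightarrow> 'o set \<Rightarrow> bool" where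
  "closed_cokernels C S \<longleftrightarrow>
     (\<forall>c f. is_cokernel C c f \<and> Dom C f \<in> S \<and> Cod C f \<in> S \<longrightarrow> Cod C c \<in> S)"

definition right_perp :: "('o, 'm) ab_category \<Rightarrow> 'o set \<Rightarrow> 'o set" where
  "right_perp C S = {Y \<in> Obj C. \<forall>X \<in> S. Hom C X Y = {Zero C X Y}}"

definition left_perp :: "('o, 'm) ab_category \<Rightarrow> 'o set \<Rightarrow> 'o set" where
  "left_perp C S = {Y \<in> Obj C. \<forall>X \<in> S. Hom C Y X = {Zero C Y X}}"

definition tors :: "('o, 'm) ab_category \<Rightarrow> 'o set set" where
  "tors C = {T. subcategory C T \<and> closed_extensions C T \<and> closed_factors C T}"

definition wide :: "('o, 'm) ab_category \<Rightarrow> 'o set \<Rightarrow> bool" where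
  "wide C W \<longleftrightarrow>
     subcategory C W \<and> closed_kernels C W \<and> closed_cokernels C W \<and> closed_extensions C W"

definition left_wide :: "('o, 'm) ab_category \<Rightarrow> 'o set \<Rightarrow> 'o set" where
  "left_wide C T =
     {X \<in> T. \<forall>Y \<in> T. \<forall>g \<in> Hom C Y X. \<forall>k. is_kernel C k g \<longrightarrow> Dom C k \<in> T}"

text \<open>
  Simplicity and the Serre closure conditions are evaluated in the category \<^term>\<open>full_sub C W\<close>,
  so monomorphisms, epimorphisms and exact sequences are those of \<^term>\<open>W\<close>, not of \<^term>\<open>C\<close>.
\<close>

definition sim :: "('o, 'm) ab_category \<Rightarrow> 'o set \<Rightarrow> 'o set set" where
  "sim C W = iso_class (full_sub C W) ` {X. simple_obj (full_sub C W) X}"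

definition Serre :: "('o, 'm) ab_category \<Rightarrow> 'o set \<Rightarrow> 'o set set" where
  "Serre C W = {S. subcategory (full_sub C W) S \<and> closed_extensions (full_sub C W) S \<and>
     closed_factors (full_sub C W) S \<and> closed_subobjects (full_sub C W) S}"

definition wide_interval :: "('o, 'm) ab_category \<Rightarrow> 'o set \<Rightarrow> 'o set \<Rightarrow> bool" where
  "wide_interval C U T \<longleftrightarrow>
     U \<in> tors C \<and> T \<in> tors C \<and> U \<subseteq> T \<and> wide C (right_perp C U \<inter> T)"

definition hasse_arrows :: "('o, 'm) ab_category \<Rightarrow> ('o set \<times> 'o set) set" where
  "hasse_arrows C = {(V1, V2). V1 \<in> tors C \<and> V2 \<in> tors C \<and> V2 \<subset> V1 \<and>
     \<not> (\<exists>V \<in> tors C. V2 \<subset> V \<and> V \<subset> V1)}"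

definition End_ring :: "('o, 'm) ab_category \<Rightarrow> 'o \<Rightarrow> 'm ring" where
  "End_ring C X = \<lparr>carrier = Hom C X X, monoid.mult = Comp C, one = Ident C X,
     ring.zero = Zero C X X, add = Plus C\<rparr>"

definition is_division_ring :: "('a, 'b) ring_scheme \<Rightarrow> bool" where
  "is_division_ring R \<longleftrightarrow>
     ring R \<and> \<one>\<^bsub>R\<^esub> \<noteq> \<zero>\<^bsub>R\<^esub> \<and> (\<forall>x \<in> carrier R. x \<noteq> \<zero>\<^bsub>R\<^esub> \<longrightarrow> x \<in> Units R)"

definition brick :: "('o, 'm) ab_category \<Rightarrow> 'o \<Rightarrow> bool" where
  "brick C X \<longleftrightarrow> X \<in> Obj C \<and> is_division_ring (End_ring C X)"

text \<open>
  The label of an arrow \<^term>\<open>(V1, V2)\<close>. The description is proper for Hasse arrows, since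
  exactly one isomorphism class of bricks lies in \<^term>\<open>right_perp C V2 \<inter> V1\<close>.
\<close>

definition brick_label :: "('o, 'm) ab_category \<Rightarrow> 'o set \<times> 'o set \<Rightarrow> 'o set" where
  "brick_label C a =
     (THE L. \<exists>B. brick C B \<and> B \<in> right_perp C (snd a) \<inter> fst a \<and> L = iso_class C B)"

end

(*
  Everything is elementary once two facts are available: every object of an abelian length
  category has a torsion sequence, and an object of T that is a subobject of an object of
  W_L(T) lies in W_L(T).

  For a Serre subcategory W of W_L(T) and U = T \<inter> \<^sup>\<bottom>W, an object X of U\<^sup>\<bottom> \<inter> T with a nonzero map to
  W has a nonzero quotient in W with kernel again in U\<^sup>\<bottom> \<inter> T, so induction on the length gives
  U\<^sup>\<bottom> \<inter> T = W; conversely U\<^sup>\<bottom> \<inter> T is a Serre subcategory of W_L(T) whenever it is wide.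

  For S simple in W_L(T), every nonzero map from T to S is epic with kernel in T. Induction on
  the length shows that T \<inter> \<^sup>\<bottom>S is covered by T and that S is the only brick in the difference.
  For a Hasse arrow from T to U one has U = T \<inter> \<^sup>\<bottom>Y for every nonzero Y in U\<^sup>\<bottom> \<inter> T. Choosing
  S of minimal length among these Y, nonzero maps from T to S are epic; if the kernel K of such
  a map were not in T, dividing by its T-torsion part would give a Y in U\<^sup>\<bottom> \<inter> T with a quotient
  S and kernel in T\<^sup>\<bottom>, and a nonzero map from S to Y then splits Y and forces that kernel to vanish.
*)

theory Submission
  imports Defs
begin

text \<open>There are no elements to chase, so diagram arguments rest on a few facts about arrows:
  images exist, epimorphisms are stable under pullback, and for an epimorphism \<open>c\<close> the
  kernels of \<open>c\<close>, \<open>d \<cdot> c\<close> and \<open>d\<close> form a short exact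
  sequence. The last fact is what puts a kernel into a torsion class: it exhibits the kernel as an
  extension of members. Simplicity and the Serre conditions live inside W_L(T). Its closure under
  kernels and cokernels makes its monomorphisms and epimorphisms those of the ambient category, so
  both notions can be tested there. Minimal length suits S because the image of a nonzero map from T
  to S is again a nonzero object of U-perp in T. The map from S to Y exists because U consists of
  the objects of T without maps to Y, and S, being nonzero in U-perp, is not in U. The composite
  from S through Y to S is nonzero, since the kernel of the second map receives nothing from T, and
  finite length makes it invertible. Labels are injective because the label S determines the lower
  end of its arrow.\<close>

definition null_arr :: "('o, 'm) ab_category \<Rightarrow> 'm \<Rightarrow> bool" where
  "null_arr C f \<longleftrightarrow> (\<exists>X \<in> Obj C. \<exists>Y \<in> Obj C. f = Zero C X Y)"

section \<open>Preadditive categories\<close>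

context preadditive_category
begin

declare Dom_Obj [simp] Cod_Obj [simp]

lemma Hom_iff: "f \<in> Hom C X Y \<longleftrightarrow> f \<in> Arr C \<and> Dom C f = X \<and> Cod C f = Y"
  by (simp add: Hom_def)

lemma comp_Arr [simp]:
  assumes "f \<in> Arr C" "g \<in> Arr C" "Cod C f = Dom C g"
  shows "g \<cdot> f \<in> Arr C" "Dom C (g \<cdot> f) = Dom C f" "Cod C (g \<cdot> f) = Cod C g"
  using Comp_Hom [of f "Dom C f" "Dom C g" g "Cod C g"] assms by (auto simp: Hom_iff)

lemma comp_assoc [simp]:
  assumes "f \<in> Arr C" "g \<in> Arr C" "h \<in> Arr C" "Cod C f = Dom C g" "Cod C g = Dom C h"
  shows "(h \<cdot> g) \<cdot> f = h \<cdot> (g \<cdot> f)"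
  using Comp_assoc assms by (auto simp: Hom_iff)

text \<open>Simplification nests composites to the right, which hides a product
  \<open>h \<cdot> g\<close> of known value; this rule substitutes that value in front of a further
  factor \<open>f\<close>.\<close>

lemma comp_left:
  assumes "h \<cdot> g = x" "f \<in> Arr C" "g \<in> Arr C" "h \<in> Arr C" "Cod C f = Dom C g" "Cod C g = Dom C h"
  shows "h \<cdot> (g \<cdot> f) = x \<cdot> f"
  using comp_assoc [OF assms(2-)] assms(1) by simp

lemma Ident_Arr [simp]:
  assumes "X \<in> Obj C"
  shows "Ident C X \<in> Arr C" "Dom C (Ident C X) = X" "Cod C (Ident C X) = X"
  using Ident_Hom [OF assms] by (auto simp: Hom_iff)

lemma comp_Ident_left [simp]: "f \<in> Arr C \<Longrightarrow> X = Cod C f \<Longrightarrow> Ident C X \<cdot> f = f"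
  using Ident_Comp by (auto simp: Hom_iff)

lemma comp_Ident_right [simp]: "f \<in> Arr C \<Longrightarrow> X = Dom C f \<Longrightarrow> f \<cdot> Ident C X = f"
  using Comp_Ident by (auto simp: Hom_iff)

lemma Zero_Arr [simp]:
  assumes "X \<in> Obj C" "Y \<in> Obj C"
  shows "Zero C X Y \<in> Arr C" "Dom C (Zero C X Y) = X" "Cod C (Zero C X Y) = Y"
proof -
  interpret comm_group "hom_group C X Y" using Hom_comm_group assms by blast
  have "Zero C X Y \<in> Hom C X Y" using one_closed by (simp add: hom_group_def)
  then show "Zero C X Y \<in> Arr C" "Dom C (Zero C X Y) = X" "Cod C (Zero C X Y) = Y"
    by (auto simp: Hom_iff)
qed

lemma Plus_Arr [simp]:
  assumes "f \<in> Arr C" "g \<in> Arr C" "Dom C f = Dom C g" "Cod C f = Cod C g"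
  shows "Plus C f g \<in> Arr C" "Dom C (Plus C f g) = Dom C g" "Cod C (Plus C f g) = Cod C g"
proof -
  interpret comm_group "hom_group C (Dom C g) (Cod C g)" using Hom_comm_group assms by simp
  have "Plus C f g \<in> Hom C (Dom C g) (Cod C g)"
    using m_closed [of f g] assms by (simp add: hom_group_def Hom_iff)
  then show "Plus C f g \<in> Arr C" "Dom C (Plus C f g) = Dom C g" "Cod C (Plus C f g) = Cod C g"
    by (auto simp: Hom_iff)
qed

lemma Plus_Zero_left [simp]:
  assumes "f \<in> Arr C" "X = Dom C f" "Y = Cod C f"
  shows "Plus C (Zero C X Y) f = f"
proof -
  interpret comm_group "hom_group C X Y" using Hom_comm_group assms by simp
  show ?thesis using l_one [of f] assms by (simp add: hom_group_def Hom_iff)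
qed

lemma Plus_Zero_right [simp]:
  assumes "f \<in> Arr C" "X = Dom C f" "Y = Cod C f"
  shows "Plus C f (Zero C X Y) = f"
proof -
  interpret comm_group "hom_group C X Y" using Hom_comm_group assms by simp
  show ?thesis using r_one [of f] assms by (simp add: hom_group_def Hom_iff)
qed

lemma ex_negative:
  assumes "f \<in> Arr C"
  shows "\<exists>g \<in> Hom C (Dom C f) (Cod C f). Plus C f g = Zero C (Dom C f) (Cod C f)"
proof -
  interpret comm_group "hom_group C (Dom C f) (Cod C f)" using Hom_comm_group assms by simp
  show ?thesis using r_inv_ex [of f] assms by (simp add: hom_group_def Hom_iff)
qed

lemma Plus_cancel_right:
  assumes "f \<in> Hom C X Y" "g \<in> Hom C X Y" "h \<in> Hom C X Y" "Plus C f h = Plus C g h"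
  shows "f = g"
proof -
  have "X \<in> Obj C" "Y \<in> Obj C" using assms(1) by (auto simp: Hom_iff)
  then interpret comm_group "hom_group C X Y" using Hom_comm_group by blast
  show ?thesis using right_cancel [of h f g] assms by (simp add: hom_group_def)
qed

lemma comp_Plus:
  assumes "f \<in> Arr C" "g \<in> Arr C" "h \<in> Arr C" "Dom C f = Dom C g" "Cod C f = Cod C g"
    "Cod C g = Dom C h"
  shows "h \<cdot> Plus C f g = Plus C (h \<cdot> f) (h \<cdot> g)"
  using Comp_Plus [of f "Dom C g" "Cod C g" g h "Cod C h"] assms by (simp add: Hom_iff)

lemma Plus_comp:
  assumes "f \<in> Arr C" "g \<in> Arr C" "h \<in> Arr C" "Dom C f = Dom C g" "Cod C f = Cod C g"
    "Cod C h = Dom C g"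
  shows "Plus C f g \<cdot> h = Plus C (f \<cdot> h) (g \<cdot> h)"
  using Plus_Comp [of h "Dom C h" "Dom C g" f "Cod C g" g] assms by (simp add: Hom_iff)

text \<open>By bilinearity the composite is unchanged when added to itself, and in a group only the
  neutral element has this property.\<close>

lemma comp_Zero_right [simp]:
  assumes "f \<in> Arr C" "X \<in> Obj C" "Y = Dom C f"
  shows "f \<cdot> Zero C X Y = Zero C X (Cod C f)"
proof (rule Plus_cancel_right [of _ X "Cod C f" _ "f \<cdot> Zero C X Y"])
  have "Plus C (f \<cdot> Zero C X Y) (f \<cdot> Zero C X Y) = f \<cdot> Plus C (Zero C X Y) (Zero C X Y)"
    by (rule comp_Plus [symmetric]) (use assms in simp_all)
  also have "\<dots> = Plus C (Zero C X (Cod C f)) (f \<cdot> Zero C X Y)" using assms by simp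
  finally show "Plus C (f \<cdot> Zero C X Y) (f \<cdot> Zero C X Y) = Plus C (Zero C X (Cod C f)) (f \<cdot> Zero C X Y)" .
qed (use assms in \<open>auto simp: Hom_iff\<close>)

lemma comp_Zero_left [simp]:
  assumes "f \<in> Arr C" "Y \<in> Obj C" "X = Cod C f"
  shows "Zero C X Y \<cdot> f = Zero C (Dom C f) Y"
proof (rule Plus_cancel_right [of _ "Dom C f" Y _ "Zero C X Y \<cdot> f"])
  have "Plus C (Zero C X Y \<cdot> f) (Zero C X Y \<cdot> f) = Plus C (Zero C X Y) (Zero C X Y) \<cdot> f"
    by (rule Plus_comp [symmetric]) (use assms in simp_all)
  also have "\<dots> = Plus C (Zero C (Dom C f) Y) (Zero C X Y \<cdot> f)" using assms by simp
  finally show "Plus C (Zero C X Y \<cdot> f) (Zero C X Y \<cdot> f) = Plus C (Zero C (Dom C f) Y) (Zero C X Y \<cdot> f)" .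
qed (use assms in \<open>auto simp: Hom_iff\<close>)

lemma null_arr_Zero [simp]: "X \<in> Obj C \<Longrightarrow> Y \<in> Obj C \<Longrightarrow> null_arr C (Zero C X Y)"
  by (auto simp: null_arr_def)

text \<open>Nullness is carried as a property of the arrow alone, so that it passes through
  composites without naming endpoints; the concrete zero arrow is recovered here when an equation
  calls for it.\<close>

lemma null_arr_eq: "null_arr C f \<Longrightarrow> Dom C f = X \<Longrightarrow> Cod C f = Y \<Longrightarrow> f = Zero C X Y"
  by (auto simp: null_arr_def)

lemma null_arr_Arr: "null_arr C f \<Longrightarrow> f \<in> Arr C"
  by (auto simp: null_arr_def)

lemma null_arrI: "f = Zero C X Y \<Longrightarrow> X \<in> Obj C \<Longrightarrow> Y \<in> Obj C \<Longrightarrow> null_arr C f"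
  by simp

lemma null_comp_right [simp]:
  assumes f: "null_arr C f" and "g \<in> Arr C" "Cod C f = Dom C g"
  shows "null_arr C (g \<cdot> f)"
proof -
  have "g \<cdot> f = g \<cdot> Zero C (Dom C f) (Dom C g)"
    using null_arr_eq [OF f refl assms(3)] by (rule arg_cong)
  also have "\<dots> = Zero C (Dom C f) (Cod C g)" using null_arr_Arr [OF f] assms by simp
  finally show ?thesis by (rule null_arrI) (use null_arr_Arr [OF f] assms in simp_all)
qed

lemma null_comp_left [simp]:
  assumes g: "null_arr C g" and "f \<in> Arr C" "Cod C f = Dom C g"
  shows "null_arr C (g \<cdot> f)"
proof -
  have "g \<cdot> f = Zero C (Cod C f) (Cod C g) \<cdot> f"
    using null_arr_eq [OF g assms(3) [symmetric] refl] by (rule arg_cong)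
  also have "\<dots> = Zero C (Dom C f) (Cod C g)" using null_arr_Arr [OF g] assms by simp
  finally show ?thesis by (rule null_arrI) (use null_arr_Arr [OF g] assms in simp_all)
qed

text \<open>With \<open>h\<close> a negative of \<open>g\<close>, the sum \<open>Plus C f h\<close>
  stands for the difference of \<open>f\<close> and \<open>g\<close>.\<close>

lemma eq_if_null_difference:
  assumes "f \<in> Arr C" "g \<in> Arr C" "h \<in> Arr C" "Dom C f = Dom C g" "Cod C f = Cod C g"
    "Dom C h = Dom C g" "Cod C h = Cod C g"
    "null_arr C (Plus C g h)" "null_arr C (Plus C f h)"
  shows "f = g"
proof (rule Plus_cancel_right [of _ "Dom C g" "Cod C g" _ h])
  have "Plus C f h = Zero C (Dom C g) (Cod C g)"
    by (rule null_arr_eq [OF assms(9)]) (use assms(1-7) in simp_all)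
  moreover have "Plus C g h = Zero C (Dom C g) (Cod C g)"
    by (rule null_arr_eq [OF assms(8)]) (use assms(1-7) in simp_all)
  ultimately show "Plus C f h = Plus C g h" by simp
qed (use assms in \<open>auto simp: Hom_iff\<close>)

section \<open>Monomorphisms and epimorphisms\<close>

lemma monic_Arr: "monic C m \<Longrightarrow> m \<in> Arr C"
  by (simp add: monic_def)

lemma epic_Arr: "epic C e \<Longrightarrow> e \<in> Arr C"
  by (simp add: epic_def)

lemma monic_cancel:
  assumes "monic C m" "g \<in> Arr C" "h \<in> Arr C" "Dom C g = Dom C h"
    "Cod C g = Dom C m" "Cod C h = Dom C m" "m \<cdot> g = m \<cdot> h"
  shows "g = h"
proof -
  have "Dom C h \<in> Obj C" "g \<in> Hom C (Dom C h) (Dom C m)" "h \<in> Hom C (Dom C h) (Dom C m)"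
    using assms by (simp_all add: Hom_iff)
  then show ?thesis using assms(1,7) unfolding monic_def by blast
qed

lemma epic_cancel:
  assumes "epic C e" "g \<in> Arr C" "h \<in> Arr C" "Cod C g = Cod C h"
    "Dom C g = Cod C e" "Dom C h = Cod C e" "g \<cdot> e = h \<cdot> e"
  shows "g = h"
proof -
  have "Cod C h \<in> Obj C" "g \<in> Hom C (Cod C e) (Cod C h)" "h \<in> Hom C (Cod C e) (Cod C h)"
    using assms by (simp_all add: Hom_iff)
  then show ?thesis using assms(1,7) unfolding epic_def by blast
qed

lemma monic_null:
  assumes "monic C m" "g \<in> Arr C" "Cod C g = Dom C m" "null_arr C (m \<cdot> g)"
  shows "null_arr C g"
proof -
  have m: "m \<in> Arr C" using assms(1) by (rule monic_Arr)
  have "m \<cdot> g = Zero C (Dom C g) (Cod C m)"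
    by (rule null_arr_eq [OF assms(4)]) (use assms m in simp_all)
  then have "m \<cdot> g = m \<cdot> Zero C (Dom C g) (Dom C m)" using assms m by simp
  then have "g = Zero C (Dom C g) (Dom C m)"
    by (rule monic_cancel [OF assms(1), rotated -1]) (use assms m in simp_all)
  then show ?thesis by (rule null_arrI) (use assms m in simp_all)
qed

lemma epic_null:
  assumes "epic C e" "g \<in> Arr C" "Dom C g = Cod C e" "null_arr C (g \<cdot> e)"
  shows "null_arr C g"
proof -
  have e: "e \<in> Arr C" using assms(1) by (rule epic_Arr)
  have "g \<cdot> e = Zero C (Dom C e) (Cod C g)"
    by (rule null_arr_eq [OF assms(4)]) (use assms e in simp_all)
  then have "g \<cdot> e = Zero C (Cod C e) (Cod C g) \<cdot> e" using assms e by simp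
  then have "g = Zero C (Cod C e) (Cod C g)"
    by (rule epic_cancel [OF assms(1), rotated -1]) (use assms e in simp_all)
  then show ?thesis by (rule null_arrI) (use assms e in simp_all)
qed

text \<open>Testing against null arrows is enough: if \<open>g\<close> and \<open>h\<close> have the
  same composite with \<open>m\<close>, then \<open>m\<close> kills their difference, formed with a
  negative \<open>n\<close> of \<open>h\<close>.\<close>

lemma monicI:
  assumes m: "m \<in> Arr C"
    and null: "\<And>g. g \<in> Arr C \<Longrightarrow> Cod C g = Dom C m \<Longrightarrow> null_arr C (m \<cdot> g) \<Longrightarrow> null_arr C g"
  shows "monic C m"
  unfolding monic_def
proof (intro conjI ballI impI m)
  fix X g h assume "X \<in> Obj C" and g: "g \<in> Hom C X (Dom C m)" and h: "h \<in> Hom C X (Dom C m)"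
    and eq: "m \<cdot> g = m \<cdot> h"
  obtain n where n: "n \<in> Hom C X (Dom C m)" "Plus C h n = Zero C X (Dom C m)"
    using ex_negative [of h] h by (auto simp: Hom_iff)
  have "m \<cdot> Plus C g n = m \<cdot> Plus C h n"
    using g h n(1) m eq by (simp add: Hom_iff comp_Plus)
  also have "\<dots> = Zero C X (Cod C m)" using n m \<open>X \<in> Obj C\<close> by simp
  finally have "null_arr C (m \<cdot> Plus C g n)" using m \<open>X \<in> Obj C\<close> by simp
  then have "null_arr C (Plus C g n)"
    by (rule null [rotated -1]) (use g n(1) m in \<open>simp_all add: Hom_iff\<close>)
  moreover have "null_arr C (Plus C h n)" using n(2) m \<open>X \<in> Obj C\<close> by simp
  ultimately show "g = h" using g h n(1) eq_if_null_difference [of g h n] by (simp add: Hom_iff)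
qed

lemma epicI:
  assumes e: "e \<in> Arr C"
    and null: "\<And>g. g \<in> Arr C \<Longrightarrow> Dom C g = Cod C e \<Longrightarrow> null_arr C (g \<cdot> e) \<Longrightarrow> null_arr C g"
  shows "epic C e"
  unfolding epic_def
proof (intro conjI ballI impI e)
  fix X g h assume "X \<in> Obj C" and g: "g \<in> Hom C (Cod C e) X" and h: "h \<in> Hom C (Cod C e) X"
    and eq: "g \<cdot> e = h \<cdot> e"
  obtain n where n: "n \<in> Hom C (Cod C e) X" "Plus C h n = Zero C (Cod C e) X"
    using ex_negative [of h] h by (auto simp: Hom_iff)
  have "Plus C g n \<cdot> e = Plus C h n \<cdot> e"
    using g h n(1) e eq by (simp add: Hom_iff Plus_comp)
  also have "\<dots> = Zero C (Dom C e) X" using n e \<open>X \<in> Obj C\<close> by simp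
  finally have "null_arr C (Plus C g n \<cdot> e)" using e \<open>X \<in> Obj C\<close> by simp
  then have "null_arr C (Plus C g n)"
    by (rule null [rotated -1]) (use g n(1) e in \<open>simp_all add: Hom_iff\<close>)
  moreover have "null_arr C (Plus C h n)" using n(2) e \<open>X \<in> Obj C\<close> by simp
  ultimately show "g = h" using g h n(1) eq_if_null_difference [of g h n] by (simp add: Hom_iff)
qed

section \<open>Kernels and cokernels\<close>

lemma is_kernel_Arr:
  assumes "is_kernel C k f"
  shows "k \<in> Arr C" "f \<in> Arr C" "Cod C k = Dom C f" "null_arr C (f \<cdot> k)"
  using assms by (auto simp: is_kernel_def)

lemma is_cokernel_Arr:
  assumes "is_cokernel C c f"
  shows "c \<in> Arr C" "f \<in> Arr C" "Dom C c = Cod C f" "null_arr C (c \<cdot> f)"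
  using assms by (auto simp: is_cokernel_def)

lemma kernel_lift:
  assumes "is_kernel C k f" "g \<in> Arr C" "Cod C g = Dom C f" "null_arr C (f \<cdot> g)"
  obtains h where "h \<in> Arr C" "Dom C h = Dom C g" "Cod C h = Dom C k" "k \<cdot> h = g"
proof -
  have "f \<in> Arr C" using assms(1) by (simp add: is_kernel_Arr)
  then have "f \<cdot> g = Zero C (Dom C g) (Cod C f)" using assms by (intro null_arr_eq) simp_all
  moreover have "g \<in> Hom C (Dom C g) (Dom C f)" using assms by (simp add: Hom_iff)
  ultimately have "\<exists>!h. h \<in> Hom C (Dom C g) (Dom C k) \<and> k \<cdot> h = g"
    using assms(1,2) unfolding is_kernel_def by simp
  then show ?thesis using that by (auto simp: Hom_iff)
qed

lemma cokernel_lift: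
  assumes "is_cokernel C c f" "g \<in> Arr C" "Dom C g = Cod C f" "null_arr C (g \<cdot> f)"
  obtains h where "h \<in> Arr C" "Dom C h = Cod C c" "Cod C h = Cod C g" "h \<cdot> c = g"
proof -
  have "f \<in> Arr C" using assms(1) by (simp add: is_cokernel_Arr)
  then have "g \<cdot> f = Zero C (Dom C f) (Cod C g)" using assms by (intro null_arr_eq) simp_all
  moreover have "g \<in> Hom C (Cod C f) (Cod C g)" using assms by (simp add: Hom_iff)
  ultimately have "\<exists>!h. h \<in> Hom C (Cod C c) (Cod C g) \<and> h \<cdot> c = g"
    using assms(1,2) unfolding is_cokernel_def by simp
  then show ?thesis using that by (auto simp: Hom_iff)
qed

text \<open>If \<open>k \<cdot> g\<close> is null, then \<open>g\<close> and a zero arrow both lift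
  the same zero arrow through \<open>k\<close>, and lifts are unique.\<close>

lemma kernel_monic:
  assumes k: "is_kernel C k f"
  shows "monic C k"
proof (rule monicI)
  note kf = is_kernel_Arr [OF k]
  show "k \<in> Arr C" by (rule kf)
  fix g assume g: "g \<in> Arr C" "Cod C g = Dom C k" "null_arr C (k \<cdot> g)"
  then have kg: "k \<cdot> g = Zero C (Dom C g) (Dom C f)" using kf by (intro null_arr_eq) simp_all
  have "Zero C (Dom C g) (Dom C f) \<in> Hom C (Dom C g) (Dom C f)" using g kf by (simp add: Hom_iff)
  moreover have "f \<cdot> Zero C (Dom C g) (Dom C f) = Zero C (Dom C g) (Cod C f)" using g kf by simp
  ultimately have "\<exists>!h. h \<in> Hom C (Dom C g) (Dom C k) \<and> k \<cdot> h = Zero C (Dom C g) (Dom C f)"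
    using k g(1) unfolding is_kernel_def by simp
  moreover have "g \<in> Hom C (Dom C g) (Dom C k)" "Zero C (Dom C g) (Dom C k) \<in> Hom C (Dom C g) (Dom C k)"
    using g kf by (simp_all add: Hom_iff)
  moreover have "k \<cdot> Zero C (Dom C g) (Dom C k) = Zero C (Dom C g) (Dom C f)" using g kf by simp
  ultimately have "g = Zero C (Dom C g) (Dom C k)" using kg by blast
  then show "null_arr C g" by (rule null_arrI) (use g kf in simp_all)
qed

lemma cokernel_epic:
  assumes c: "is_cokernel C c f"
  shows "epic C c"
proof (rule epicI)
  note cf = is_cokernel_Arr [OF c]
  show "c \<in> Arr C" by (rule cf)
  fix g assume g: "g \<in> Arr C" "Dom C g = Cod C c" "null_arr C (g \<cdot> c)"
  then have gc: "g \<cdot> c = Zero C (Cod C f) (Cod C g)" using cf by (intro null_arr_eq) simp_all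
  have "Zero C (Cod C f) (Cod C g) \<in> Hom C (Cod C f) (Cod C g)" using g cf by (simp add: Hom_iff)
  moreover have "Zero C (Cod C f) (Cod C g) \<cdot> f = Zero C (Dom C f) (Cod C g)" using g cf by simp
  ultimately have "\<exists>!h. h \<in> Hom C (Cod C c) (Cod C g) \<and> h \<cdot> c = Zero C (Cod C f) (Cod C g)"
    using c g(1) unfolding is_cokernel_def by simp
  moreover have "g \<in> Hom C (Cod C c) (Cod C g)" "Zero C (Cod C c) (Cod C g) \<in> Hom C (Cod C c) (Cod C g)"
    using g cf by (simp_all add: Hom_iff)
  moreover have "Zero C (Cod C c) (Cod C g) \<cdot> c = Zero C (Cod C f) (Cod C g)" using g cf by simp
  ultimately have "g = Zero C (Cod C c) (Cod C g)" using gc by blast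
  then show "null_arr C g" by (rule null_arrI) (use g cf in simp_all)
qed

text \<open>Uniqueness of the lift is what \<open>monic C k\<close> supplies, so only its existence
  has to be checked.\<close>

lemma is_kernelI:
  assumes m: "monic C k" and f: "f \<in> Arr C" "Cod C k = Dom C f" "null_arr C (f \<cdot> k)"
    and lift: "\<And>g. g \<in> Arr C \<Longrightarrow> Cod C g = Dom C f \<Longrightarrow> null_arr C (f \<cdot> g) \<Longrightarrow>
      \<exists>h \<in> Arr C. Dom C h = Dom C g \<and> Cod C h = Dom C k \<and> k \<cdot> h = g"
  shows "is_kernel C k f"
  unfolding is_kernel_def
proof (intro conjI ballI impI)
  have k: "k \<in> Arr C" using m by (rule monic_Arr)
  then show "k \<in> Arr C" .
  show "f \<cdot> k = Zero C (Dom C k) (Cod C f)" using k f by (intro null_arr_eq) simp_all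
  fix X g assume "X \<in> Obj C" "g \<in> Hom C X (Dom C f)" "f \<cdot> g = Zero C X (Cod C f)"
  then have "\<exists>h \<in> Arr C. Dom C h = Dom C g \<and> Cod C h = Dom C k \<and> k \<cdot> h = g"
    using f by (intro lift) (auto simp: Hom_iff)
  then obtain h where h: "h \<in> Hom C X (Dom C k)" "k \<cdot> h = g"
    using \<open>g \<in> _\<close> by (auto simp: Hom_iff)
  show "\<exists>!h. h \<in> Hom C X (Dom C k) \<and> k \<cdot> h = g"
  proof (rule ex1I [of _ h])
    fix h' assume "h' \<in> Hom C X (Dom C k) \<and> k \<cdot> h' = g"
    then show "h' = h" by (intro monic_cancel [OF m, of h' h]) (use h in \<open>simp_all add: Hom_iff\<close>)
  qed (use h in simp)
qed (use f in auto)

lemma is_cokernelI: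
  assumes e: "epic C c" and f: "f \<in> Arr C" "Dom C c = Cod C f" "null_arr C (c \<cdot> f)"
    and lift: "\<And>g. g \<in> Arr C \<Longrightarrow> Dom C g = Cod C f \<Longrightarrow> null_arr C (g \<cdot> f) \<Longrightarrow>
      \<exists>h \<in> Arr C. Dom C h = Cod C c \<and> Cod C h = Cod C g \<and> h \<cdot> c = g"
  shows "is_cokernel C c f"
  unfolding is_cokernel_def
proof (intro conjI ballI impI)
  have c: "c \<in> Arr C" using e by (rule epic_Arr)
  then show "c \<in> Arr C" .
  show "c \<cdot> f = Zero C (Dom C f) (Cod C c)" using c f by (intro null_arr_eq) simp_all
  fix X g assume "X \<in> Obj C" "g \<in> Hom C (Cod C f) X" "g \<cdot> f = Zero C (Dom C f) X"
  then have "\<exists>h \<in> Arr C. Dom C h = Cod C c \<and> Cod C h = Cod C g \<and> h \<cdot> c = g"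
    using f by (intro lift) (auto simp: Hom_iff)
  then obtain h where h: "h \<in> Hom C (Cod C c) X" "h \<cdot> c = g"
    using \<open>g \<in> _\<close> by (auto simp: Hom_iff)
  show "\<exists>!h. h \<in> Hom C (Cod C c) X \<and> h \<cdot> c = g"
  proof (rule ex1I [of _ h])
    fix h' assume "h' \<in> Hom C (Cod C c) X \<and> h' \<cdot> c = g"
    then show "h' = h" by (intro epic_cancel [OF e, of h' h]) (use h in \<open>simp_all add: Hom_iff\<close>)
  qed (use h in simp)
qed (use f in auto)

lemma monic_comp: "monic C m \<Longrightarrow> monic C n \<Longrightarrow> Cod C n = Dom C m \<Longrightarrow> monic C (m \<cdot> n)"
proof (rule monicI)
  assume m: "monic C m" and n: "monic C n" "Cod C n = Dom C m"
  note a = monic_Arr [OF m] monic_Arr [OF n(1)]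
  then show "m \<cdot> n \<in> Arr C" using n by simp
  fix g assume g: "g \<in> Arr C" "Cod C g = Dom C (m \<cdot> n)" "null_arr C ((m \<cdot> n) \<cdot> g)"
  then have "null_arr C (n \<cdot> g)" using monic_null [OF m, of "n \<cdot> g"] a n by simp
  then show "null_arr C g" using monic_null [OF n(1), of g] a n g by simp
qed

lemma epic_comp: "epic C e \<Longrightarrow> epic C d \<Longrightarrow> Cod C d = Dom C e \<Longrightarrow> epic C (e \<cdot> d)"
proof (rule epicI)
  assume e: "epic C e" and d: "epic C d" "Cod C d = Dom C e"
  note a = epic_Arr [OF e] epic_Arr [OF d(1)]
  then show "e \<cdot> d \<in> Arr C" using d by simp
  fix g assume g: "g \<in> Arr C" "Dom C g = Cod C (e \<cdot> d)" "null_arr C (g \<cdot> (e \<cdot> d))"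
  then have "null_arr C ((g \<cdot> e) \<cdot> d)" using a d by simp
  then have "null_arr C (g \<cdot> e)" using epic_null [OF d(1), of "g \<cdot> e"] a d g by simp
  then show "null_arr C g" using epic_null [OF e, of g] a d g by simp
qed

section \<open>Isomorphisms and zero objects\<close>

lemma iso_monic:
  assumes "iso_arr C f" shows "monic C f"
proof (rule monicI)
  obtain h where f: "f \<in> Arr C" and h: "h \<in> Arr C" "Dom C h = Cod C f" "Cod C h = Dom C f"
    "h \<cdot> f = Ident C (Dom C f)" using assms by (auto simp: iso_arr_def Hom_iff)
  show "f \<in> Arr C" by (rule f)
  fix g assume g: "g \<in> Arr C" "Cod C g = Dom C f" "null_arr C (f \<cdot> g)"
  have "null_arr C (h \<cdot> (f \<cdot> g))" by (rule null_comp_right) (use f h g in simp_all)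
  moreover have "h \<cdot> (f \<cdot> g) = g" using comp_left [OF h(4)] f g h(1-3) by simp
  ultimately show "null_arr C g" by simp
qed

lemma iso_epic:
  assumes "iso_arr C f" shows "epic C f"
proof (rule epicI)
  obtain h where f: "f \<in> Arr C" and h: "h \<in> Arr C" "Dom C h = Cod C f" "Cod C h = Dom C f"
    "f \<cdot> h = Ident C (Cod C f)" using assms by (auto simp: iso_arr_def Hom_iff)
  show "f \<in> Arr C" by (rule f)
  fix g assume g: "g \<in> Arr C" "Dom C g = Cod C f" "null_arr C (g \<cdot> f)"
  have "null_arr C ((g \<cdot> f) \<cdot> h)" by (rule null_comp_left) (use f h g in simp_all)
  moreover have "(g \<cdot> f) \<cdot> h = g" using f g h by simp
  ultimately show "null_arr C g" by simp
qed

lemma iso_inverse: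
  assumes "iso_arr C f"
  obtains g where "iso_arr C g" "Dom C g = Cod C f" "Cod C g = Dom C f"
    "g \<cdot> f = Ident C (Dom C f)" "f \<cdot> g = Ident C (Cod C f)"
proof -
  obtain g where "g \<in> Arr C" "Dom C g = Cod C f" "Cod C g = Dom C f"
    "g \<cdot> f = Ident C (Dom C f)" "f \<cdot> g = Ident C (Cod C f)" "f \<in> Arr C"
    using assms by (auto simp: iso_arr_def Hom_iff)
  moreover from this have "iso_arr C g"
    unfolding iso_arr_def by (intro conjI bexI [of _ f]) (simp_all add: Hom_iff)
  ultimately show ?thesis using that by blast
qed

lemma isomorphic_iff: "isomorphic C X Y \<longleftrightarrow> (\<exists>f. iso_arr C f \<and> Dom C f = X \<and> Cod C f = Y)"
proof -
  have "f \<in> Arr C" if "iso_arr C f" for f using that by (simp add: iso_arr_def)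
  then show ?thesis by (auto simp add: isomorphic_def Hom_iff)
qed

lemma isomorphic_sym: "isomorphic C X Y \<Longrightarrow> isomorphic C Y X"
proof -
  assume "isomorphic C X Y"
  then obtain f where f: "iso_arr C f" "Dom C f = X" "Cod C f = Y" unfolding isomorphic_iff by blast
  show ?thesis 
  proof (rule iso_inverse [OF f(1)])
    fix g assume "iso_arr C g" "Dom C g = Cod C f" "Cod C g = Dom C f"
    then show ?thesis unfolding isomorphic_iff by (intro exI [of _ g]) (simp add: f)
  qed
qed

lemma isomorphic_refl: "X \<in> Obj C \<Longrightarrow> isomorphic C X X"
  unfolding isomorphic_iff iso_arr_def
  by (intro exI [of _ "Ident C X"] conjI bexI [of _ "Ident C X"]) (simp_all add: Hom_iff)

lemma iso_comp:
  assumes f: "iso_arr C f" and g: "iso_arr C g" and fg: "Cod C f = Dom C g"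
  shows "iso_arr C (g \<cdot> f)"
proof -
  obtain f' where f': "iso_arr C f'" "Dom C f' = Cod C f" "Cod C f' = Dom C f"
    "f' \<cdot> f = Ident C (Dom C f)" "f \<cdot> f' = Ident C (Cod C f)" using iso_inverse [OF f] .
  obtain g' where g': "iso_arr C g'" "Dom C g' = Cod C g" "Cod C g' = Dom C g"
    "g' \<cdot> g = Ident C (Dom C g)" "g \<cdot> g' = Ident C (Cod C g)" using iso_inverse [OF g] .
  have a: "f \<in> Arr C" "g \<in> Arr C" "f' \<in> Arr C" "g' \<in> Arr C"
    using f g f' g' by (auto simp: iso_arr_def)
  have 1: "(f' \<cdot> g') \<cdot> (g \<cdot> f) = Ident C (Dom C f)"
    using a f' g' fg comp_left [OF g'(4), of f] by simp
  have 2: "(g \<cdot> f) \<cdot> (f' \<cdot> g') = Ident C (Cod C g)"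
    using a f' g' fg comp_left [OF f'(5), of g'] by simp
  show ?thesis unfolding iso_arr_def
    by (intro conjI bexI [of _ "f' \<cdot> g'"]) (use a f' g' fg 1 2 in \<open>simp_all add: Hom_iff\<close>)
qed

lemma isomorphic_trans: "isomorphic C X Y \<Longrightarrow> isomorphic C Y Z \<Longrightarrow> isomorphic C X Z"
proof -
  assume "isomorphic C X Y" "isomorphic C Y Z"
  then obtain f g where f: "iso_arr C f" "Dom C f = X" "Cod C f = Y"
    and g: "iso_arr C g" "Dom C g = Y" "Cod C g = Z" by (auto simp: isomorphic_iff)
  have "f \<in> Arr C" "g \<in> Arr C" using f(1) g(1) by (simp_all add: iso_arr_def)
  then have "iso_arr C (g \<cdot> f) \<and> Dom C (g \<cdot> f) = X \<and> Cod C (g \<cdot> f) = Z"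
    using f g iso_comp by simp
  then show ?thesis by (auto simp: isomorphic_iff simp del: comp_Arr)
qed

text \<open>Every arrow into or out of \<open>Z\<close> factors through the identity of
  \<open>Z\<close>, so a null identity makes all of them null.\<close>

lemma zero_obj_iff:
  "zero_obj C Z \<longleftrightarrow> Z \<in> Obj C \<and> null_arr C (Ident C Z)"
proof
  assume Z: "zero_obj C Z"
  then have "Z \<in> Obj C" "\<exists>!f. f \<in> Hom C Z Z" by (auto simp: zero_obj_def)
  moreover from this have "Ident C Z \<in> Hom C Z Z" "Zero C Z Z \<in> Hom C Z Z"
    by (simp_all add: Hom_iff)
  ultimately have "Ident C Z = Zero C Z Z" by blast
  then have "null_arr C (Ident C Z)" by (rule null_arrI) (use \<open>Z \<in> Obj C\<close> in simp_all)
  then show "Z \<in> Obj C \<and> null_arr C (Ident C Z)" using \<open>Z \<in> Obj C\<close> by simp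
next
  assume Z: "Z \<in> Obj C \<and> null_arr C (Ident C Z)"
  show "zero_obj C Z" unfolding zero_obj_def
  proof (intro conjI ballI)
    fix X assume X: "X \<in> Obj C"
    show "\<exists>!f. f \<in> Hom C Z X"
    proof (rule ex1I [of _ "Zero C Z X"])
      fix f assume "f \<in> Hom C Z X"
      then have "null_arr C f" using Z null_comp_right [of "Ident C Z" f] by (simp add: Hom_iff)
      then show "f = Zero C Z X" by (rule null_arr_eq) (use \<open>f \<in> Hom C Z X\<close> in \<open>simp_all add: Hom_iff\<close>)
    qed (use X Z in \<open>simp add: Hom_iff\<close>)
    show "\<exists>!f. f \<in> Hom C X Z"
    proof (rule ex1I [of _ "Zero C X Z"])
      fix f assume "f \<in> Hom C X Z"
      then have "null_arr C f" using Z null_comp_left [of "Ident C Z" f] by (simp add: Hom_iff)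
      then show "f = Zero C X Z" by (rule null_arr_eq) (use \<open>f \<in> Hom C X Z\<close> in \<open>simp_all add: Hom_iff\<close>)
    qed (use X Z in \<open>simp add: Hom_iff\<close>)
  qed (use Z in simp)
qed

lemma null_if_zero_Dom: "zero_obj C (Dom C f) \<Longrightarrow> f \<in> Arr C \<Longrightarrow> null_arr C f"
  using null_comp_right [of "Ident C (Dom C f)" f] by (simp add: zero_obj_iff)

lemma null_if_zero_Cod: "zero_obj C (Cod C f) \<Longrightarrow> f \<in> Arr C \<Longrightarrow> null_arr C f"
  using null_comp_left [of "Ident C (Cod C f)" f] by (simp add: zero_obj_iff)

lemma null_monic_zero: "monic C m \<Longrightarrow> null_arr C m \<Longrightarrow> zero_obj C (Dom C m)"
  using monic_null [of m "Ident C (Dom C m)"] by (simp add: zero_obj_iff monic_Arr)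

lemma null_epic_zero: "epic C e \<Longrightarrow> null_arr C e \<Longrightarrow> zero_obj C (Cod C e)"
  using epic_null [of e "Ident C (Cod C e)"] by (simp add: zero_obj_iff epic_Arr)

lemma zero_obj_isomorphic:
  assumes "zero_obj C X" "isomorphic C X Y"
  shows "zero_obj C Y"
proof -
  obtain f where f: "iso_arr C f" "Dom C f = X" "Cod C f = Y"
    using assms(2) by (auto simp: isomorphic_iff)
  then have "epic C f" using iso_epic by simp
  moreover from this have "null_arr C f" using epic_Arr null_if_zero_Dom [of f] assms f by simp
  ultimately show ?thesis using null_epic_zero [of f] f by simp
qed

end

section \<open>Abelian categories\<close>

context preadditive_category
begin

lemma monic_right_factor:
  assumes "monic C (m \<cdot> n)" "m \<in> Arr C" "n \<in> Arr C" "Cod C n = Dom C m"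
  shows "monic C n"
proof (rule monicI)
  fix g assume g: "g \<in> Arr C" "Cod C g = Dom C n" "null_arr C (n \<cdot> g)"
  have "null_arr C (m \<cdot> (n \<cdot> g))" by (rule null_comp_right) (use assms g in simp_all)
  then show "null_arr C g" by (intro monic_null [OF assms(1), of g]) (use assms g in simp_all)
qed (use assms in simp)

lemma epic_left_factor:
  assumes "epic C (e \<cdot> d)" "e \<in> Arr C" "d \<in> Arr C" "Cod C d = Dom C e"
  shows "epic C e"
proof (rule epicI)
  fix g assume g: "g \<in> Arr C" "Dom C g = Cod C e" "null_arr C (g \<cdot> e)"
  have "null_arr C ((g \<cdot> e) \<cdot> d)" by (rule null_comp_left) (use assms g in simp_all)
  then show "null_arr C g" by (intro epic_null [OF assms(1), of g]) (use assms g in simp_all)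
qed (use assms in simp)

lemma isoI:
  assumes "f \<in> Arr C" "g \<in> Arr C" "Dom C g = Cod C f" "Cod C g = Dom C f"
    "g \<cdot> f = Ident C (Dom C f)" "f \<cdot> g = Ident C (Cod C f)"
  shows "iso_arr C f"
  unfolding iso_arr_def using assms by (intro conjI bexI [of _ g]) (simp_all add: Hom_iff)

lemma cokernel_unique:
  assumes k: "is_cokernel C k f" and l: "is_cokernel C l f"
  shows "isomorphic C (Cod C k) (Cod C l)"
proof -
  note a = is_cokernel_Arr [OF k] is_cokernel_Arr [OF l]
  obtain h where h: "h \<in> Arr C" "Dom C h = Cod C k" "Cod C h = Cod C l" "h \<cdot> k = l"
    using cokernel_lift [OF k, of l] a by auto
  obtain g where g: "g \<in> Arr C" "Dom C g = Cod C l" "Cod C g = Cod C k" "g \<cdot> l = k"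
    using cokernel_lift [OF l, of k] a by auto
  have "g \<cdot> h = Ident C (Dom C h)"
    by (rule epic_cancel [OF cokernel_epic [OF k]]) (use a g h in simp_all)
  moreover have "h \<cdot> g = Ident C (Cod C h)"
    by (rule epic_cancel [OF cokernel_epic [OF l]]) (use a g h in simp_all)
  ultimately have "iso_arr C h" using g h by (intro isoI [of h g]) simp_all
  then show ?thesis using h by (auto simp: isomorphic_iff)
qed

text \<open>Provides the difference of \<open>f\<close> and \<open>g\<close> with the two facts that
  the pullback construction relies on: which arrows it kills, and its value on arrows killed by
  \<open>g\<close>.\<close>

lemma ex_difference:
  assumes "f \<in> Arr C" "g \<in> Arr C" "Dom C f = Dom C g" "Cod C f = Cod C g"
  obtains d where "d \<in> Arr C" "Dom C d = Dom C g" "Cod C d = Cod C g"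
    "\<And>t. t \<in> Arr C \<Longrightarrow> Cod C t = Dom C g \<Longrightarrow> null_arr C (d \<cdot> t) \<longleftrightarrow> f \<cdot> t = g \<cdot> t"
    "\<And>t. t \<in> Arr C \<Longrightarrow> Cod C t = Dom C g \<Longrightarrow> null_arr C (g \<cdot> t) \<Longrightarrow> d \<cdot> t = f \<cdot> t"
proof -
  obtain n where n: "n \<in> Arr C" "Dom C n = Dom C g" "Cod C n = Cod C g"
    and gn: "Plus C g n = Zero C (Dom C g) (Cod C g)"
    using ex_negative [OF assms(2)] by (auto simp: Hom_iff)
  let ?d = "Plus C f n"
  have dt: "?d \<cdot> t = Plus C (f \<cdot> t) (n \<cdot> t)" if "t \<in> Arr C" "Cod C t = Dom C g" for t
    by (rule Plus_comp) (use that n assms in simp_all)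
  have gnt: "Plus C (g \<cdot> t) (n \<cdot> t) = Zero C (Dom C t) (Cod C g)"
    if "t \<in> Arr C" "Cod C t = Dom C g" for t
  proof -
    have "Plus C (g \<cdot> t) (n \<cdot> t) = Plus C g n \<cdot> t"
      by (rule Plus_comp [symmetric]) (use that n assms in simp_all)
    then show ?thesis using gn that assms by simp
  qed
  show ?thesis
  proof (rule that [of ?d])
    fix t assume t: "t \<in> Arr C" "Cod C t = Dom C g"
    have ngn: "null_arr C (Plus C (g \<cdot> t) (n \<cdot> t))" using gnt [OF t] t assms by simp
    show "null_arr C (?d \<cdot> t) \<longleftrightarrow> f \<cdot> t = g \<cdot> t"
    proof
      assume "null_arr C (?d \<cdot> t)"
      then have "null_arr C (Plus C (f \<cdot> t) (n \<cdot> t))" using dt [OF t] by simp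
      then show "f \<cdot> t = g \<cdot> t"
        by (intro eq_if_null_difference [OF _ _ _ _ _ _ _ ngn]) (use t n assms in simp_all)
    next
      assume "f \<cdot> t = g \<cdot> t"
      then show "null_arr C (?d \<cdot> t)" using dt [OF t] ngn by simp
    qed
    assume "null_arr C (g \<cdot> t)"
    then have "g \<cdot> t = Zero C (Dom C t) (Cod C g)" by (rule null_arr_eq) (use t assms in simp_all)
    then have "n \<cdot> t = Zero C (Dom C t) (Cod C g)" using gnt [OF t] t n by simp
    then show "?d \<cdot> t = f \<cdot> t" using dt [OF t] t assms by simp
  qed (use assms n in simp_all)
qed

end

text \<open>Here \<open>b\<close> is the base change of \<open>q\<close> along \<open>g\<close>, and
  \<open>a\<close> that of \<open>g\<close> along \<open>q\<close>. The universal property is split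
  into a joint lift and joint cancellation, so that each half can be used alone.\<close>

definition pullback :: "('o, 'm) ab_category \<Rightarrow> 'm \<Rightarrow> 'm \<Rightarrow> 'm \<Rightarrow> 'm \<Rightarrow> bool" where
  "pullback C a b q g \<longleftrightarrow> a \<in> Arr C \<and> b \<in> Arr C \<and> q \<in> Arr C \<and> g \<in> Arr C \<and>
     Cod C q = Cod C g \<and> Dom C a = Dom C b \<and> Cod C a = Dom C q \<and> Cod C b = Dom C g \<and>
     q \<cdot>\<^bsub>C\<^esub> a = g \<cdot>\<^bsub>C\<^esub> b \<and>
     (\<forall>x \<in> Arr C. \<forall>y \<in> Arr C. Dom C x = Dom C y \<and> Cod C x = Dom C q \<and> Cod C y = Dom C g \<and>
        q \<cdot>\<^bsub>C\<^esub> x = g \<cdot>\<^bsub>C\<^esub> y \<longrightarrow>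
        (\<exists>h \<in> Arr C. Dom C h = Dom C x \<and> Cod C h = Dom C a \<and> a \<cdot>\<^bsub>C\<^esub> h = x \<and> b \<cdot>\<^bsub>C\<^esub> h = y)) \<and>
     (\<forall>x \<in> Arr C. \<forall>y \<in> Arr C. Dom C x = Dom C y \<and> Cod C x = Dom C a \<and> Cod C y = Dom C a \<and>
        a \<cdot>\<^bsub>C\<^esub> x = a \<cdot>\<^bsub>C\<^esub> y \<and> b \<cdot>\<^bsub>C\<^esub> x = b \<cdot>\<^bsub>C\<^esub> y \<longrightarrow> x = y)"

section \<open>Normality, images and pullbacks\<close>

context abelian_category
begin

text \<open>\<open>m\<close> is the kernel of some \<open>f\<close> by normality. As
  \<open>f\<close> kills \<open>m\<close>, it factors through \<open>c\<close>, so whatever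
  \<open>c\<close> kills is killed by \<open>f\<close> and lifts through \<open>m\<close>.\<close>

lemma monic_kernel:
  assumes m: "monic C m" and c: "is_cokernel C c m"
  shows "is_kernel C m c"
proof -
  obtain f where f: "is_kernel C m f" using monic_normal [OF m] by blast
  note a = is_kernel_Arr [OF f] is_cokernel_Arr [OF c]
  obtain h where h: "h \<in> Arr C" "Dom C h = Cod C c" "Cod C h = Cod C f" "h \<cdot> c = f"
    using cokernel_lift [OF c, of f] a by auto
  show ?thesis
  proof (rule is_kernelI [OF m])
    fix g assume g: "g \<in> Arr C" "Cod C g = Dom C c" "null_arr C (c \<cdot> g)"
    have "null_arr C (h \<cdot> (c \<cdot> g))" by (rule null_comp_right) (use g h a in simp_all)
    moreover have "h \<cdot> (c \<cdot> g) = f \<cdot> g" by (rule comp_left [OF h(4)]) (use g h a in simp_all)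
    ultimately have "null_arr C (f \<cdot> g)" by simp
    then obtain t where "t \<in> Arr C" "Dom C t = Dom C g" "Cod C t = Dom C m" "m \<cdot> t = g"
      using kernel_lift [OF f g(1)] g(2) a by auto
    then show "\<exists>h \<in> Arr C. Dom C h = Dom C g \<and> Cod C h = Dom C m \<and> m \<cdot> h = g"
      by (intro bexI [of _ t]) simp_all
  qed (use a in simp_all)
qed

lemma epic_cokernel:
  assumes e: "epic C e" and k: "is_kernel C k e"
  shows "is_cokernel C e k"
proof -
  obtain f where f: "is_cokernel C e f" using epic_normal [OF e] by blast
  note a = is_cokernel_Arr [OF f] is_kernel_Arr [OF k]
  obtain h where h: "h \<in> Arr C" "Dom C h = Dom C f" "Cod C h = Dom C k" "k \<cdot> h = f"
    using kernel_lift [OF k, of f] a by auto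
  show ?thesis
  proof (rule is_cokernelI [OF e])
    fix g assume g: "g \<in> Arr C" "Dom C g = Cod C k" "null_arr C (g \<cdot> k)"
    have "null_arr C ((g \<cdot> k) \<cdot> h)" by (rule null_comp_left) (use g h a in simp_all)
    then have "null_arr C (g \<cdot> f)" using g h a by simp
    then obtain t where "t \<in> Arr C" "Dom C t = Cod C e" "Cod C t = Cod C g" "t \<cdot> e = g"
      using cokernel_lift [OF f g(1)] g(2) a by auto
    then show "\<exists>h \<in> Arr C. Dom C h = Cod C e \<and> Cod C h = Cod C g \<and> h \<cdot> e = g"
      by (intro bexI [of _ t]) simp_all
  qed (use a in simp_all)
qed

lemma short_exact_epic: "epic C e \<Longrightarrow> is_kernel C k e \<Longrightarrow> short_exact C k e"
  by (simp add: short_exact_def epic_cokernel)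

lemma short_exact_monic: "monic C m \<Longrightarrow> is_cokernel C c m \<Longrightarrow> short_exact C m c"
  by (simp add: short_exact_def monic_kernel)

lemma short_exactD:
  assumes "short_exact C m e"
  shows "is_kernel C m e" "is_cokernel C e m" "monic C m" "epic C e" "m \<in> Arr C" "e \<in> Arr C"
    "Cod C m = Dom C e" "null_arr C (e \<cdot> m)"
proof -
  show k: "is_kernel C m e" and c: "is_cokernel C e m" using assms by (simp_all add: short_exact_def)
  show "monic C m" "epic C e" using kernel_monic [OF k] cokernel_epic [OF c] by simp_all
  show "m \<in> Arr C" "e \<in> Arr C" "Cod C m = Dom C e" "null_arr C (e \<cdot> m)" using is_kernel_Arr [OF k] by simp_all
qed

text \<open>\<open>m\<close> is the kernel of some \<open>f\<close>, and an epic \<open>m\<close>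
  forces \<open>f\<close> to be null. Hence the identity lifts through \<open>m\<close> to a right
  inverse, which cancelling \<open>m\<close> shows to be a left inverse too.\<close>

lemma iso_monic_epic:
  assumes m: "monic C m" and e: "epic C m"
  shows "iso_arr C m"
proof -
  have ma: "m \<in> Arr C" using m by (rule monic_Arr)
  obtain f where f: "is_kernel C m f" using monic_normal [OF m] by blast
  note a = is_kernel_Arr [OF f]
  have "null_arr C f" by (rule epic_null [OF e]) (use a in simp_all)
  then have "null_arr C (f \<cdot> Ident C (Cod C m))" using a by simp
  then obtain h where h: "h \<in> Arr C" "Dom C h = Cod C m" "Cod C h = Dom C m" "m \<cdot> h = Ident C (Cod C m)"
    using kernel_lift [OF f, of "Ident C (Cod C m)"] a by auto
  have "h \<cdot> m = Ident C (Dom C m)"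
    by (rule monic_cancel [OF m]) (use h ma comp_left [OF h(4), of m] in simp_all)
  then show ?thesis using h ma by (intro isoI [of m h]) simp_all
qed

text \<open>The monic part is the kernel of the cokernel of \<open>f\<close>.\<close>

lemma image:
  assumes f: "f \<in> Arr C"
  obtains e m where "epic C e" "monic C m" "Dom C e = Dom C f" "Cod C e = Dom C m"
    "Cod C m = Cod C f" "m \<cdot> e = f"
proof -
  obtain c where c: "is_cokernel C c f" using ex_cokernel [OF f] by blast
  note ca = is_cokernel_Arr [OF c]
  obtain m where m: "is_kernel C m c" using ex_kernel ca by blast
  note ma = is_kernel_Arr [OF m]
  have mm: "monic C m" using m by (rule kernel_monic)
  obtain e where e: "e \<in> Arr C" "Dom C e = Dom C f" "Cod C e = Dom C m" "m \<cdot> e = f"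
    using kernel_lift [OF m, of f] ca by auto
  have "epic C e"
  proof (rule epicI)
    fix u assume u: "u \<in> Arr C" "Dom C u = Cod C e" "null_arr C (u \<cdot> e)"
    \<comment> \<open>As \<open>u\<close> kills \<open>e\<close>, the arrow \<open>f\<close> factors
      through the subobject \<open>m \<cdot> k\<close>. The cokernel \<open>d\<close> of that
      subobject kills \<open>f\<close>, so it factors through \<open>c\<close> and kills
      \<open>m\<close>. Hence \<open>m\<close> factors through \<open>m \<cdot> k\<close>, which
      gives \<open>k\<close> a right inverse and makes \<open>u\<close> null.\<close>
    obtain k where k: "is_kernel C k u" using ex_kernel u by blast
    note ka = is_kernel_Arr [OF k]
    obtain e' where e': "e' \<in> Arr C" "Dom C e' = Dom C e" "Cod C e' = Dom C k" "k \<cdot> e' = e"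
      using kernel_lift [OF k, of e] e u by auto
    have mk: "monic C (m \<cdot> k)" by (rule monic_comp [OF mm kernel_monic [OF k]]) (use ka u e in simp)
    obtain d where d: "is_cokernel C d (m \<cdot> k)" using ex_cokernel mk monic_Arr by blast
    note da = is_cokernel_Arr [OF d]
    have dd: "Dom C d = Cod C m" using da ka ma u e by simp
    have "f = (m \<cdot> k) \<cdot> e'" using e e' ka ma u by simp
    then have "d \<cdot> f = (d \<cdot> (m \<cdot> k)) \<cdot> e'" using da ka ma u e e' dd by simp
    moreover have "null_arr C ((d \<cdot> (m \<cdot> k)) \<cdot> e')"
      by (rule null_comp_left [OF da(4)]) (use da(1,3) ka ma u e e' dd in simp_all)
    ultimately have "null_arr C (d \<cdot> f)" by simp
    then obtain d' where d': "d' \<in> Arr C" "Dom C d' = Cod C c" "Cod C d' = Cod C d" "d' \<cdot> c = d"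
      using cokernel_lift [OF c, of d] da dd ca ma by auto
    have "null_arr C (d' \<cdot> (c \<cdot> m))" by (rule null_comp_right [OF ma(4)]) (use d' ma ca in simp_all)
    moreover have "d' \<cdot> (c \<cdot> m) = d \<cdot> m" by (rule comp_left [OF d'(4)]) (use d' ma ca in simp_all)
    ultimately have "null_arr C (d \<cdot> m)" by simp
    then obtain s where s: "s \<in> Arr C" "Dom C s = Dom C m" "Cod C s = Dom C (m \<cdot> k)" "(m \<cdot> k) \<cdot> s = m"
      using kernel_lift [OF monic_kernel [OF mk d], of m] ma dd by auto
    have ks: "k \<cdot> s = Ident C (Dom C m)"
      by (rule monic_cancel [OF mm]) (use s ma ka u e in simp_all)
    have "null_arr C ((u \<cdot> k) \<cdot> s)" by (rule null_comp_left [OF ka(4)]) (use s ka ma u e in simp_all)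
    moreover have "(u \<cdot> k) \<cdot> s = u" using s ka ma u e ks by simp
    ultimately show "null_arr C u" by simp
  qed (use e in simp)
  then show ?thesis using that [OF _ mm] e ma ca by simp
qed

text \<open>The pullback is the kernel of the difference of \<open>q \<cdot> p\<close> and
  \<open>g \<cdot> r\<close> on a biproduct of the two domains.\<close>

lemma ex_pullback:
  assumes qg: "q \<in> Arr C" "g \<in> Arr C" "Cod C q = Cod C g"
  shows "\<exists>a b. pullback C a b q g"
proof -
  obtain P i j p r where bp: "biproduct C (Dom C q) (Dom C g) P i j p r"
    using ex_biproduct [of "Dom C q" "Dom C g"] qg by auto
  then have P: "P \<in> Obj C" and i: "i \<in> Arr C" "Dom C i = Dom C q" "Cod C i = P"
    and j: "j \<in> Arr C" "Dom C j = Dom C g" "Cod C j = P"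
    and p: "p \<in> Arr C" "Dom C p = P" "Cod C p = Dom C q"
    and r: "r \<in> Arr C" "Dom C r = P" "Cod C r = Dom C g"
    and eqs: "p \<cdot> i = Ident C (Dom C q)" "r \<cdot> j = Ident C (Dom C g)"
      "p \<cdot> j = Zero C (Dom C g) (Dom C q)" "r \<cdot> i = Zero C (Dom C q) (Dom C g)"
      "Plus C (i \<cdot> p) (j \<cdot> r) = Ident C P"
    by (auto simp: biproduct_def Hom_iff)
  have "q \<cdot> p \<in> Arr C" "g \<cdot> r \<in> Arr C" "Dom C (q \<cdot> p) = Dom C (g \<cdot> r)" "Cod C (q \<cdot> p) = Cod C (g \<cdot> r)"
    using qg p r by simp_all
  then obtain d where d: "d \<in> Arr C" "Dom C d = P" "Cod C d = Cod C q"
    and eq: "\<And>t. t \<in> Arr C \<Longrightarrow> Cod C t = P \<Longrightarrow> null_arr C (d \<cdot> t) \<longleftrightarrow> (q \<cdot> p) \<cdot> t = (g \<cdot> r) \<cdot> t"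
    by (rule ex_difference) (use qg p r in auto)
  obtain k where k: "is_kernel C k d" using ex_kernel [OF d(1)] by blast
  note ka = is_kernel_Arr [OF k]
  have kP: "Cod C k = P" using ka d by simp
  have "pullback C (p \<cdot> k) (r \<cdot> k) q g"
    unfolding pullback_def
  proof (intro conjI ballI impI)
    show "q \<cdot> (p \<cdot> k) = g \<cdot> (r \<cdot> k)" using eq [of k] ka kP qg p r by simp
  next
    fix x y assume xy: "x \<in> Arr C" "y \<in> Arr C"
      "Dom C x = Dom C y \<and> Cod C x = Dom C q \<and> Cod C y = Dom C g \<and> q \<cdot> x = g \<cdot> y"
    let ?h = "Plus C (i \<cdot> x) (j \<cdot> y)"
    have h: "?h \<in> Arr C" "Dom C ?h = Dom C x" "Cod C ?h = P" using xy i j by simp_all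
    have "p \<cdot> ?h = Plus C (p \<cdot> (i \<cdot> x)) (p \<cdot> (j \<cdot> y))" by (rule comp_Plus) (use xy i j p in simp_all)
    then have ph: "p \<cdot> ?h = x"
      using comp_left [OF eqs(1), of x] comp_left [OF eqs(3), of y] xy i j p qg by simp
    have "r \<cdot> ?h = Plus C (r \<cdot> (i \<cdot> x)) (r \<cdot> (j \<cdot> y))" by (rule comp_Plus) (use xy i j r in simp_all)
    then have rh: "r \<cdot> ?h = y"
      using comp_left [OF eqs(2), of y] comp_left [OF eqs(4), of x] xy i j r qg by simp
    have "null_arr C (d \<cdot> ?h)" using eq [OF h(1,3)] ph rh qg p r h xy by simp
    then obtain t where t: "t \<in> Arr C" "Dom C t = Dom C x" "Cod C t = Dom C k" "k \<cdot> t = ?h"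
      using kernel_lift [OF k h(1)] h d by auto
    show "\<exists>h \<in> Arr C. Dom C h = Dom C x \<and> Cod C h = Dom C (p \<cdot> k) \<and> (p \<cdot> k) \<cdot> h = x \<and> (r \<cdot> k) \<cdot> h = y"
      by (rule bexI [of _ t]) (use t ph rh p r ka kP in simp_all)
  next
    fix x y assume xy: "x \<in> Arr C" "y \<in> Arr C"
      "Dom C x = Dom C y \<and> Cod C x = Dom C (p \<cdot> k) \<and> Cod C y = Dom C (p \<cdot> k) \<and>
       (p \<cdot> k) \<cdot> x = (p \<cdot> k) \<cdot> y \<and> (r \<cdot> k) \<cdot> x = (r \<cdot> k) \<cdot> y"
    \<comment> \<open>The biproduct identity rebuilds \<open>k \<cdot> z\<close> from its two
      components, so equal components give equal arrows after cancelling the monic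
      \<open>k\<close>.\<close>
    have *: "k \<cdot> z = Plus C (i \<cdot> ((p \<cdot> k) \<cdot> z)) (j \<cdot> ((r \<cdot> k) \<cdot> z))"
      if "z \<in> Arr C" "Cod C z = Dom C (p \<cdot> k)" for z
    proof -
      have "k \<cdot> z = Plus C (i \<cdot> p) (j \<cdot> r) \<cdot> (k \<cdot> z)" using that eqs ka kP p by simp
      also have "\<dots> = Plus C ((i \<cdot> p) \<cdot> (k \<cdot> z)) ((j \<cdot> r) \<cdot> (k \<cdot> z))"
        by (rule Plus_comp) (use that ka kP i j p r in simp_all)
      finally show ?thesis using that ka kP i j p r by simp
    qed
    have "k \<cdot> x = k \<cdot> y" using * [of x] * [of y] xy by simp
    then show "x = y" by (intro monic_cancel [OF kernel_monic [OF k], of x y]) (use xy ka kP p in simp_all)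
  qed (use qg p r ka kP in simp_all)
  then show ?thesis by blast
qed

lemma pullbackD:
  assumes "pullback C a b q g"
  shows "a \<in> Arr C" "b \<in> Arr C" "q \<in> Arr C" "g \<in> Arr C" "Cod C q = Cod C g" "Dom C a = Dom C b"
    "Cod C a = Dom C q" "Cod C b = Dom C g" "q \<cdot> a = g \<cdot> b"
  using assms by (simp_all add: pullback_def)

lemma pullback_lift:
  assumes pb: "pullback C a b q g" and x: "x \<in> Arr C" and y: "y \<in> Arr C"
    and xy: "Dom C x = Dom C y" "Cod C x = Dom C q" "Cod C y = Dom C g" "q \<cdot> x = g \<cdot> y"
  obtains h where "h \<in> Arr C" "Dom C h = Dom C x" "Cod C h = Dom C a" "a \<cdot> h = x" "b \<cdot> h = y"
proof -
  have "\<forall>x \<in> Arr C. \<forall>y \<in> Arr C. Dom C x = Dom C y \<and> Cod C x = Dom C q \<and> Cod C y = Dom C g \<and>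
        q \<cdot> x = g \<cdot> y \<longrightarrow>
        (\<exists>h \<in> Arr C. Dom C h = Dom C x \<and> Cod C h = Dom C a \<and> a \<cdot> h = x \<and> b \<cdot> h = y)"
    using pb unfolding pullback_def by (elim conjE)
  from this [rule_format, OF x y] show ?thesis using xy that by auto
qed

lemma pullback_unique:
  assumes pb: "pullback C a b q g" and x: "x \<in> Arr C" and y: "y \<in> Arr C"
    and xy: "Dom C x = Dom C y" "Cod C x = Dom C a" "Cod C y = Dom C a" "a \<cdot> x = a \<cdot> y" "b \<cdot> x = b \<cdot> y"
  shows "x = y"
proof -
  have "\<forall>x \<in> Arr C. \<forall>y \<in> Arr C. Dom C x = Dom C y \<and> Cod C x = Dom C a \<and> Cod C y = Dom C a \<and>
        a \<cdot> x = a \<cdot> y \<and> b \<cdot> x = b \<cdot> y \<longrightarrow> x = y"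
    using pb unfolding pullback_def by (elim conjE)
  from this [rule_format, OF x y] show ?thesis using xy by simp
qed

lemma pullback_sym:
  assumes pb: "pullback C a b q g"
  shows "pullback C b a g q"
  unfolding pullback_def
proof (intro conjI ballI impI)
  fix x y assume x: "x \<in> Arr C" and y: "y \<in> Arr C"
    and xy: "Dom C x = Dom C y \<and> Cod C x = Dom C g \<and> Cod C y = Dom C q \<and> g \<cdot> x = q \<cdot> y"
  show "\<exists>h \<in> Arr C. Dom C h = Dom C x \<and> Cod C h = Dom C b \<and> b \<cdot> h = x \<and> a \<cdot> h = y"
  proof (rule pullback_lift [OF pb y x])
    fix h assume "h \<in> Arr C" "Dom C h = Dom C y" "Cod C h = Dom C a" "a \<cdot> h = y" "b \<cdot> h = x"
    then show ?thesis using xy pullbackD(6) [OF pb] by (intro bexI [of _ h]) simp_all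
  qed (use xy in simp_all)
next
  fix x y assume x: "x \<in> Arr C" and y: "y \<in> Arr C"
    and xy: "Dom C x = Dom C y \<and> Cod C x = Dom C b \<and> Cod C y = Dom C b \<and> b \<cdot> x = b \<cdot> y \<and> a \<cdot> x = a \<cdot> y"
  show "x = y" by (rule pullback_unique [OF pb x y]) (use xy pullbackD(6) [OF pb] in simp_all)
qed (use pullbackD [OF pb] in simp_all)

text \<open>On the biproduct of the domains, the difference \<open>d\<close> of
  \<open>q \<cdot> p\<close> and \<open>g \<cdot> r\<close> restricts to \<open>q\<close> on the
  first summand. It is therefore epic, hence the cokernel of its own kernel.\<close>

lemma pullback_epic:
  assumes pb: "pullback C a b q g" and q: "epic C q"
  shows "epic C b"
proof -
  note qg = pullbackD(1-8) [OF pb]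
  obtain P i j p r where bp: "biproduct C (Dom C q) (Dom C g) P i j p r"
    using ex_biproduct [of "Dom C q" "Dom C g"] qg by auto
  then have P: "P \<in> Obj C" and i: "i \<in> Arr C" "Dom C i = Dom C q" "Cod C i = P"
    and j: "j \<in> Arr C" "Dom C j = Dom C g" "Cod C j = P"
    and p: "p \<in> Arr C" "Dom C p = P" "Cod C p = Dom C q"
    and r: "r \<in> Arr C" "Dom C r = P" "Cod C r = Dom C g"
    and eqs: "p \<cdot> i = Ident C (Dom C q)" "r \<cdot> j = Ident C (Dom C g)"
      "r \<cdot> i = Zero C (Dom C q) (Dom C g)"
    by (auto simp: biproduct_def Hom_iff)
  have "q \<cdot> p \<in> Arr C" "g \<cdot> r \<in> Arr C" "Dom C (q \<cdot> p) = Dom C (g \<cdot> r)" "Cod C (q \<cdot> p) = Cod C (g \<cdot> r)"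
    using qg p r by simp_all
  then obtain d where d: "d \<in> Arr C" "Dom C d = P" "Cod C d = Cod C q"
    and eq: "\<And>t. t \<in> Arr C \<Longrightarrow> Cod C t = P \<Longrightarrow> null_arr C (d \<cdot> t) \<longleftrightarrow> (q \<cdot> p) \<cdot> t = (g \<cdot> r) \<cdot> t"
    and dt: "\<And>t. t \<in> Arr C \<Longrightarrow> Cod C t = P \<Longrightarrow> null_arr C ((g \<cdot> r) \<cdot> t) \<Longrightarrow> d \<cdot> t = (q \<cdot> p) \<cdot> t"
    by (rule ex_difference) (use qg p r in auto)
  have di: "d \<cdot> i = q" using dt [of i] i p r qg eqs by simp
  have "epic C (d \<cdot> i)" using di q by simp
  then have ed: "epic C d" by (rule epic_left_factor) (use d i in simp_all)
  obtain k where k: "is_kernel C k d" using ex_kernel [OF d(1)] by blast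
  note ka = is_kernel_Arr [OF k]
  have kP: "Cod C k = P" using ka d by simp
  have "q \<cdot> (p \<cdot> k) = g \<cdot> (r \<cdot> k)" using eq [of k] ka kP qg p r by simp
  then obtain h where h: "h \<in> Arr C" "Dom C h = Dom C k" "Cod C h = Dom C a" "b \<cdot> h = r \<cdot> k"
    using pullback_lift [OF pb, of "p \<cdot> k" "r \<cdot> k"] ka kP p r by auto
  show ?thesis
  proof (rule epicI)
    fix u assume u: "u \<in> Arr C" "Dom C u = Cod C b" "null_arr C (u \<cdot> b)"
    \<comment> \<open>Since \<open>u\<close> kills \<open>b\<close>, it kills the second component
      of \<open>k\<close>, so \<open>u \<cdot> r\<close> descends along \<open>d\<close> to some
      \<open>v\<close>. On the first summand this says that \<open>v \<cdot> q\<close> is null, so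
      \<open>v\<close> is null; on the second summand it returns \<open>u\<close>.\<close>
    have "null_arr C ((u \<cdot> b) \<cdot> h)" by (rule null_comp_left [OF u(3)]) (use u h qg in simp_all)
    then have "null_arr C ((u \<cdot> r) \<cdot> k)" using u h qg r ka kP by simp
    then obtain v where v: "v \<in> Arr C" "Dom C v = Cod C d" "Cod C v = Cod C u" "v \<cdot> d = u \<cdot> r"
      using cokernel_lift [OF epic_cokernel [OF ed k], of "u \<cdot> r"] u r qg kP by auto
    have "v \<cdot> (d \<cdot> i) = (u \<cdot> r) \<cdot> i" by (rule comp_left [OF v(4)]) (use v d i in simp_all)
    then have "v \<cdot> q = u \<cdot> (r \<cdot> i)" using di u r qg i by simp
    then have "null_arr C (v \<cdot> q)" using eqs u qg by simp
    then have "null_arr C v" by (intro epic_null [OF q, of v]) (use v d qg in simp_all)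
    then have "null_arr C (v \<cdot> (d \<cdot> j))" by (rule null_comp_left) (use v d j in simp_all)
    moreover have "v \<cdot> (d \<cdot> j) = (u \<cdot> r) \<cdot> j" by (rule comp_left [OF v(4)]) (use v d j in simp_all)
    moreover have "(u \<cdot> r) \<cdot> j = u" using u r qg j eqs by simp
    ultimately show "null_arr C u" by simp
  qed (use qg in simp)
qed

text \<open>The kernel of \<open>b\<close> is the arrow with components \<open>k\<close> and zero:
  an arrow killed by \<open>b\<close> is determined by its composite with \<open>a\<close>, which
  \<open>q\<close> kills.\<close>

lemma pullback_kernel:
  assumes pb: "pullback C a b q g" and k: "is_kernel C k q"
  obtains j where "is_kernel C j b" "Dom C j = Dom C k" "a \<cdot> j = k"
proof -
  note qg = pullbackD(1-8) [OF pb] and sq = pullbackD(9) [OF pb]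
  note ka = is_kernel_Arr [OF k]
  have "q \<cdot> k = Zero C (Dom C k) (Cod C q)" by (rule null_arr_eq [OF ka(4)]) (use ka in simp_all)
  then have "q \<cdot> k = g \<cdot> Zero C (Dom C k) (Dom C g)" using qg ka by simp
  then obtain j where j: "j \<in> Arr C" "Dom C j = Dom C k" "Cod C j = Dom C a" "a \<cdot> j = k"
    "b \<cdot> j = Zero C (Dom C k) (Dom C g)"
    using pullback_lift [OF pb, of k "Zero C (Dom C k) (Dom C g)"] ka qg by auto
  have mj: "monic C j" by (rule monic_right_factor [of a]) (use j qg kernel_monic [OF k] in simp_all)
  have "is_kernel C j b"
  proof (rule is_kernelI [OF mj])
    show "null_arr C (b \<cdot> j)" using j ka qg by simp
    fix h assume h: "h \<in> Arr C" "Cod C h = Dom C b" "null_arr C (b \<cdot> h)"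
    have "q \<cdot> (a \<cdot> h) = (g \<cdot> b) \<cdot> h" by (rule comp_left [OF sq]) (use h qg in simp_all)
    then have "q \<cdot> (a \<cdot> h) = g \<cdot> (b \<cdot> h)" using h qg by simp
    then have "null_arr C (q \<cdot> (a \<cdot> h))" using h qg by simp
    then obtain s where s: "s \<in> Arr C" "Dom C s = Dom C h" "Cod C s = Dom C k" "k \<cdot> s = a \<cdot> h"
      using kernel_lift [OF k, of "a \<cdot> h"] h qg by auto
    have "j \<cdot> s = h"
    proof (rule pullback_unique [OF pb])
      show "a \<cdot> (j \<cdot> s) = a \<cdot> h" using comp_left [OF j(4), of s] s j(1-3) qg by simp
      have "b \<cdot> (j \<cdot> s) = Zero C (Dom C k) (Dom C g) \<cdot> s"
        by (rule comp_left [OF j(5)]) (use s j qg in simp_all)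
      also have "\<dots> = Zero C (Dom C h) (Dom C g)" using s qg by simp
      also have "\<dots> = b \<cdot> h" by (rule null_arr_eq [OF h(3), symmetric]) (use h qg in simp_all)
      finally show "b \<cdot> (j \<cdot> s) = b \<cdot> h" .
    qed (use s j h qg in simp_all)
    then show "\<exists>t \<in> Arr C. Dom C t = Dom C h \<and> Cod C t = Dom C j \<and> j \<cdot> t = h"
      by (intro bexI [of _ s]) (use s j in simp_all)
  qed (use j qg in simp_all)
  then show ?thesis using that j by blast
qed

text \<open>The arrow \<open>p\<close> from the kernel of \<open>d \<cdot> c\<close> to the kernel
  of \<open>d\<close> is the base change of \<open>c\<close> along \<open>kd\<close>, so it is epic
  and its kernel has the same domain as that of \<open>c\<close>.\<close>

lemma kernel_comp_exact:
  assumes c: "epic C c" and d: "d \<in> Arr C" "Dom C d = Cod C c"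
    and kc: "is_kernel C kc c" and kd: "is_kernel C kd d" and k: "is_kernel C k (d \<cdot> c)"
  obtains j p where "short_exact C j p" "Dom C j = Dom C kc" "Cod C j = Dom C k" "Cod C p = Dom C kd"
    "k \<cdot> j = kc"
proof -
  note a = is_kernel_Arr [OF kc] is_kernel_Arr [OF kd] is_kernel_Arr [OF k]
  have ka: "Cod C k = Dom C c" using a d by simp
  have "null_arr C (d \<cdot> (c \<cdot> k))" using a d ka by simp
  then obtain p where p: "p \<in> Arr C" "Dom C p = Dom C k" "Cod C p = Dom C kd" "kd \<cdot> p = c \<cdot> k"
    using kernel_lift [OF kd, of "c \<cdot> k"] a d ka by auto
  have pb: "pullback C k p c kd"
    unfolding pullback_def
  proof (intro conjI ballI impI)
    fix x y assume xy: "x \<in> Arr C" "y \<in> Arr C"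
      "Dom C x = Dom C y \<and> Cod C x = Dom C c \<and> Cod C y = Dom C kd \<and> c \<cdot> x = kd \<cdot> y"
    have "null_arr C ((d \<cdot> kd) \<cdot> y)" by (rule null_comp_left) (use a xy in simp_all)
    then have "null_arr C ((d \<cdot> c) \<cdot> x)" using a xy d by simp
    then obtain h where h: "h \<in> Arr C" "Dom C h = Dom C x" "Cod C h = Dom C k" "k \<cdot> h = x"
      using kernel_lift [OF k, of x] xy d a by auto
    have "p \<cdot> h = y"
    proof (rule monic_cancel [OF kernel_monic [OF kd]])
      have "kd \<cdot> (p \<cdot> h) = (c \<cdot> k) \<cdot> h" by (rule comp_left [OF p(4)]) (use p h a in simp_all)
      then show "kd \<cdot> (p \<cdot> h) = kd \<cdot> y" using h a ka xy by simp
    qed (use h p xy in simp_all)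
    then show "\<exists>h \<in> Arr C. Dom C h = Dom C x \<and> Cod C h = Dom C k \<and> k \<cdot> h = x \<and> p \<cdot> h = y"
      using h by blast
  next
    fix x y assume xy: "x \<in> Arr C" "y \<in> Arr C"
      "Dom C x = Dom C y \<and> Cod C x = Dom C k \<and> Cod C y = Dom C k \<and> k \<cdot> x = k \<cdot> y \<and> p \<cdot> x = p \<cdot> y"
    then show "x = y" by (intro monic_cancel [OF kernel_monic [OF k], of x y]) simp_all
  qed (use a p ka d in simp_all)
  obtain j where j: "is_kernel C j p" "Dom C j = Dom C kc" "k \<cdot> j = kc" using pullback_kernel [OF pb kc] .
  have "short_exact C j p" using short_exact_epic [OF pullback_epic [OF pb c] j(1)] .
  then show ?thesis using that j p is_kernel_Arr [OF j(1)] by simp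
qed

end

section \<open>Length\<close>

text \<open>A relation, since nothing here excludes two lengths for one object; each step puts one
  simple factor on top, as in \<open>has_composition_series\<close>.\<close>

inductive has_length :: "('o, 'm) ab_category \<Rightarrow> 'o \<Rightarrow> nat \<Rightarrow> bool" for C where
  zero: "zero_obj C X \<Longrightarrow> has_length C X 0"
| step: "short_exact C m c \<Longrightarrow> simple_obj C (Cod C c) \<Longrightarrow> has_length C (Dom C m) n \<Longrightarrow>
    has_length C (Cod C m) (Suc n)"

definition obj_length :: "('o, 'm) ab_category \<Rightarrow> 'o \<Rightarrow> nat" where
  "obj_length C X = (LEAST n. has_length C X n)"

context abelian_category
begin

lemma monic_if_null_kernel:
  assumes k: "is_kernel C k f" and n: "null_arr C k"
  shows "monic C f"
proof (rule monicI)
  show "f \<in> Arr C" using is_kernel_Arr [OF k] by simp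
  fix g assume g: "g \<in> Arr C" "Cod C g = Dom C f" "null_arr C (f \<cdot> g)"
  obtain h where h: "h \<in> Arr C" "Dom C h = Dom C g" "Cod C h = Dom C k" "k \<cdot> h = g"
    using kernel_lift [OF k g] .
  have "null_arr C (k \<cdot> h)" by (rule null_comp_left [OF n]) (use h in simp_all)
  then show "null_arr C g" using h by simp
qed

lemma epic_if_null_cokernel:
  assumes c: "is_cokernel C c f" and n: "null_arr C c"
  shows "epic C f"
proof (rule epicI)
  show "f \<in> Arr C" using is_cokernel_Arr [OF c] by simp
  fix g assume g: "g \<in> Arr C" "Dom C g = Cod C f" "null_arr C (g \<cdot> f)"
  obtain h where h: "h \<in> Arr C" "Dom C h = Cod C c" "Cod C h = Cod C g" "h \<cdot> c = g"
    using cokernel_lift [OF c g] .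
  have "null_arr C (h \<cdot> c)" by (rule null_comp_right [OF n]) (use h in simp_all)
  then show "null_arr C g" using h by simp
qed

lemma kernel_monic_comp:
  assumes k: "is_kernel C k g" and m: "monic C m" and gm: "Cod C g = Dom C m"
  shows "is_kernel C k (m \<cdot> g)"
proof (rule is_kernelI [OF kernel_monic [OF k]])
  note a = is_kernel_Arr [OF k] monic_Arr [OF m]
  show "m \<cdot> g \<in> Arr C" "Cod C k = Dom C (m \<cdot> g)" using a gm by simp_all
  have "null_arr C (m \<cdot> (g \<cdot> k))" by (rule null_comp_right [OF a(4)]) (use a gm in simp_all)
  then show "null_arr C ((m \<cdot> g) \<cdot> k)" using a gm by simp
  fix h assume h: "h \<in> Arr C" "Cod C h = Dom C (m \<cdot> g)" "null_arr C ((m \<cdot> g) \<cdot> h)"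
  then have "null_arr C (m \<cdot> (g \<cdot> h))" "Cod C h = Dom C g" using a gm by simp_all
  then have "null_arr C (g \<cdot> h)" by (intro monic_null [OF m, of "g \<cdot> h"]) (use a h gm in simp_all)
  then obtain t where "t \<in> Arr C" "Dom C t = Dom C h" "Cod C t = Dom C k" "k \<cdot> t = h"
    using kernel_lift [OF k h(1) \<open>Cod C h = Dom C g\<close>] by blast
  then show "\<exists>t \<in> Arr C. Dom C t = Dom C h \<and> Cod C t = Dom C k \<and> k \<cdot> t = h"
    by (intro bexI [of _ t]) simp_all
qed

lemma ex_short_exact_epic:
  assumes "epic C e"
  obtains k where "short_exact C k e"
  using assms ex_kernel epic_Arr short_exact_epic by blast

lemma ex_short_exact_monic:
  assumes "monic C m"
  obtains c where "short_exact C m c"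
  using assms ex_cokernel monic_Arr short_exact_monic by blast

lemma simple_epic:
  assumes S: "simple_obj C (Cod C f)" and f: "f \<in> Arr C" "\<not> null_arr C f"
  shows "epic C f"
proof -
  obtain e m where em: "epic C e" "monic C m" "Dom C e = Dom C f" "Cod C e = Dom C m"
    "Cod C m = Cod C f" "m \<cdot> e = f" using image [OF f(1)] .
  note a = epic_Arr [OF em(1)] monic_Arr [OF em(2)]
  have "\<not> zero_obj C (Dom C m)"
  proof
    assume "zero_obj C (Dom C m)"
    then have "null_arr C m" by (rule null_if_zero_Dom) (rule a)
    then have "null_arr C (m \<cdot> e)" by (rule null_comp_left) (use a em in simp_all)
    then show False using em f by simp
  qed
  then have "iso_arr C m" using S em(2,5) by (auto simp: simple_obj_def)
  then have "epic C (m \<cdot> e)" by (intro epic_comp iso_epic em)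
  then show ?thesis using em by simp
qed

text \<open>Additivity of the length gives both monotonicity statements at once and avoids the
  Jordan-Hoelder theorem.\<close>

lemma has_length_additive:
  assumes "has_length C X n" "short_exact C m e" "Cod C m = X"
  shows "\<exists>a b. has_length C (Dom C m) a \<and> has_length C (Cod C e) b \<and> a + b = n"
  using assms
proof (induction arbitrary: m e)
  case (zero X)
  note E = short_exactD [OF zero(2)]
  have "zero_obj C (Dom C m)"
    by (rule null_monic_zero [OF E(3)], rule null_if_zero_Cod) (use zero E in simp_all)
  moreover have "zero_obj C (Cod C e)"
    by (rule null_epic_zero [OF E(4)], rule null_if_zero_Dom) (use zero E in simp_all)
  ultimately show ?case using has_length.zero by force
next
  case (step k c n)
  note K = short_exactD [OF step(1)] and E = short_exactD [OF step(5)]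
  have mk: "Cod C m = Cod C k" by (rule step(6))
  have cm: "c \<cdot> m \<in> Arr C" "Dom C (c \<cdot> m) = Dom C m" "Cod C (c \<cdot> m) = Cod C c"
    using K E mk by simp_all
  show ?case
  proof (cases "null_arr C (c \<cdot> m)")
    case True
    \<comment> \<open>Here \<open>m\<close> factors through \<open>k\<close>, so the simple factor
      survives in \<open>Cod C e\<close>. The kernel of the induced \<open>c'\<close> is the factor
      of \<open>Dom C k\<close> by \<open>Dom C m\<close>, to which the induction hypothesis
      applies.\<close>
    obtain c' where c': "c' \<in> Arr C" "Dom C c' = Cod C e" "Cod C c' = Cod C c" "c' \<cdot> e = c"
      using cokernel_lift [OF E(2) K(6) _ True] K E mk by auto
    have "epic C (c' \<cdot> e)" using K c' by simp
    then have "epic C c'" by (rule epic_left_factor) (use c' E in simp_all)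
    then obtain k' where k': "short_exact C k' c'" by (rule ex_short_exact_epic)
    note K' = short_exactD [OF k']
    have "is_kernel C k (c' \<cdot> e)" using K c' by simp
    then obtain j p where jp: "short_exact C j p" "Dom C j = Dom C m" "Cod C j = Dom C k" "Cod C p = Dom C k'"
      by (rule kernel_comp_exact [OF E(4) c'(1,2) E(1) K'(1)])
    obtain a b where ab: "has_length C (Dom C m) a" "has_length C (Dom C k') b" "a + b = n"
      using step.IH [OF jp(1)] jp by auto
    have "has_length C (Cod C k') (Suc b)"
      by (rule has_length.step [OF k' _ ab(2)]) (use step c' in simp)
    then have "has_length C (Cod C e) (Suc b)" using K' c' by simp
    then show ?thesis using ab by (intro exI [of _ a] exI [of _ "Suc b"]) simp
  next
    case False
    \<comment> \<open>Now the simple factor is a factor of \<open>Dom C m\<close>. The kernel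
      \<open>l\<close> represents the intersection of the subobjects \<open>m\<close> and
      \<open>k\<close>.\<close>
    have "epic C (c \<cdot> m)" by (rule simple_epic) (use step(2) cm False in simp_all)
    then obtain l where l: "short_exact C l (c \<cdot> m)" by (rule ex_short_exact_epic)
    note L = short_exactD [OF l]
    have lm: "Cod C l = Dom C m" using L cm by simp
    have "null_arr C (c \<cdot> (m \<cdot> l))" using L(8) L(5) lm K E mk by simp
    then obtain j where j: "j \<in> Arr C" "Dom C j = Dom C l" "Cod C j = Dom C k" "k \<cdot> j = m \<cdot> l"
      using kernel_lift [OF K(1), of "m \<cdot> l"] L(5) lm K E mk by auto
    have ek: "e \<cdot> k \<in> Arr C" "Dom C (e \<cdot> k) = Dom C k" "Cod C (e \<cdot> k) = Cod C e"
      using K E mk by simp_all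
    \<comment> \<open>Second isomorphism theorem: \<open>m\<close> and \<open>k\<close> together
      generate the middle term, so the factor of \<open>Dom C k\<close> by the intersection is still
      \<open>Cod C e\<close>.\<close>
    have "epic C (e \<cdot> k)"
    proof (rule epicI)
      fix u assume u: "u \<in> Arr C" "Dom C u = Cod C (e \<cdot> k)" "null_arr C (u \<cdot> (e \<cdot> k))"
      then have u': "u \<cdot> e \<in> Arr C" "Dom C (u \<cdot> e) = Cod C k" "null_arr C ((u \<cdot> e) \<cdot> k)"
        using ek E K mk by simp_all
      obtain v where v: "v \<in> Arr C" "Dom C v = Cod C c" "Cod C v = Cod C (u \<cdot> e)" "v \<cdot> c = u \<cdot> e"
        using cokernel_lift [OF K(2) u'] .
      have "v \<cdot> (c \<cdot> m) = (u \<cdot> e) \<cdot> m" by (rule comp_left [OF v(4)]) (use v cm K E mk in simp_all)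
      also have "\<dots> = u \<cdot> (e \<cdot> m)" using u u' E ek by simp
      finally have eq: "v \<cdot> (c \<cdot> m) = u \<cdot> (e \<cdot> m)" .
      have "null_arr C (u \<cdot> (e \<cdot> m))" by (rule null_comp_right [OF E(8)]) (use u E ek in simp_all)
      then have "null_arr C (v \<cdot> (c \<cdot> m))" using eq by simp
      then have "null_arr C v" by (intro epic_null [OF \<open>epic C (c \<cdot> m)\<close>, of v]) (use v cm in simp_all)
      then have "null_arr C (v \<cdot> c)" by (rule null_comp_left) (use v K in simp_all)
      then have "null_arr C (u \<cdot> e)" using v by simp
      then show "null_arr C u" by (intro epic_null [OF E(4), of u]) (use u ek in simp_all)
    qed (rule ek)
    moreover have "is_kernel C j (e \<cdot> k)"
    proof (rule is_kernelI)
      have "monic C (m \<cdot> l)" by (rule monic_comp [OF E(3) L(3) lm])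
      then have "monic C (k \<cdot> j)" using j by simp
      then show "monic C j" by (rule monic_right_factor) (use j K in simp_all)
      have "null_arr C ((e \<cdot> m) \<cdot> l)" by (rule null_comp_left [OF E(8)]) (use L(5) lm E in simp_all)
      then have "null_arr C (e \<cdot> (m \<cdot> l))" using E L(5) lm by simp
      then show "null_arr C ((e \<cdot> k) \<cdot> j)" using j ek E(5-7) K(5) mk by simp
      fix h assume h: "h \<in> Arr C" "Cod C h = Dom C (e \<cdot> k)" "null_arr C ((e \<cdot> k) \<cdot> h)"
      then have "k \<cdot> h \<in> Arr C" "Cod C (k \<cdot> h) = Dom C e" "null_arr C (e \<cdot> (k \<cdot> h))"
        using ek K(5) E(5-7) mk by simp_all
      then obtain t where t: "t \<in> Arr C" "Dom C t = Dom C (k \<cdot> h)" "Cod C t = Dom C m" "m \<cdot> t = k \<cdot> h"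
        by (rule kernel_lift [OF E(1)])
      have hk: "Cod C h = Dom C k" using h ek by simp
      have "null_arr C ((c \<cdot> k) \<cdot> h)" by (rule null_comp_left [OF K(8)]) (use h hk K in simp_all)
      then have "null_arr C (c \<cdot> (k \<cdot> h))" using h hk K by simp
      then have "null_arr C ((c \<cdot> m) \<cdot> t)" using t E K mk by simp
      then obtain s where s: "s \<in> Arr C" "Dom C s = Dom C t" "Cod C s = Dom C l" "l \<cdot> s = t"
        using kernel_lift [OF L(1), of t] t cm by auto
      have "j \<cdot> s = h"
      proof (rule monic_cancel [OF K(3)])
        have "k \<cdot> (j \<cdot> s) = (m \<cdot> l) \<cdot> s" by (rule comp_left [OF j(4)]) (use s j K in simp_all)
        then show "k \<cdot> (j \<cdot> s) = k \<cdot> h" using s t L(5) lm E(5) by simp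
      qed (use s j h hk t K in simp_all)
      then show "\<exists>s \<in> Arr C. Dom C s = Dom C h \<and> Cod C s = Dom C j \<and> j \<cdot> s = h"
        by (intro bexI [of _ s]) (use s t j h hk K in simp_all)
    qed (use ek j in simp_all)
    ultimately have "short_exact C j (e \<cdot> k)" by (rule short_exact_epic)
    then obtain a b where ab: "has_length C (Dom C l) a" "has_length C (Cod C e) b" "a + b = n"
      using step.IH [of j "e \<cdot> k"] j ek by auto
    have "has_length C (Cod C l) (Suc a)"
      by (rule has_length.step [OF l _ ab(1)]) (use step cm in simp)
    then show ?thesis using ab lm by (intro exI [of _ "Suc a"] exI [of _ b]) simp
  qed
qed

lemma has_length_zero: "has_length C X 0 \<Longrightarrow> zero_obj C X"
  by (cases rule: has_length.cases) auto

end

section \<open>Length as an induction measure\<close>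

context abelian_length_category
begin

lemma ex_has_length:
  assumes "X \<in> Obj C"
  shows "\<exists>n. has_length C X n"
proof -
  obtain n F m where F: "zero_obj C (F 0)" "F n = X"
    and m: "\<And>k. k < n \<Longrightarrow> m k \<in> Hom C (F k) (F (Suc k)) \<and> monic C (m k) \<and>
           (\<exists>c. is_cokernel C c (m k) \<and> simple_obj C (Cod C c))"
    using finite_length [OF assms] by (auto simp: has_composition_series_def)
  have "has_length C (F k) k" if "k \<le> n" for k
    using that
  proof (induction k)
    case 0
    then show ?case using F by (simp add: has_length.zero)
  next
    case (Suc k)
    then have mk: "m k \<in> Hom C (F k) (F (Suc k))" "monic C (m k)"
      and "\<exists>c. is_cokernel C c (m k) \<and> simple_obj C (Cod C c)" using m [of k] by simp_all
    then obtain c where c: "is_cokernel C c (m k)" "simple_obj C (Cod C c)" by blast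
    have "has_length C (Cod C (m k)) (Suc k)"
      by (rule has_length.step [OF short_exact_monic [OF mk(2) c(1)] c(2)])
        (use Suc mk in \<open>simp add: Hom_iff\<close>)
    then show ?case using mk by (simp add: Hom_iff)
  qed
  then show ?thesis using F by blast
qed

text \<open>A shortest series of the middle term splits into series of the two ends, and a nonzero
  end takes at least one step of it.\<close>

lemma obj_length_less:
  assumes E: "short_exact C m e"
  shows "\<not> zero_obj C (Cod C e) \<Longrightarrow> obj_length C (Dom C m) < obj_length C (Cod C m)"
    and "\<not> zero_obj C (Dom C m) \<Longrightarrow> obj_length C (Cod C e) < obj_length C (Cod C m)"
proof -
  have L: "has_length C (Cod C m) (obj_length C (Cod C m))"
    unfolding obj_length_def using ex_has_length [of "Cod C m"] short_exactD [OF E]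
    by (simp add: LeastI_ex)
  obtain a b where ab: "has_length C (Dom C m) a" "has_length C (Cod C e) b"
    "a + b = obj_length C (Cod C m)" using has_length_additive [OF L E refl] by auto
  have "obj_length C (Dom C m) \<le> a" "obj_length C (Cod C e) \<le> b"
    using ab by (simp_all add: obj_length_def Least_le)
  moreover have "a > 0" if "\<not> zero_obj C (Dom C m)" using that ab(1) has_length_zero by (cases a) auto
  moreover have "b > 0" if "\<not> zero_obj C (Cod C e)" using that ab(2) has_length_zero by (cases b) auto
  ultimately show "\<not> zero_obj C (Cod C e) \<Longrightarrow> obj_length C (Dom C m) < obj_length C (Cod C m)"
    and "\<not> zero_obj C (Dom C m) \<Longrightarrow> obj_length C (Cod C e) < obj_length C (Cod C m)"
    using ab(3) by linarith+
qed

text \<open>With a nonzero kernel the codomain would be strictly shorter than the domain, which is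
  the same object.\<close>

lemma epic_endo_iso:
  assumes e: "epic C e" and "Dom C e = Cod C e"
  shows "iso_arr C e"
proof -
  obtain k where k: "short_exact C k e" using ex_short_exact_epic [OF e] .
  note K = short_exactD [OF k]
  have "zero_obj C (Dom C k)"
  proof (rule ccontr)
    assume "\<not> zero_obj C (Dom C k)"
    then show False using obj_length_less(2) [OF k] K assms by simp
  qed
  then have "null_arr C k" by (rule null_if_zero_Dom) (rule K)
  then have "monic C e" by (rule monic_if_null_kernel [OF K(1)])
  then show ?thesis using e by (rule iso_monic_epic)
qed

end

section \<open>Torsion classes\<close>

context preadditive_category
begin

lemma right_perp_null:
  assumes "Cod C f \<in> right_perp C S" "f \<in> Arr C" "Dom C f \<in> S"
  shows "null_arr C f"
proof -
  have "f \<in> Hom C (Dom C f) (Cod C f)" using assms by (simp add: Hom_iff)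
  moreover have "Hom C (Dom C f) (Cod C f) = {Zero C (Dom C f) (Cod C f)}"
    using assms by (simp add: right_perp_def)
  ultimately have "f = Zero C (Dom C f) (Cod C f)" by blast
  then show ?thesis by (rule null_arrI) (use assms in simp_all)
qed

lemma left_perp_null:
  assumes "Dom C f \<in> left_perp C S" "f \<in> Arr C" "Cod C f \<in> S"
  shows "null_arr C f"
proof -
  have "f \<in> Hom C (Dom C f) (Cod C f)" using assms by (simp add: Hom_iff)
  moreover have "Hom C (Dom C f) (Cod C f) = {Zero C (Dom C f) (Cod C f)}"
    using assms by (simp add: left_perp_def)
  ultimately have "f = Zero C (Dom C f) (Cod C f)" by blast
  then show ?thesis by (rule null_arrI) (use assms in simp_all)
qed

lemma right_perp_iff:
  assumes "S \<subseteq> Obj C"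
  shows "Y \<in> right_perp C S \<longleftrightarrow>
    Y \<in> Obj C \<and> (\<forall>f \<in> Arr C. Dom C f \<in> S \<and> Cod C f = Y \<longrightarrow> null_arr C f)"
proof (intro iffI conjI ballI impI)
  assume Y: "Y \<in> right_perp C S"
  then show "Y \<in> Obj C" by (simp add: right_perp_def)
  fix f assume f: "f \<in> Arr C" "Dom C f \<in> S \<and> Cod C f = Y"
  show "null_arr C f" by (rule right_perp_null [of f S]) (use f Y in simp_all)
next
  assume Y: "Y \<in> Obj C \<and> (\<forall>f \<in> Arr C. Dom C f \<in> S \<and> Cod C f = Y \<longrightarrow> null_arr C f)"
  have "Hom C X Y = {Zero C X Y}" if X: "X \<in> S" for X
  proof (intro equalityI subsetI)
    fix f assume "f \<in> Hom C X Y"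
    then have "null_arr C f" "Dom C f = X" "Cod C f = Y" using Y X by (simp_all add: Hom_iff)
    then show "f \<in> {Zero C X Y}" using null_arr_eq by simp
  next
    fix f assume "f \<in> {Zero C X Y}"
    then show "f \<in> Hom C X Y" using X Y assms by (auto simp: Hom_iff subset_eq)
  qed
  then show "Y \<in> right_perp C S" using Y by (simp add: right_perp_def)
qed

lemma left_perp_iff:
  assumes "S \<subseteq> Obj C"
  shows "Y \<in> left_perp C S \<longleftrightarrow>
    Y \<in> Obj C \<and> (\<forall>f \<in> Arr C. Dom C f = Y \<and> Cod C f \<in> S \<longrightarrow> null_arr C f)"
proof (intro iffI conjI ballI impI)
  assume Y: "Y \<in> left_perp C S"
  then show "Y \<in> Obj C" by (simp add: left_perp_def)
  fix f assume f: "f \<in> Arr C" "Dom C f = Y \<and> Cod C f \<in> S"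
  show "null_arr C f" by (rule left_perp_null [of f S]) (use f Y in simp_all)
next
  assume Y: "Y \<in> Obj C \<and> (\<forall>f \<in> Arr C. Dom C f = Y \<and> Cod C f \<in> S \<longrightarrow> null_arr C f)"
  have "Hom C Y X = {Zero C Y X}" if X: "X \<in> S" for X
  proof (intro equalityI subsetI)
    fix f assume "f \<in> Hom C Y X"
    then have "null_arr C f" "Cod C f = X" "Dom C f = Y" using Y X by (simp_all add: Hom_iff)
    then show "f \<in> {Zero C Y X}" using null_arr_eq by simp
  next
    fix f assume "f \<in> {Zero C Y X}"
    then show "f \<in> Hom C Y X" using X Y assms by (auto simp: Hom_iff subset_eq)
  qed
  then show "Y \<in> left_perp C S" using Y by (simp add: left_perp_def)
qed

lemma right_perp_sub:
  assumes "S \<subseteq> Obj C" "monic C m" "Cod C m \<in> right_perp C S"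
  shows "Dom C m \<in> right_perp C S"
  unfolding right_perp_iff [OF assms(1)]
proof (intro conjI ballI impI)
  note a = monic_Arr [OF assms(2)]
  then show "Dom C m \<in> Obj C" by simp
  fix f assume f: "f \<in> Arr C" "Dom C f \<in> S \<and> Cod C f = Dom C m"
  then have "null_arr C (m \<cdot> f)" by (intro right_perp_null [of "m \<cdot> f" S]) (use a assms in simp_all)
  then show "null_arr C f" by (intro monic_null [OF assms(2), of f]) (use f in simp_all)
qed

lemma left_perp_factor:
  assumes "S \<subseteq> Obj C" "epic C e" "Dom C e \<in> left_perp C S"
  shows "Cod C e \<in> left_perp C S"
  unfolding left_perp_iff [OF assms(1)]
proof (intro conjI ballI impI)
  note a = epic_Arr [OF assms(2)]
  then show "Cod C e \<in> Obj C" by simp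
  fix f assume f: "f \<in> Arr C" "Dom C f = Cod C e \<and> Cod C f \<in> S"
  then have "null_arr C (f \<cdot> e)" by (intro left_perp_null [of "f \<cdot> e" S]) (use a assms in simp_all)
  then show "null_arr C f" by (intro epic_null [OF assms(2), of f]) (use f in simp_all)
qed

end

context abelian_category
begin

lemma right_perp_ext:
  assumes S: "S \<subseteq> Obj C" and E: "short_exact C m e"
    and "Dom C m \<in> right_perp C S" "Cod C e \<in> right_perp C S"
  shows "Cod C m \<in> right_perp C S"
  unfolding right_perp_iff [OF S]
proof (intro conjI ballI impI)
  note a = short_exactD [OF E]
  then show "Cod C m \<in> Obj C" by simp
  fix f assume f: "f \<in> Arr C" "Dom C f \<in> S \<and> Cod C f = Cod C m"
  then have "null_arr C (e \<cdot> f)" by (intro right_perp_null [of "e \<cdot> f" S]) (use a assms in simp_all)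
  then obtain h where h: "h \<in> Arr C" "Dom C h = Dom C f" "Cod C h = Dom C m" "m \<cdot> h = f"
    using kernel_lift [OF a(1), of f] f a by auto
  have "null_arr C h" by (rule right_perp_null [of h S]) (use h f assms in simp_all)
  then have "null_arr C (m \<cdot> h)" by (rule null_comp_right) (use h a in simp_all)
  then show "null_arr C f" using h by simp
qed

lemma left_perp_ext:
  assumes S: "S \<subseteq> Obj C" and E: "short_exact C m e"
    and "Dom C m \<in> left_perp C S" "Cod C e \<in> left_perp C S"
  shows "Cod C m \<in> left_perp C S"
  unfolding left_perp_iff [OF S]
proof (intro conjI ballI impI)
  note a = short_exactD [OF E]
  then show "Cod C m \<in> Obj C" by simp
  fix f assume f: "f \<in> Arr C" "Dom C f = Cod C m \<and> Cod C f \<in> S"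
  then have "null_arr C (f \<cdot> m)" by (intro left_perp_null [of "f \<cdot> m" S]) (use a assms in simp_all)
  then obtain h where h: "h \<in> Arr C" "Dom C h = Cod C e" "Cod C h = Cod C f" "h \<cdot> e = f"
    using cokernel_lift [OF a(2), of f] f a by auto
  have "null_arr C h" by (rule left_perp_null [of h S]) (use h f assms in simp_all)
  then have "null_arr C (h \<cdot> e)" by (rule null_comp_left) (use h a in simp_all)
  then show "null_arr C f" using h by simp
qed

lemma tors_Obj: "T \<in> tors C \<Longrightarrow> T \<subseteq> Obj C"
  by (simp add: tors_def subcategory_def)

lemma tors_factor: "T \<in> tors C \<Longrightarrow> epic C e \<Longrightarrow> Dom C e \<in> T \<Longrightarrow> Cod C e \<in> T"
  by (simp add: tors_def closed_factors_def)

lemma tors_ext: "T \<in> tors C \<Longrightarrow> short_exact C m e \<Longrightarrow> Dom C m \<in> T \<Longrightarrow> Cod C e \<in> T \<Longrightarrow> Cod C m \<in> T"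
  by (auto simp: tors_def closed_extensions_def)

lemma tors_iso:
  assumes T: "T \<in> tors C" and X: "X \<in> T" "isomorphic C X Y"
  shows "Y \<in> T"
proof -
  obtain f where f: "iso_arr C f" "Dom C f = X" "Cod C f = Y" using X by (auto simp: isomorphic_iff)
  then show ?thesis using tors_factor [OF T iso_epic [OF f(1)]] X by simp
qed

text \<open>A torsion class is nonempty, and the zero arrow from any member to \<open>Z\<close> is
  epic.\<close>

lemma tors_zero:
  assumes T: "T \<in> tors C" and Z: "zero_obj C Z"
  shows "Z \<in> T"
proof -
  obtain X where X: "X \<in> T" using T by (auto simp: tors_def subcategory_def)
  have XO: "X \<in> Obj C" "Z \<in> Obj C" using X tors_Obj [OF T] Z by (auto simp: zero_obj_iff)
  have "epic C (Zero C X Z)"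
  proof (rule epicI)
    fix g assume g: "g \<in> Arr C" "Dom C g = Cod C (Zero C X Z)"
    show "null_arr C g" by (rule null_if_zero_Dom) (use g XO Z in simp_all)
  qed (use XO in simp)
  then show ?thesis using tors_factor [OF T, of "Zero C X Z"] X XO by simp
qed

lemma left_perp_tors:
  assumes T: "T \<in> tors C" and S: "S \<subseteq> Obj C"
  shows "T \<inter> left_perp C S \<in> tors C"
proof -
  obtain Z where Z: "zero_obj C Z" using ex_zero_obj by blast
  have "null_arr C f" if "f \<in> Arr C" "Dom C f = Z \<and> Cod C f \<in> S" for f
    by (rule null_if_zero_Dom) (use Z that in simp_all)
  moreover have "Z \<in> Obj C" using Z by (simp add: zero_obj_def)
  ultimately have "Z \<in> left_perp C S" unfolding left_perp_iff [OF S] by simp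
  then have 1: "T \<inter> left_perp C S \<noteq> {}" using tors_zero [OF T Z] by blast
  have 2: "closed_factors C (T \<inter> left_perp C S)"
    unfolding closed_factors_def
  proof (intro allI impI)
    fix e assume "epic C e \<and> Dom C e \<in> T \<inter> left_perp C S"
    then show "Cod C e \<in> T \<inter> left_perp C S" using tors_factor [OF T, of e] left_perp_factor [OF S, of e] by simp
  qed
  have 3: "closed_extensions C (T \<inter> left_perp C S)"
    unfolding closed_extensions_def
  proof (intro allI impI)
    fix m e assume "short_exact C m e \<and> Dom C m \<in> T \<inter> left_perp C S \<and> Cod C e \<in> T \<inter> left_perp C S"
    then show "Cod C m \<in> T \<inter> left_perp C S" using tors_ext [OF T, of m e] left_perp_ext [OF S, of m e] by simp
  qed
  have 4: "Y \<in> T \<inter> left_perp C S" if XY: "X \<in> T \<inter> left_perp C S" "isomorphic C X Y" for X Y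
  proof -
    obtain f where f: "iso_arr C f" "Dom C f = X" "Cod C f = Y" using XY by (auto simp: isomorphic_iff)
    then have "Cod C f \<in> T \<inter> left_perp C S"
      using iso_epic [OF f(1)] XY tors_factor [OF T, of f] left_perp_factor [OF S, of f] by simp
    then show ?thesis using f by simp
  qed
  have 5: "T \<inter> left_perp C S \<subseteq> Obj C" using tors_Obj [OF T] by auto
  show ?thesis unfolding tors_def subcategory_def mem_Collect_eq by (intro conjI ballI impI 1 2 3 5) (rule 4)
qed

end

section \<open>Torsion sequences\<close>

context abelian_length_category
begin

text \<open>If \<open>X\<close> receives a nonzero map from \<open>U\<close>, its image lies in
  \<open>U\<close>, and dividing by it shortens \<open>X\<close>. The torsion part of the quotient
  is then pulled back to \<open>X\<close>.\<close>

lemma torsion_sequence: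
  assumes U: "U \<in> tors C" and X: "X \<in> Obj C"
  obtains m e where "short_exact C m e" "Cod C m = X" "Dom C m \<in> U" "Cod C e \<in> right_perp C U"
proof -
  have "\<exists>m e. short_exact C m e \<and> Cod C m = X \<and> Dom C m \<in> U \<and> Cod C e \<in> right_perp C U"
    using X
  proof (induction "obj_length C X" arbitrary: X rule: less_induct)
    case less
    show ?case
    proof (cases "X \<in> right_perp C U")
      case True
      \<comment> \<open>The sequence with zero torsion part, as the kernel of the identity has a
        zero object as domain.\<close>
      have id: "epic C (Ident C X)" by (rule epicI) (use less in simp_all)
      then obtain k where k: "short_exact C k (Ident C X)" by (rule ex_short_exact_epic)
      note K = short_exactD [OF k]
      have "null_arr C k" using K less by simp
      then have "zero_obj C (Dom C k)" by (rule null_monic_zero [OF K(3)])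
      then show ?thesis using k K True less tors_zero [OF U]
        by (intro exI [of _ k] exI [of _ "Ident C X"]) simp
    next
      case False
      then obtain f where f: "f \<in> Arr C" "Dom C f \<in> U" "Cod C f = X" "\<not> null_arr C f"
        using less by (auto simp: right_perp_iff [OF tors_Obj [OF U]])
      obtain e0 m0 where em: "epic C e0" "monic C m0" "Dom C e0 = Dom C f" "Cod C e0 = Dom C m0"
        "Cod C m0 = Cod C f" "m0 \<cdot> e0 = f" using image [OF f(1)] .
      have I: "Dom C m0 \<in> U" using tors_factor [OF U em(1)] em f by simp
      have nz: "\<not> zero_obj C (Dom C m0)"
      proof
        assume "zero_obj C (Dom C m0)"
        then have "null_arr C m0" by (rule null_if_zero_Dom) (rule monic_Arr [OF em(2)])
        then have "null_arr C (m0 \<cdot> e0)" by (rule null_comp_left) (use em epic_Arr in simp_all)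
        then show False using em f by simp
      qed
      obtain c where c: "short_exact C m0 c" using ex_short_exact_monic [OF em(2)] .
      note Cc = short_exactD [OF c]
      have "obj_length C (Cod C c) < obj_length C X" using obj_length_less(2) [OF c nz] em f by simp
      then obtain m' e' where me: "short_exact C m' e'" "Cod C m' = Cod C c" "Dom C m' \<in> U"
        "Cod C e' \<in> right_perp C U" using less.hyps [of "Cod C c"] Cc by auto
      note M = short_exactD [OF me(1)]
      \<comment> \<open>The kernel of this composite is an extension of the torsion part of
        \<open>Cod C c\<close> by the image \<open>Dom C m0\<close>, both in \<open>U\<close>, while
        the torsion-free factor is unchanged.\<close>
      have "epic C (e' \<cdot> c)" by (rule epic_comp [OF M(4) Cc(4)]) (use M me in simp)
      then obtain k where k: "short_exact C k (e' \<cdot> c)" by (rule ex_short_exact_epic)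
      note K = short_exactD [OF k]
      have dc: "Dom C e' = Cod C c" using M me by simp
      obtain j p where jp: "short_exact C j p" "Dom C j = Dom C m0" "Cod C j = Dom C k" "Cod C p = Dom C m'"
        using kernel_comp_exact [OF Cc(4) M(6) dc Cc(1) M(1) K(1)] .
      have "Dom C k \<in> U" using tors_ext [OF U jp(1)] jp I me by simp
      moreover have "Cod C k = X" "Cod C (e' \<cdot> c) = Cod C e'" using K(7) M Cc dc em f by simp_all
      ultimately show ?thesis using k me by (intro exI [of _ k] exI [of _ "e' \<cdot> c"]) simp
    qed
  qed
  then show ?thesis using that by blast
qed

end

section \<open>Left wide subcategories\<close>

context abelian_category
begin

lemma left_wideD:
  assumes "X \<in> left_wide C T"
  shows "X \<in> T" "\<And>g k. g \<in> Arr C \<Longrightarrow> Dom C g \<in> T \<Longrightarrow> Cod C g = X \<Longrightarrow> is_kernel C k g \<Longrightarrow> Dom C k \<in> T"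
  using assms by (auto simp: left_wide_def Hom_iff)

lemma left_wideI:
  assumes "X \<in> T" "\<And>g k. g \<in> Arr C \<Longrightarrow> Dom C g \<in> T \<Longrightarrow> Cod C g = X \<Longrightarrow> is_kernel C k g \<Longrightarrow> Dom C k \<in> T"
  shows "X \<in> left_wide C T"
  using assms by (auto simp: left_wide_def Hom_iff)

text \<open>Composing with \<open>m\<close> does not change kernels, so a test map into
  \<open>Dom C m\<close> becomes a test map into \<open>Cod C m\<close> with the same
  kernel.\<close>

lemma left_wide_sub:
  assumes m: "monic C m" and X: "Cod C m \<in> left_wide C T" and Y: "Dom C m \<in> T"
  shows "Dom C m \<in> left_wide C T"
proof (rule left_wideI [OF Y])
  fix g k assume g: "g \<in> Arr C" "Dom C g \<in> T" "Cod C g = Dom C m" and k: "is_kernel C k g"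
  show "Dom C k \<in> T"
    by (rule left_wideD(2) [OF X _ _ _ kernel_monic_comp [OF k m g(3)]])
      (use g monic_Arr [OF m] in simp_all)
qed

lemma left_wide_kernel:
  assumes k: "is_kernel C k f" and f: "Dom C f \<in> left_wide C T" "Cod C f \<in> left_wide C T"
  shows "Dom C k \<in> left_wide C T"
proof (rule left_wide_sub [OF kernel_monic [OF k]])
  note a = is_kernel_Arr [OF k]
  show "Cod C k \<in> left_wide C T" using a f by simp
  show "Dom C k \<in> T" by (rule left_wideD(2) [OF f(2) _ _ _ k]) (use a left_wideD(1) [OF f(1)] in simp_all)
qed

lemma left_wide_iso:
  assumes T: "T \<in> tors C" and X: "X \<in> left_wide C T" "isomorphic C X Y"
  shows "Y \<in> left_wide C T"
proof -
  obtain f where f: "iso_arr C f" "Dom C f = Y" "Cod C f = X"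
    using isomorphic_sym [OF X(2)] by (auto simp: isomorphic_iff)
  have "Y \<in> T" using tors_iso [OF T left_wideD(1) [OF X(1)] X(2)] .
  then show ?thesis using left_wide_sub [OF iso_monic [OF f(1)], of T] f X by simp
qed

text \<open>For a test map \<open>g\<close>, the kernel of \<open>e \<cdot> g\<close> lies in
  \<open>T\<close> by the condition on \<open>Cod C e\<close>. On this kernel \<open>g\<close>
  factors through \<open>Dom C m\<close>, whose condition applies next.\<close>

lemma left_wide_ext:
  assumes T: "T \<in> tors C" and E: "short_exact C m e"
    and X: "Dom C m \<in> left_wide C T" and Y: "Cod C e \<in> left_wide C T"
  shows "Cod C m \<in> left_wide C T"
proof (rule left_wideI)
  note a = short_exactD [OF E]
  show "Cod C m \<in> T" by (rule tors_ext [OF T E left_wideD(1) [OF X] left_wideD(1) [OF Y]])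
  fix g k assume g: "g \<in> Arr C" "Dom C g \<in> T" "Cod C g = Cod C m" and k: "is_kernel C k g"
  note ka = is_kernel_Arr [OF k]
  have eg: "e \<cdot> g \<in> Arr C" "Dom C (e \<cdot> g) = Dom C g" "Cod C (e \<cdot> g) = Cod C e" using a g by simp_all
  obtain l where l: "is_kernel C l (e \<cdot> g)" using ex_kernel [OF eg(1)] by blast
  note la = is_kernel_Arr [OF l]
  have lT: "Dom C l \<in> T" by (rule left_wideD(2) [OF Y _ _ _ l]) (use eg g in simp_all)
  have "g \<cdot> l \<in> Arr C" "Cod C (g \<cdot> l) = Dom C e" "null_arr C (e \<cdot> (g \<cdot> l))" using la g a eg by simp_all
  then obtain h where h: "h \<in> Arr C" "Dom C h = Dom C (g \<cdot> l)" "Cod C h = Dom C m" "m \<cdot> h = g \<cdot> l"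
    by (rule kernel_lift [OF a(1)])
  have "null_arr C (e \<cdot> (g \<cdot> k))" by (rule null_comp_right [OF ka(4)]) (use ka a g in simp_all)
  then have "null_arr C ((e \<cdot> g) \<cdot> k)" using ka a g by simp
  then obtain j where j: "j \<in> Arr C" "Dom C j = Dom C k" "Cod C j = Dom C l" "l \<cdot> j = k"
    using kernel_lift [OF l, of k] ka eg by auto
  \<comment> \<open>The factored map \<open>h\<close> has the same kernel as \<open>g\<close>: an
    arrow killed by \<open>g\<close> is killed by \<open>e \<cdot> g\<close> and so passes through
    \<open>l\<close>.\<close>
  have jh: "is_kernel C j h"
  proof (rule is_kernelI)
    have "monic C (l \<cdot> j)" using kernel_monic [OF k] j by simp
    then show "monic C j" by (rule monic_right_factor) (use j la in simp_all)
    show "Cod C j = Dom C h" using j h la eg g by simp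
    have "m \<cdot> (h \<cdot> j) = (g \<cdot> l) \<cdot> j" by (rule comp_left [OF h(4)]) (use h j la eg g a in simp_all)
    then have "m \<cdot> (h \<cdot> j) = g \<cdot> k" using j la eg g by simp
    then have "null_arr C (m \<cdot> (h \<cdot> j))" using ka by simp
    then show "null_arr C (h \<cdot> j)"
      by (intro monic_null [OF a(3), of "h \<cdot> j"]) (use h j la eg g in simp_all)
    fix x assume x: "x \<in> Arr C" "Cod C x = Dom C h" "null_arr C (h \<cdot> x)"
    have xl: "Cod C x = Dom C l" using x h la eg g by simp
    have "null_arr C (m \<cdot> (h \<cdot> x))" by (rule null_comp_right [OF x(3)]) (use x h a in simp_all)
    moreover have "m \<cdot> (h \<cdot> x) = (g \<cdot> l) \<cdot> x" by (rule comp_left [OF h(4)]) (use h x a in simp_all)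
    moreover have "(g \<cdot> l) \<cdot> x = g \<cdot> (l \<cdot> x)" using x xl la eg g by simp
    ultimately have "null_arr C (g \<cdot> (l \<cdot> x))" by simp
    then obtain t where t: "t \<in> Arr C" "Dom C t = Dom C (l \<cdot> x)" "Cod C t = Dom C k" "k \<cdot> t = l \<cdot> x"
      using kernel_lift [OF k, of "l \<cdot> x"] x xl la eg g by auto
    have "j \<cdot> t = x"
    proof (rule monic_cancel [OF kernel_monic [OF l]])
      have "l \<cdot> (j \<cdot> t) = k \<cdot> t" by (rule comp_left [OF j(4)]) (use j t la in simp_all)
      then show "l \<cdot> (j \<cdot> t) = l \<cdot> x" using t by simp
    qed (use j t x xl la in simp_all)
    then show "\<exists>t \<in> Arr C. Dom C t = Dom C x \<and> Cod C t = Dom C j \<and> j \<cdot> t = x"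
      by (intro bexI [of _ t]) (use t j x xl la in simp_all)
  qed (rule h)
  have "Dom C j \<in> T" by (rule left_wideD(2) [OF X h(1) _ h(3) jh]) (use h la lT eg g in simp)
  then show "Dom C k \<in> T" using j by simp
qed

text \<open>A test map \<open>g\<close> into the cokernel is pulled back along \<open>c\<close> to a
  test map \<open>a\<close> into \<open>Cod C f\<close> with the same kernel. The pullback lies in
  \<open>T\<close>, as an extension of \<open>Dom C g\<close> by the image of
  \<open>f\<close>.\<close>

lemma left_wide_cokernel:
  assumes T: "T \<in> tors C" and c: "is_cokernel C c f"
    and X: "Dom C f \<in> left_wide C T" and Y: "Cod C f \<in> left_wide C T"
  shows "Cod C c \<in> left_wide C T"
proof (rule left_wideI)
  note ca = is_cokernel_Arr [OF c] and ce = cokernel_epic [OF c]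
  show "Cod C c \<in> T" by (rule tors_factor [OF T ce]) (use left_wideD(1) [OF Y] ca in simp)
  fix g k assume g: "g \<in> Arr C" "Dom C g \<in> T" "Cod C g = Cod C c" and k: "is_kernel C k g"
  \<comment> \<open>Replacing \<open>f\<close> by its image shows that the kernel of
    \<open>c\<close> is a factor object of \<open>Dom C f\<close>, hence in
    \<open>T\<close>.\<close>
  obtain e m where em: "epic C e" "monic C m" "Dom C e = Dom C f" "Cod C e = Dom C m"
    "Cod C m = Cod C f" "m \<cdot> e = f" using image [OF ca(2)] .
  note ea = epic_Arr [OF em(1)] monic_Arr [OF em(2)]
  have mT: "Dom C m \<in> T" using tors_factor [OF T em(1)] em left_wideD(1) [OF X] by simp
  have "is_cokernel C c m"
  proof (rule is_cokernelI [OF ce])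
    have "null_arr C ((c \<cdot> m) \<cdot> e)" using ca(4) em ea ca(1-3) by simp
    then show "null_arr C (c \<cdot> m)" by (rule epic_null [OF em(1), rotated -1]) (use em ea ca(1-3) in simp_all)
    fix h assume h: "h \<in> Arr C" "Dom C h = Cod C m" "null_arr C (h \<cdot> m)"
    have "null_arr C ((h \<cdot> m) \<cdot> e)" by (rule null_comp_left [OF h(3)]) (use h ea em in simp_all)
    then have "null_arr C (h \<cdot> f)" using h ea em by simp
    then obtain t where "t \<in> Arr C" "Dom C t = Cod C c" "Cod C t = Cod C h" "t \<cdot> c = h"
      using cokernel_lift [OF c h(1)] h em by auto
    then show "\<exists>t \<in> Arr C. Dom C t = Cod C c \<and> Cod C t = Cod C h \<and> t \<cdot> c = h"
      by (intro bexI [of _ t]) simp_all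
  qed (use ea em ca in simp_all)
  then have mc: "is_kernel C m c" by (rule monic_kernel [OF em(2)])
  obtain a b where pb: "pullback C a b c g" using ex_pullback [OF ca(1) g(1)] g by auto
  note p = pullbackD [OF pb]
  obtain j where j: "is_kernel C j b" "Dom C j = Dom C m" using pullback_kernel [OF pb mc] .
  have "short_exact C j b" by (rule short_exact_epic [OF pullback_epic [OF pb ce] j(1)])
  then have "Cod C j \<in> T" by (rule tors_ext [OF T]) (use j mT p g in simp_all)
  then have aT: "Dom C a \<in> T" using is_kernel_Arr [OF j(1)] p by simp
  obtain l where l: "is_kernel C l a" "Dom C l = Dom C k" using pullback_kernel [OF pullback_sym [OF pb] k] .
  have "Dom C l \<in> T" by (rule left_wideD(2) [OF Y p(1) aT _ l(1)]) (use p ca in simp)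
  then show "Dom C k \<in> T" using l by simp
qed

lemma left_wide_Obj: "T \<in> tors C \<Longrightarrow> left_wide C T \<subseteq> Obj C"
  using tors_Obj left_wideD(1) by blast

lemma kernel_null_iso:
  assumes k: "is_kernel C k g" and n: "null_arr C g"
  shows "iso_arr C k"
proof (rule iso_monic_epic [OF kernel_monic [OF k]])
  note a = is_kernel_Arr [OF k]
  have "null_arr C (g \<cdot> Ident C (Dom C g))" by (rule null_comp_left [OF n]) (use a in simp_all)
  then obtain h where h: "h \<in> Arr C" "Dom C h = Dom C g" "Cod C h = Dom C k" "k \<cdot> h = Ident C (Dom C g)"
    using kernel_lift [OF k, of "Ident C (Dom C g)"] a by auto
  have "epic C (Ident C (Dom C g))" by (rule epicI) (use a in simp_all)
  then have "epic C (k \<cdot> h)" using h by simp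
  then show "epic C k" by (rule epic_left_factor) (use h a in simp_all)
qed

lemma left_wide_zero:
  assumes T: "T \<in> tors C" and Z: "zero_obj C Z"
  shows "Z \<in> left_wide C T"
proof (rule left_wideI)
  show "Z \<in> T" by (rule tors_zero [OF T Z])
  fix g k assume g: "g \<in> Arr C" "Dom C g \<in> T" "Cod C g = Z" and k: "is_kernel C k g"
  have "null_arr C g" by (rule null_if_zero_Cod) (use g Z in simp_all)
  then have "iso_arr C k" by (rule kernel_null_iso [OF k])
  then have "isomorphic C (Dom C k) (Dom C g)" using is_kernel_Arr [OF k] by (auto simp: isomorphic_iff)
  then show "Dom C k \<in> T" using tors_iso [OF T g(2) isomorphic_sym] by simp
qed

end

section \<open>Full subcategories\<close>

lemma full_sub_simps [simp]:
  "Obj (full_sub C S) = S"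
  "Arr (full_sub C S) = {f \<in> Arr C. Dom C f \<in> S \<and> Cod C f \<in> S}"
  "Dom (full_sub C S) = Dom C" "Cod (full_sub C S) = Cod C"
  "Ident (full_sub C S) = Ident C" "Comp (full_sub C S) = Comp C"
  "Plus (full_sub C S) = Plus C" "Zero (full_sub C S) = Zero C"
  by (simp_all add: full_sub_def)

lemma Hom_full_sub: "X \<in> S \<Longrightarrow> Y \<in> S \<Longrightarrow> Hom (full_sub C S) X Y = Hom C X Y"
  by (auto simp: Hom_def)

lemma Hom_full_sub_iff: "f \<in> Hom (full_sub C S) X Y \<longleftrightarrow> X \<in> S \<and> Y \<in> S \<and> f \<in> Hom C X Y"
  by (auto simp: Hom_def)

context abelian_category
begin

lemma monic_full_subI: "monic C m \<Longrightarrow> Dom C m \<in> S \<Longrightarrow> Cod C m \<in> S \<Longrightarrow> S \<subseteq> Obj C \<Longrightarrow> monic (full_sub C S) m"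
  by (auto simp: monic_def Hom_full_sub_iff)

lemma epic_full_subI: "epic C m \<Longrightarrow> Dom C m \<in> S \<Longrightarrow> Cod C m \<in> S \<Longrightarrow> S \<subseteq> Obj C \<Longrightarrow> epic (full_sub C S) m"
  by (auto simp: epic_def Hom_full_sub_iff)

text \<open>The kernel of \<open>m\<close> in the ambient category has its domain in
  \<open>S\<close>, so cancellation tested only within \<open>S\<close> already shows that it is
  null.\<close>

lemma monic_full_subD:
  assumes m: "monic (full_sub C S) m" and S: "S \<subseteq> Obj C" "closed_kernels C S"
  shows "monic C m" "Dom C m \<in> S" "Cod C m \<in> S"
proof -
  have ma: "m \<in> Arr C" and mS: "Dom C m \<in> S" "Cod C m \<in> S" using m by (auto simp: monic_def)
  then show "Dom C m \<in> S" "Cod C m \<in> S" by simp_all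
  obtain k where k: "is_kernel C k m" using ex_kernel [OF ma] by blast
  note a = is_kernel_Arr [OF k]
  have kS: "Dom C k \<in> S" using S(2) k mS unfolding closed_kernels_def by blast
  let ?z = "Zero C (Dom C k) (Dom C m)"
  have cancel: "\<forall>X \<in> S. \<forall>g \<in> Hom (full_sub C S) X (Dom C m). \<forall>h \<in> Hom (full_sub C S) X (Dom C m).
    m \<cdot> g = m \<cdot> h \<longrightarrow> g = h"
    using m by (simp add: monic_def)
  have kH: "k \<in> Hom (full_sub C S) (Dom C k) (Dom C m)" "?z \<in> Hom (full_sub C S) (Dom C k) (Dom C m)"
    using a kS mS by (simp_all add: Hom_full_sub_iff Hom_iff)
  have "m \<cdot> k = Zero C (Dom C k) (Cod C m)" by (rule null_arr_eq [OF a(4)]) (use a in simp_all)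
  then have "m \<cdot> k = m \<cdot> ?z" using a by simp
  then have "k = ?z" using cancel [rule_format, OF kS kH] by simp
  then have "null_arr C k" by (rule null_arrI) (use a in simp_all)
  then show "monic C m" by (rule monic_if_null_kernel [OF k])
qed

lemma epic_full_subD:
  assumes e: "epic (full_sub C S) e" and S: "S \<subseteq> Obj C" "closed_cokernels C S"
  shows "epic C e" "Dom C e \<in> S" "Cod C e \<in> S"
proof -
  have ea: "e \<in> Arr C" and eS: "Dom C e \<in> S" "Cod C e \<in> S" using e by (auto simp: epic_def)
  then show "Dom C e \<in> S" "Cod C e \<in> S" by simp_all
  obtain c where c: "is_cokernel C c e" using ex_cokernel [OF ea] by blast
  note a = is_cokernel_Arr [OF c]
  have cS: "Cod C c \<in> S" using S(2) c eS unfolding closed_cokernels_def by blast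
  let ?z = "Zero C (Cod C e) (Cod C c)"
  have cancel: "\<forall>X \<in> S. \<forall>g \<in> Hom (full_sub C S) (Cod C e) X. \<forall>h \<in> Hom (full_sub C S) (Cod C e) X.
    g \<cdot> e = h \<cdot> e \<longrightarrow> g = h"
    using e by (simp add: epic_def)
  have cH: "c \<in> Hom (full_sub C S) (Cod C e) (Cod C c)" "?z \<in> Hom (full_sub C S) (Cod C e) (Cod C c)"
    using a cS eS by (simp_all add: Hom_full_sub_iff Hom_iff)
  have "c \<cdot> e = Zero C (Dom C e) (Cod C c)" by (rule null_arr_eq [OF a(4)]) (use a in simp_all)
  then have "c \<cdot> e = ?z \<cdot> e" using a by simp
  then have "c = ?z" using cancel [rule_format, OF cS cH] by simp
  then have "null_arr C c" by (rule null_arrI) (use a in simp_all)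
  then show "epic C e" by (rule epic_if_null_cokernel [OF c])
qed

lemma iso_full_sub: "iso_arr (full_sub C S) f \<longleftrightarrow> iso_arr C f \<and> Dom C f \<in> S \<and> Cod C f \<in> S"
  by (auto simp: iso_arr_def Hom_full_sub_iff)

lemma isomorphic_full_sub: "isomorphic (full_sub C S) X Y \<longleftrightarrow> X \<in> S \<and> Y \<in> S \<and> isomorphic C X Y"
  by (auto simp: isomorphic_def iso_full_sub Hom_full_sub_iff Hom_iff)

lemma zero_full_sub:
  assumes "S \<subseteq> Obj C"
  shows "zero_obj (full_sub C S) Z \<longleftrightarrow> Z \<in> S \<and> zero_obj C Z"
proof
  assume Z: "zero_obj (full_sub C S) Z"
  then have ZS: "Z \<in> S" and ex: "\<exists>!f. f \<in> Hom (full_sub C S) Z Z" by (auto simp: zero_obj_def)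
  then have ZO: "Z \<in> Obj C" using assms by auto
  have "Ident C Z \<in> Hom (full_sub C S) Z Z" "Zero C Z Z \<in> Hom (full_sub C S) Z Z"
    using ZS ZO by (simp_all add: Hom_full_sub_iff Hom_iff)
  then have "Ident C Z = Zero C Z Z" using ex by blast
  then have "null_arr C (Ident C Z)" by (rule null_arrI) (rule ZO)+
  then show "Z \<in> S \<and> zero_obj C Z" using ZS ZO by (simp add: zero_obj_iff)
next
  assume "Z \<in> S \<and> zero_obj C Z"
  then show "zero_obj (full_sub C S) Z"
    using assms by (auto simp: zero_obj_def Hom_full_sub_iff subset_eq)
qed

lemma short_exact_full_subI:
  assumes E: "short_exact C m e" and S: "S \<subseteq> Obj C" "Dom C m \<in> S" "Cod C m \<in> S" "Cod C e \<in> S"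
  shows "short_exact (full_sub C S) m e"
proof -
  note a = short_exactD [OF E]
  have k: "\<forall>X \<in> Obj C. \<forall>g \<in> Hom C X (Dom C e). e \<cdot> g = Zero C X (Cod C e) \<longrightarrow>
        (\<exists>!h. h \<in> Hom C X (Dom C m) \<and> m \<cdot> h = g)" "e \<cdot> m = Zero C (Dom C m) (Cod C e)"
    using a(1) by (simp_all add: is_kernel_def)
  have c: "\<forall>X \<in> Obj C. \<forall>g \<in> Hom C (Cod C m) X. g \<cdot> m = Zero C (Dom C m) X \<longrightarrow>
        (\<exists>!h. h \<in> Hom C (Cod C e) X \<and> h \<cdot> e = g)"
    using a(2) by (simp add: is_cokernel_def)
  have DS: "Dom C e \<in> S" using a(7) S by simp
  have "is_kernel (full_sub C S) m e" unfolding is_kernel_def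
  proof (intro conjI ballI impI)
    fix X g assume X: "X \<in> Obj (full_sub C S)" and g: "g \<in> Hom (full_sub C S) X (Dom (full_sub C S) e)"
      "Comp (full_sub C S) e g = Zero (full_sub C S) X (Cod (full_sub C S) e)"
    then have "X \<in> Obj C" "X \<in> S" "g \<in> Hom C X (Dom C e)" "e \<cdot> g = Zero C X (Cod C e)"
      using S by (auto simp: Hom_full_sub_iff)
    then show "\<exists>!h. h \<in> Hom (full_sub C S) X (Dom (full_sub C S) m) \<and> Comp (full_sub C S) m h = g"
      using k(1) S by (simp add: Hom_full_sub)
  qed (use a k(2) S DS in simp_all)
  moreover have "is_cokernel (full_sub C S) e m" unfolding is_cokernel_def
  proof (intro conjI ballI impI)
    fix X g assume X: "X \<in> Obj (full_sub C S)" and g: "g \<in> Hom (full_sub C S) (Cod (full_sub C S) m) X"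
      "Comp (full_sub C S) g m = Zero (full_sub C S) (Dom (full_sub C S) m) X"
    then have "X \<in> Obj C" "X \<in> S" "g \<in> Hom C (Cod C m) X" "g \<cdot> m = Zero C (Dom C m) X"
      using S by (auto simp: Hom_full_sub_iff)
    then show "\<exists>!h. h \<in> Hom (full_sub C S) (Cod (full_sub C S) e) X \<and> Comp (full_sub C S) h e = g"
      using c S by (simp add: Hom_full_sub)
  qed (use a k(2) S DS in simp_all)
  ultimately show ?thesis by (simp add: short_exact_def)
qed

lemma left_wide_closed_kernels: "closed_kernels C (left_wide C T)"
  unfolding closed_kernels_def using left_wide_kernel by blast

lemma left_wide_closed_cokernels: "T \<in> tors C \<Longrightarrow> closed_cokernels C (left_wide C T)"
  unfolding closed_cokernels_def using left_wide_cokernel by blast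

end

section \<open>Serre subcategories and wide intervals\<close>

context abelian_category
begin

text \<open>Rephrases the Serre conditions, stated inside W_L(T), for arrows of the ambient
  category. The extension clause carries no side condition on the middle term because W_L(T) is
  closed under extensions.\<close>

lemma SerreD:
  assumes T: "T \<in> tors C" and W: "W \<in> Serre C (left_wide C T)"
  shows "W \<noteq> {}" "W \<subseteq> left_wide C T"
    "\<And>m e. short_exact C m e \<Longrightarrow> Dom C m \<in> W \<Longrightarrow> Cod C e \<in> W \<Longrightarrow> Cod C m \<in> W"
    "\<And>e. epic C e \<Longrightarrow> Dom C e \<in> W \<Longrightarrow> Cod C e \<in> left_wide C T \<Longrightarrow> Cod C e \<in> W"
    "\<And>m. monic C m \<Longrightarrow> Cod C m \<in> W \<Longrightarrow> Dom C m \<in> left_wide C T \<Longrightarrow> Dom C m \<in> W"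
    "\<And>X Y. X \<in> W \<Longrightarrow> isomorphic C X Y \<Longrightarrow> Y \<in> W"
proof -
  let ?A = "left_wide C T"
  note A = left_wide_Obj [OF T]
  have sub: "subcategory (full_sub C ?A) W" and ext: "closed_extensions (full_sub C ?A) W"
    and fac: "closed_factors (full_sub C ?A) W" and sbo: "closed_subobjects (full_sub C ?A) W"
    using W by (auto simp: Serre_def)
  show "W \<noteq> {}" and WA: "W \<subseteq> ?A" using sub by (simp_all add: subcategory_def)
  show "Cod C m \<in> W" if E: "short_exact C m e" "Dom C m \<in> W" "Cod C e \<in> W" for m e
  proof -
    have "Cod C m \<in> ?A" by (rule left_wide_ext [OF T E(1)]) (use E WA in auto)
    then have "short_exact (full_sub C ?A) m e"
      by (intro short_exact_full_subI E A) (use E WA in auto)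
    then show ?thesis using ext E by (auto simp: closed_extensions_def)
  qed
  show "Cod C e \<in> W" if e: "epic C e" "Dom C e \<in> W" "Cod C e \<in> ?A" for e
  proof -
    have "epic (full_sub C ?A) e" by (rule epic_full_subI) (use e WA A in auto)
    then show ?thesis using fac e by (auto simp: closed_factors_def)
  qed
  show "Dom C m \<in> W" if m: "monic C m" "Cod C m \<in> W" "Dom C m \<in> ?A" for m
  proof -
    have "monic (full_sub C ?A) m" by (rule monic_full_subI) (use m WA A in auto)
    then show ?thesis using sbo m by (auto simp: closed_subobjects_def)
  qed
  show "Y \<in> W" if X: "X \<in> W" "isomorphic C X Y" for X Y
  proof -
    have "X \<in> ?A" using X WA by auto
    moreover from this have "Y \<in> ?A" by (rule left_wide_iso [OF T _ X(2)])
    ultimately show ?thesis using sub X by (auto simp: subcategory_def isomorphic_full_sub)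
  qed
qed

lemma Serre_zero:
  assumes T: "T \<in> tors C" and W: "W \<in> Serre C (left_wide C T)" and Z: "zero_obj C Z"
  shows "Z \<in> W"
proof -
  obtain X where X: "X \<in> W" using SerreD(1) [OF T W] by blast
  then have XO: "X \<in> Obj C" "Z \<in> Obj C"
    using SerreD(2) [OF T W] left_wide_Obj [OF T] Z by (auto simp: zero_obj_def)
  have "epic C (Zero C X Z)"
  proof (rule epicI)
    fix g assume g: "g \<in> Arr C" "Dom C g = Cod C (Zero C X Z)"
    show "null_arr C g" by (rule null_if_zero_Dom) (use g XO Z in simp_all)
  qed (use XO in simp)
  then show ?thesis using SerreD(4) [OF T W, of "Zero C X Z"] X XO left_wide_zero [OF T Z] by simp
qed

text \<open>Kernels and cokernels formed in the ambient category stay in W_L(T), where they are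
  subobjects and factor objects of members of \<open>W\<close>.\<close>

lemma Serre_wide:
  assumes T: "T \<in> tors C" and W: "W \<in> Serre C (left_wide C T)"
  shows "wide C W"
proof -
  note S = SerreD [OF T W]
  have "W \<subseteq> Obj C" using S(2) left_wide_Obj [OF T] by blast
  then have 1: "subcategory C W" using S(1,6) unfolding subcategory_def by blast
  have 2: "closed_kernels C W" unfolding closed_kernels_def
  proof (intro allI impI)
    fix k f assume f: "is_kernel C k f \<and> Dom C f \<in> W \<and> Cod C f \<in> W"
    then have k: "is_kernel C k f" by simp
    show "Dom C k \<in> W"
    proof (rule S(5) [OF kernel_monic [OF k]])
      show "Cod C k \<in> W" using is_kernel_Arr [OF k] f by simp
      show "Dom C k \<in> left_wide C T" by (rule left_wide_kernel [OF k]) (use f S(2) in auto)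
    qed
  qed
  have 3: "closed_cokernels C W" unfolding closed_cokernels_def
  proof (intro allI impI)
    fix c f assume f: "is_cokernel C c f \<and> Dom C f \<in> W \<and> Cod C f \<in> W"
    then have c: "is_cokernel C c f" by simp
    show "Cod C c \<in> W"
    proof (rule S(4) [OF cokernel_epic [OF c]])
      show "Dom C c \<in> W" using is_cokernel_Arr [OF c] f by simp
      show "Cod C c \<in> left_wide C T" by (rule left_wide_cokernel [OF T c]) (use f S(2) in auto)
    qed
  qed
  have 4: "closed_extensions C W" unfolding closed_extensions_def
  proof (intro allI impI)
    fix m e assume "short_exact C m e \<and> Dom C m \<in> W \<and> Cod C e \<in> W"
    then show "Cod C m \<in> W" using S(3) [of m e] by simp
  qed
  show ?thesis unfolding wide_def using 1 2 3 4 by simp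
qed

lemma image_zero:
  assumes "epic C e" "monic C m" "Cod C e = Dom C m" "zero_obj C (Dom C m)"
  shows "null_arr C (m \<cdot> e)"
proof -
  have "null_arr C m" by (rule null_if_zero_Dom) (use assms monic_Arr in simp_all)
  then show ?thesis by (rule null_comp_left) (use assms epic_Arr in simp_all)
qed

end

section \<open>The correspondence of Serre subcategories and wide intervals\<close>

context abelian_length_category
begin

lemma Serre_recover:
  assumes T: "T \<in> tors C" and W: "W \<in> Serre C (left_wide C T)"
  shows "right_perp C (T \<inter> left_perp C W) \<inter> T = W"
proof (intro equalityI subsetI)
  note S = SerreD [OF T W]
  let ?U = "T \<inter> left_perp C W"
  have UO: "?U \<subseteq> Obj C" and WO: "W \<subseteq> Obj C" and TO: "T \<subseteq> Obj C"
    using tors_Obj [OF T] S(2) left_wide_Obj [OF T] by auto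
  fix X assume "X \<in> W"
  then have "X \<in> T" "X \<in> Obj C" using S(2) left_wideD(1) WO by auto
  moreover have "null_arr C f" if "f \<in> Arr C" "Dom C f \<in> ?U" "Cod C f = X" for f
    by (rule left_perp_null [of f W]) (use that \<open>X \<in> W\<close> in simp_all)
  ultimately show "X \<in> right_perp C ?U \<inter> T" by (simp add: right_perp_iff [OF UO])
next
  note S = SerreD [OF T W]
  let ?U = "T \<inter> left_perp C W"
  have UO: "?U \<subseteq> Obj C" and WO: "W \<subseteq> Obj C"
    using tors_Obj [OF T] S(2) left_wide_Obj [OF T] by auto
  fix X assume "X \<in> right_perp C ?U \<inter> T"
  then show "X \<in> W"
  proof (induction "obj_length C X" arbitrary: X rule: less_induct)
    case less
    have XO: "X \<in> Obj C" using less tors_Obj [OF T] by auto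
    show ?case
    proof (cases "X \<in> left_perp C W")
      case True
      \<comment> \<open>\<open>X\<close> lies in \<open>?U\<close> and receives no nonzero map from
        \<open>?U\<close>, so its identity is null.\<close>
      have "null_arr C (Ident C X)"
        by (rule right_perp_null [of _ ?U]) (use less True XO in simp_all)
      then show ?thesis using Serre_zero [OF T W] XO by (simp add: zero_obj_iff)
    next
      case False
      then obtain f where f: "f \<in> Arr C" "Dom C f = X" "Cod C f \<in> W" "\<not> null_arr C f"
        using XO by (auto simp: left_perp_iff [OF WO])
      obtain e m where em: "epic C e" "monic C m" "Dom C e = Dom C f" "Cod C e = Dom C m"
        "Cod C m = Cod C f" "m \<cdot> e = f" using image [OF f(1)] .
      \<comment> \<open>The image is in \<open>T\<close> as a factor of \<open>X\<close>, and in
        W_L(T) as a subobject of a member of it; only then does closure of \<open>W\<close> under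
        subobjects apply.\<close>
      have "Dom C m \<in> T" using tors_factor [OF T em(1)] less em f by simp
      then have I: "Dom C m \<in> left_wide C T"
        by (intro left_wide_sub [OF em(2)]) (use em f S(2) in auto)
      then have IW: "Cod C e \<in> W" using S(5) [OF em(2)] em f by simp
      obtain k where k: "short_exact C k e" using ex_short_exact_epic [OF em(1)] .
      note K = short_exactD [OF k]
      have "\<not> zero_obj C (Cod C e)" using image_zero [OF em(1,2,4)] em f by auto
      then have "obj_length C (Dom C k) < obj_length C X"
        using obj_length_less(1) [OF k] K em f by simp
      \<comment> \<open>The defining property of W_L(T), applied to the image, keeps the kernel in
        \<open>T\<close>.\<close>
      moreover have "Dom C k \<in> T"
        by (rule left_wideD(2) [OF I _ _ _ K(1)]) (use K em f less in simp_all)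
      moreover have "Dom C k \<in> right_perp C ?U"
        by (rule right_perp_sub [OF UO K(3)]) (use K em f less in simp)
      ultimately have "Dom C k \<in> W" using less.hyps by blast
      then have "Cod C k \<in> W" using S(3) [OF k] IW by simp
      then show ?thesis using K em f by simp
    qed
  qed
qed

text \<open>Wideness speaks only about \<open>right_perp C U \<inter> T\<close>. The torsion
  sequence for \<open>U\<close> carries questions about arbitrary objects of \<open>T\<close> over
  to their torsion-free factors, which lie there.\<close>

lemma wide_interval_Serre:
  assumes "wide_interval C U T"
  shows "right_perp C U \<inter> T \<in> Serre C (left_wide C T)"
    and "T \<inter> left_perp C (right_perp C U \<inter> T) = U"
proof -
  have U: "U \<in> tors C" and T: "T \<in> tors C" and UT: "U \<subseteq> T" and wide: "wide C (right_perp C U \<inter> T)"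
    using assms by (simp_all add: wide_interval_def)
  let ?W = "right_perp C U \<inter> T" and ?A = "left_wide C T"
  note UO = tors_Obj [OF U] and TO = tors_Obj [OF T] and A = left_wide_Obj [OF T]
  have WO: "?W \<subseteq> Obj C" using TO by auto
  have ne: "?W \<noteq> {}" and iso: "\<And>X Y. X \<in> ?W \<Longrightarrow> Y \<in> Obj C \<Longrightarrow> isomorphic C X Y \<Longrightarrow> Y \<in> ?W"
    and ker: "\<And>k f. is_kernel C k f \<Longrightarrow> Dom C f \<in> ?W \<Longrightarrow> Cod C f \<in> ?W \<Longrightarrow> Dom C k \<in> ?W"
    and coker: "\<And>c f. is_cokernel C c f \<Longrightarrow> Dom C f \<in> ?W \<Longrightarrow> Cod C f \<in> ?W \<Longrightarrow> Cod C c \<in> ?W"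
    using wide unfolding wide_def subcategory_def closed_kernels_def closed_cokernels_def by blast+
  show "T \<inter> left_perp C ?W = U"
  proof (intro equalityI subsetI)
    fix X assume X: "X \<in> T \<inter> left_perp C ?W"
    then have "X \<in> Obj C" using TO by auto
    then obtain m e where me: "short_exact C m e" "Cod C m = X" "Dom C m \<in> U" "Cod C e \<in> right_perp C U"
      using torsion_sequence [OF U] by blast
    note M = short_exactD [OF me(1)]
    \<comment> \<open>The torsion-free factor of \<open>X\<close> for \<open>U\<close> lies in
      \<open>?W\<close>, and \<open>X\<close> has no nonzero map there; so the torsion part is all
      of \<open>X\<close>.\<close>
    have "Cod C e \<in> T" using tors_factor [OF T M(4)] M me X by simp
    then have "null_arr C e" by (intro left_perp_null [of e ?W]) (use M me X in simp_all)
    then have "epic C m" by (rule epic_if_null_cokernel [OF M(2)])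
    then show "X \<in> U" using tors_factor [OF U] me by blast
  next
    fix X assume X: "X \<in> U"
    then have "X \<in> Obj C" using UO by auto
    moreover have "null_arr C f" if "f \<in> Arr C" "Dom C f = X" "Cod C f \<in> ?W" for f
      by (rule right_perp_null [of f U]) (use that X in simp_all)
    ultimately show "X \<in> T \<inter> left_perp C ?W" using X UT by (auto simp: left_perp_iff [OF WO])
  qed
  have WA: "?W \<subseteq> ?A"
  proof
    fix X assume X: "X \<in> ?W"
    show "X \<in> ?A"
    proof (rule left_wideI)
      fix g k assume g: "g \<in> Arr C" "Dom C g \<in> T" "Cod C g = X" and k: "is_kernel C k g"
      \<comment> \<open>\<open>X\<close> receives nothing from \<open>U\<close>, so \<open>g\<close>
        factors through the torsion-free factor of its domain. There the kernel lies in
        \<open>?W\<close> by wideness, and the kernel of \<open>g\<close> is an extension of it by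
        the part in \<open>U\<close>.\<close>
      obtain m c where mc: "short_exact C m c" "Cod C m = Dom C g" "Dom C m \<in> U" "Cod C c \<in> right_perp C U"
        using torsion_sequence [OF U, of "Dom C g"] g by auto
      note M = short_exactD [OF mc(1)]
      have cW: "Cod C c \<in> ?W" using tors_factor [OF T M(4)] M mc g by simp
      have "null_arr C (g \<cdot> m)" by (rule right_perp_null [of _ U]) (use M mc g X in simp_all)
      then obtain g' where g': "g' \<in> Arr C" "Dom C g' = Cod C c" "Cod C g' = Cod C g" "g' \<cdot> c = g"
        using cokernel_lift [OF M(2) g(1)] mc by auto
      obtain l where l: "is_kernel C l g'" using ex_kernel [OF g'(1)] by blast
      have lT: "Dom C l \<in> T" using ker [OF l] cW g' g X by simp
      have "is_kernel C k (g' \<cdot> c)" using k g' by simp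
      then obtain j p where jp: "short_exact C j p" "Dom C j = Dom C m" "Cod C j = Dom C k" "Cod C p = Dom C l"
        by (rule kernel_comp_exact [OF M(4) g'(1,2) M(1) l])
      have "Cod C j \<in> T" by (rule tors_ext [OF T jp(1)]) (use jp mc UT lT in auto)
      then show "Dom C k \<in> T" using jp by simp
    qed (use X in simp)
  qed
  have "subcategory (full_sub C ?A) ?W"
    unfolding subcategory_def
  proof (intro conjI ballI impI)
    fix X Y assume "X \<in> ?W" "Y \<in> Obj (full_sub C ?A)" "isomorphic (full_sub C ?A) X Y"
    then show "Y \<in> ?W" using iso [of X Y] A by (auto simp: isomorphic_full_sub)
  qed (use ne WA in simp_all)
  moreover have "closed_factors (full_sub C ?A) ?W"
    unfolding closed_factors_def
  proof (intro allI impI)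
    fix e assume "epic (full_sub C ?A) e \<and> Dom (full_sub C ?A) e \<in> ?W"
    then have e0: "epic (full_sub C ?A) e" and eW: "Dom C e \<in> ?W" by simp_all
    note e = epic_full_subD [OF e0 A left_wide_closed_cokernels [OF T]]
    obtain k where k: "short_exact C k e" using ex_short_exact_epic [OF e(1)] .
    note K = short_exactD [OF k]
    \<comment> \<open>That \<open>Cod C e\<close> is in W_L(T) puts the kernel of \<open>e\<close>
      into \<open>T\<close>, which turns \<open>Cod C e\<close> into the cokernel of an arrow
      between members of \<open>?W\<close>.\<close>
    have "Dom C k \<in> T" by (rule left_wideD(2) [OF e(3) K(6) _ refl K(1)]) (use eW in simp)
    moreover have "Dom C k \<in> right_perp C U" by (rule right_perp_sub [OF UO K(3)]) (use K eW in simp)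
    ultimately have "Cod C e \<in> ?W" by (intro coker [OF K(2)]) (use K eW in simp_all)
    then show "Cod (full_sub C ?A) e \<in> ?W" by simp
  qed
  moreover have "closed_subobjects (full_sub C ?A) ?W"
    unfolding closed_subobjects_def
  proof (intro allI impI)
    fix m assume "monic (full_sub C ?A) m \<and> Cod (full_sub C ?A) m \<in> ?W"
    then have m0: "monic (full_sub C ?A) m" and mW: "Cod C m \<in> ?W" by simp_all
    note m = monic_full_subD [OF m0 A left_wide_closed_kernels]
    have "Dom C m \<in> right_perp C U" by (rule right_perp_sub [OF UO m(1)]) (use mW in simp)
    then show "Dom (full_sub C ?A) m \<in> ?W" using left_wideD(1) [OF m(2)] by simp
  qed
  moreover have "closed_extensions (full_sub C ?A) ?W"
    unfolding closed_extensions_def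
  proof (intro allI impI)
    fix f g assume "short_exact (full_sub C ?A) f g \<and> Dom (full_sub C ?A) f \<in> ?W \<and> Cod (full_sub C ?A) g \<in> ?W"
    then have ker': "is_kernel (full_sub C ?A) f g" and fW: "Dom C f \<in> ?W" and gW: "Cod C g \<in> ?W"
      by (simp_all add: short_exact_def)
    have fg: "f \<in> Arr C" "g \<in> Arr C" "Cod C f = Dom C g" "Cod C f \<in> ?A"
      and lift: "\<forall>X \<in> ?A. \<forall>h \<in> Hom (full_sub C ?A) X (Dom C g). g \<cdot> h = Zero C X (Cod C g) \<longrightarrow>
        (\<exists>!t. t \<in> Hom (full_sub C ?A) X (Dom C f) \<and> f \<cdot> t = h)"
      using ker' by (simp_all add: is_kernel_def)
    \<comment> \<open>The kernel property of \<open>f\<close> is available only for test objects in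
      W_L(T). The image of \<open>h\<close> is one, being a subobject in \<open>T\<close> of
      \<open>Cod C f\<close>. It is killed by \<open>g\<close>, so it lifts to
      \<open>Dom C f\<close>, which receives nothing from \<open>U\<close>.\<close>
    have "null_arr C h" if h: "h \<in> Arr C" "Dom C h \<in> U" "Cod C h = Cod C f" for h
    proof -
      obtain e m where em: "epic C e" "monic C m" "Dom C e = Dom C h" "Cod C e = Dom C m"
        "Cod C m = Cod C h" "m \<cdot> e = h" using image [OF h(1)] .
      note ma = monic_Arr [OF em(2)]
      have mU: "Dom C m \<in> U" using tors_factor [OF U em(1)] em h by simp
      then have mA: "Dom C m \<in> ?A" by (intro left_wide_sub [OF em(2)]) (use em h fg UT in auto)
      have "null_arr C (g \<cdot> m)" by (rule right_perp_null [of _ U]) (use ma em h fg gW mU in simp_all)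
      then have "g \<cdot> m = Zero C (Dom C m) (Cod C g)" by (rule null_arr_eq) (use ma em h fg in simp_all)
      moreover have "m \<in> Hom (full_sub C ?A) (Dom C m) (Dom C g)"
        using ma em h fg mA by (simp add: Hom_full_sub_iff Hom_iff)
      ultimately have "\<exists>!t. t \<in> Hom (full_sub C ?A) (Dom C m) (Dom C f) \<and> f \<cdot> t = m"
        using lift [rule_format, OF mA] by simp
      then obtain t where t: "t \<in> Arr C" "Dom C t = Dom C m" "Cod C t = Dom C f" "f \<cdot> t = m"
        by (auto simp: Hom_full_sub_iff Hom_iff)
      have "null_arr C t" by (rule right_perp_null [of _ U]) (use t mU fW in simp_all)
      then have "null_arr C (f \<cdot> t)" by (rule null_comp_right) (use t fg in simp_all)
      then have "null_arr C m" using t by simp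
      then have "null_arr C (m \<cdot> e)" by (rule null_comp_left) (use em epic_Arr in simp_all)
      then show ?thesis using em by simp
    qed
    then have "Cod C f \<in> right_perp C U" using fg by (simp add: right_perp_iff [OF UO])
    then show "Cod (full_sub C ?A) f \<in> ?W" using left_wideD(1) [OF fg(4)] by simp
  qed
  ultimately show "?W \<in> Serre C ?A" by (simp add: Serre_def)
qed

theorem Serre_wide_interval_bij:
  assumes T: "T \<in> tors C"
  shows "bij_betw (\<lambda>W. T \<inter> left_perp C W) (Serre C (left_wide C T)) {U \<in> tors C. wide_interval C U T}"
proof (rule bij_betw_byWitness [where f' = "\<lambda>U. right_perp C U \<inter> T"])
  show "\<forall>W \<in> Serre C (left_wide C T). right_perp C (T \<inter> left_perp C W) \<inter> T = W"
    using Serre_recover [OF T] by blast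
  show "\<forall>U \<in> {U \<in> tors C. wide_interval C U T}. T \<inter> left_perp C (right_perp C U \<inter> T) = U"
    using wide_interval_Serre(2) by blast
  show "(\<lambda>W. T \<inter> left_perp C W) ` Serre C (left_wide C T) \<subseteq> {U \<in> tors C. wide_interval C U T}"
  proof (intro image_subsetI CollectI conjI)
    fix W assume W: "W \<in> Serre C (left_wide C T)"
    have WO: "W \<subseteq> Obj C" using SerreD(2) [OF T W] left_wide_Obj [OF T] by blast
    show "T \<inter> left_perp C W \<in> tors C" by (rule left_perp_tors [OF T WO])
    then show "wide_interval C (T \<inter> left_perp C W) T"
      using T Serre_recover [OF T W] Serre_wide [OF T W] by (simp add: wide_interval_def)
  qed
  show "(\<lambda>U. right_perp C U \<inter> T) ` {U \<in> tors C. wide_interval C U T} \<subseteq> Serre C (left_wide C T)"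
    using wide_interval_Serre(1) by blast
qed

end

section \<open>Simple objects and bricks\<close>

lemma (in preadditive_category) End_ring_ring:
  assumes X: "X \<in> Obj C"
  shows "ring (End_ring C X)"
proof -
  have "comm_group (hom_group C X X)" using Hom_comm_group X by blast
  moreover have "add_monoid (End_ring C X) = hom_group C X X"
    by (simp add: End_ring_def hom_group_def)
  ultimately have cg: "comm_group (add_monoid (End_ring C X))" by simp
  then interpret A: comm_group "add_monoid (End_ring C X)" .
  have ag: "abelian_group (End_ring C X)"
    by (intro abelian_group.intro abelian_monoid.intro abelian_group_axioms.intro)
      (rule A.comm_monoid_axioms, rule cg)
  show ?thesis
  proof (rule ringI [OF ag])
    show "monoid (End_ring C X)"
      by (rule monoidI) (use X in \<open>simp_all add: End_ring_def Hom_iff\<close>)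
  qed (simp_all add: End_ring_def Hom_iff comp_Plus Plus_comp)
qed

context preadditive_category
begin

text \<open>Units of the endomorphism ring are the invertible arrows, and one equals zero in it
  exactly when the identity is null.\<close>

lemma brick_iff:
  "brick C X \<longleftrightarrow> X \<in> Obj C \<and> \<not> zero_obj C X \<and>
    (\<forall>f \<in> Arr C. Dom C f = X \<and> Cod C f = X \<and> \<not> null_arr C f \<longrightarrow> iso_arr C f)"
proof -
  have null: "null_arr C f \<longleftrightarrow> f = Zero C X X" if "X \<in> Obj C" "f \<in> Arr C" "Dom C f = X" "Cod C f = X" for f
  proof
    show "null_arr C f" if "f = Zero C X X" using that \<open>X \<in> Obj C\<close> by simp
    show "f = Zero C X X" if "null_arr C f" by (rule null_arr_eq [OF that]) fact+
  qed
  have unit: "f \<in> Units (End_ring C X) \<longleftrightarrow> iso_arr C f"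
    if "X \<in> Obj C" "f \<in> Arr C" "Dom C f = X" "Cod C f = X" for f
    using that by (auto simp: Units_def End_ring_def iso_arr_def Hom_iff)
  have one: "\<one>\<^bsub>End_ring C X\<^esub> \<noteq> \<zero>\<^bsub>End_ring C X\<^esub> \<longleftrightarrow> \<not> zero_obj C X" if "X \<in> Obj C"
    using null [OF that, of "Ident C X"] that by (simp add: End_ring_def zero_obj_iff)
  have "(\<forall>f \<in> carrier (End_ring C X). f \<noteq> \<zero>\<^bsub>End_ring C X\<^esub> \<longrightarrow> f \<in> Units (End_ring C X)) \<longleftrightarrow>
    (\<forall>f \<in> Arr C. Dom C f = X \<and> Cod C f = X \<and> \<not> null_arr C f \<longrightarrow> iso_arr C f)" (is "?L = ?R")
    if X: "X \<in> Obj C"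
  proof
    assume L: ?L
    show ?R
    proof (intro ballI impI)
      fix f assume f: "f \<in> Arr C" "Dom C f = X \<and> Cod C f = X \<and> \<not> null_arr C f"
      then have "f \<in> carrier (End_ring C X)" "f \<noteq> \<zero>\<^bsub>End_ring C X\<^esub>"
        using null [OF X, of f] by (simp_all add: End_ring_def Hom_iff)
      then show "iso_arr C f" using L unit [OF X, of f] f by blast
    qed
  next
    assume R: ?R
    show ?L
    proof (intro ballI impI)
      fix f assume "f \<in> carrier (End_ring C X)" "f \<noteq> \<zero>\<^bsub>End_ring C X\<^esub>"
      then have f: "f \<in> Arr C" "Dom C f = X" "Cod C f = X" "f \<noteq> Zero C X X"
        by (simp_all add: End_ring_def Hom_iff)
      then have "iso_arr C f" using R null [OF X f(1-3)] by simp
      then show "f \<in> Units (End_ring C X)" using unit [OF X f(1-3)] by simp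
    qed
  qed
  then show ?thesis using one End_ring_ring unfolding brick_def is_division_ring_def by blast
qed

lemma iso_class_eq:
  assumes XY: "isomorphic C X Y"
  shows "iso_class C X = iso_class C Y"
  using isomorphic_trans [OF XY] isomorphic_trans [OF isomorphic_sym [OF XY]]
  unfolding iso_class_def by blast

lemma iso_class_eqD:
  assumes "iso_class C X = iso_class C Y" "Y \<in> Obj C"
  shows "isomorphic C X Y"
proof -
  have "Y \<in> iso_class C X" using assms isomorphic_refl by (simp add: iso_class_def)
  then show ?thesis by (simp add: iso_class_def)
qed

text \<open>Makes the lower end \<open>T \<inter> left_perp C {S}\<close> of an arrow depend only on
  the isomorphism class of \<open>S\<close>.\<close>

lemma left_perp_single_iso:
  assumes XY: "isomorphic C X Y" and O: "X \<in> Obj C" "Y \<in> Obj C"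
  shows "left_perp C {X} \<subseteq> left_perp C {Y}"
proof
  fix Z assume Z: "Z \<in> left_perp C {X}"
  have XO: "{X} \<subseteq> Obj C" and YO: "{Y} \<subseteq> Obj C" using O by simp_all
  obtain g where g: "iso_arr C g" "Dom C g = Y" "Cod C g = X"
    using isomorphic_sym [OF XY] by (auto simp: isomorphic_iff)
  note gm = iso_monic [OF g(1)]
  have "null_arr C f" if f: "f \<in> Arr C" "Dom C f = Z" "Cod C f = Y" for f
  proof (rule monic_null [OF gm])
    show "null_arr C (g \<cdot> f)" by (rule left_perp_null [of _ "{X}"]) (use f g Z monic_Arr [OF gm] in simp_all)
  qed (use f g in simp_all)
  then show "Z \<in> left_perp C {Y}" using Z by (simp add: left_perp_iff [OF YO] left_perp_iff [OF XO])
qed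

end

context abelian_category
begin

text \<open>\<open>sim\<close> forms classes inside W_L(T), \<open>brick_label\<close> in the
  ambient category; closure of W_L(T) under isomorphism reconciles them.\<close>

lemma iso_class_full_sub:
  assumes T: "T \<in> tors C" and X: "X \<in> left_wide C T"
  shows "iso_class (full_sub C (left_wide C T)) X = iso_class C X"
proof -
  have "Y \<in> left_wide C T" if "isomorphic C X Y" for Y using left_wide_iso [OF T X that] .
  moreover have "left_wide C T \<subseteq> Obj C" by (rule left_wide_Obj [OF T])
  ultimately show ?thesis using X by (auto simp: iso_class_def isomorphic_full_sub)
qed

lemma simple_left_wide_iff:
  assumes T: "T \<in> tors C"
  shows "simple_obj (full_sub C (left_wide C T)) S \<longleftrightarrow> S \<in> left_wide C T \<and> \<not> zero_obj C S \<and>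
    (\<forall>m. monic C m \<and> Cod C m = S \<and> Dom C m \<in> left_wide C T \<longrightarrow> zero_obj C (Dom C m) \<or> iso_arr C m)"
    (is "_ \<longleftrightarrow> ?R")
proof
  let ?A = "left_wide C T"
  note A = left_wide_Obj [OF T]
  assume s: "simple_obj (full_sub C ?A) S"
  then have SA: "S \<in> ?A" by (simp add: simple_obj_def)
  have "zero_obj C (Dom C m) \<or> iso_arr C m" if m: "monic C m" "Cod C m = S" "Dom C m \<in> ?A" for m
  proof -
    have "monic (full_sub C ?A) m" by (rule monic_full_subI) (use m SA A in simp_all)
    then show ?thesis using s m unfolding simple_obj_def by (auto simp: zero_full_sub [OF A] iso_full_sub)
  qed
  then show ?R using s SA by (auto simp: simple_obj_def zero_full_sub [OF A])
next
  let ?A = "left_wide C T"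
  note A = left_wide_Obj [OF T]
  assume R: ?R
  show "simple_obj (full_sub C ?A) S"
    unfolding simple_obj_def zero_full_sub [OF A] iso_full_sub
  proof (intro conjI allI impI)
    fix m assume "monic (full_sub C ?A) m \<and> Cod (full_sub C ?A) m = S"
    then have m: "monic (full_sub C ?A) m" "Cod C m = S" by simp_all
    note md = monic_full_subD [OF m(1) A left_wide_closed_kernels]
    have "zero_obj C (Dom C m) \<or> iso_arr C m" using R m(2) md by simp
    then show "Dom (full_sub C ?A) m \<in> ?A \<and> zero_obj C (Dom (full_sub C ?A) m) \<or>
      iso_arr C m \<and> Dom C m \<in> ?A \<and> Cod C m \<in> ?A" using md by simp
  qed (use R in simp_all)
qed

text \<open>The image of such a map is a subobject in \<^term>\<open>T\<close> of an object of the left wide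
  subcategory, hence itself in the left wide subcategory, so simplicity applies to it.\<close>

lemma simple_left_wide_epic:
  assumes T: "T \<in> tors C" and S: "simple_obj (full_sub C (left_wide C T)) (Cod C f)"
    and f: "f \<in> Arr C" "Dom C f \<in> T" "\<not> null_arr C f"
  shows "epic C f"
proof -
  obtain e m where em: "epic C e" "monic C m" "Dom C e = Dom C f" "Cod C e = Dom C m"
    "Cod C m = Cod C f" "m \<cdot> e = f" using image [OF f(1)] .
  have S': "Cod C f \<in> left_wide C T" using S simple_left_wide_iff [OF T] by blast
  have "Dom C m \<in> T" using tors_factor [OF T em(1)] em f by simp
  then have "Dom C m \<in> left_wide C T" by (intro left_wide_sub [OF em(2)]) (use em S' in simp_all)
  then have "zero_obj C (Dom C m) \<or> iso_arr C m"
    using S [unfolded simple_left_wide_iff [OF T]] em(2,5) by simp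
  moreover have "\<not> zero_obj C (Dom C m)" using image_zero [OF em(1,2,4)] em f by auto
  ultimately have "iso_arr C m" by simp
  then have "epic C (m \<cdot> e)" by (rule epic_comp [OF iso_epic em(1,4)])
  then show ?thesis using em by simp
qed

end

section \<open>Hasse arrows defined by simple objects of the left wide subcategory\<close>

context abelian_length_category
begin

text \<open>A nonzero endomorphism is epic by simplicity, and an epic endomorphism is invertible by
  finite length.\<close>

lemma simple_left_wide_brick:
  assumes T: "T \<in> tors C" and S: "simple_obj (full_sub C (left_wide C T)) S"
  shows "brick C S"
proof -
  have S': "S \<in> left_wide C T" "\<not> zero_obj C S" using S simple_left_wide_iff [OF T] by simp_all
  have "iso_arr C f" if f: "f \<in> Arr C" "Dom C f = S" "Cod C f = S" "\<not> null_arr C f" for f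
    by (rule epic_endo_iso, rule simple_left_wide_epic [OF T])
      (use f S left_wideD(1) [OF S'(1)] in simp_all)
  then show ?thesis using S' left_wide_Obj [OF T] unfolding brick_iff by auto
qed

text \<open>An object of \<open>T\<close> with a nonzero map to \<open>S\<close> is an extension of
  \<open>S\<close> by a shorter object of \<open>T\<close>. Repeating this ends in
  \<open>T \<inter> left_perp C {S}\<close>.\<close>

lemma simple_left_wide_generates:
  assumes T: "T \<in> tors C" and S: "simple_obj (full_sub C (left_wide C T)) S"
    and V: "V \<in> tors C" "T \<inter> left_perp C {S} \<subseteq> V" "S \<in> V" and X: "X \<in> T"
  shows "X \<in> V"
  using X
proof (induction "obj_length C X" arbitrary: X rule: less_induct)
  case less
  have S': "S \<in> left_wide C T" "\<not> zero_obj C S" using S simple_left_wide_iff [OF T] by simp_all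
  have SO: "{S} \<subseteq> Obj C" using S' left_wide_Obj [OF T] by auto
  have XO: "X \<in> Obj C" using less tors_Obj [OF T] by auto
  show ?case
  proof (cases "X \<in> left_perp C {S}")
    case True
    then show ?thesis using V less by auto
  next
    case False
    then obtain f where f: "f \<in> Arr C" "Dom C f = X" "Cod C f = S" "\<not> null_arr C f"
      using XO by (auto simp: left_perp_iff [OF SO])
    have ef: "epic C f" by (rule simple_left_wide_epic [OF T]) (use f S less in simp_all)
    then obtain k where k: "short_exact C k f" by (rule ex_short_exact_epic)
    note K = short_exactD [OF k]
    have "Dom C k \<in> T" by (rule left_wideD(2) [OF S'(1) f(1) _ f(3) K(1)]) (use f less in simp)
    moreover have "obj_length C (Dom C k) < obj_length C X" using obj_length_less(1) [OF k] K f S' by simp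
    ultimately have "Dom C k \<in> V" using less.hyps by blast
    then have "Cod C k \<in> V" using tors_ext [OF V(1) k] f V by simp
    then show ?thesis using K f by simp
  qed
qed

lemma simple_left_wide_hasse:
  assumes T: "T \<in> tors C" and S: "simple_obj (full_sub C (left_wide C T)) S"
  shows "(T, T \<inter> left_perp C {S}) \<in> hasse_arrows C"
proof -
  have S': "S \<in> left_wide C T" "\<not> zero_obj C S" using S simple_left_wide_iff [OF T] by simp_all
  have ST: "S \<in> T" using left_wideD(1) [OF S'(1)] .
  have SO: "{S} \<subseteq> Obj C" "S \<in> Obj C" using S' left_wide_Obj [OF T] by auto
  let ?U = "T \<inter> left_perp C {S}"
  have U: "?U \<in> tors C" by (rule left_perp_tors [OF T SO(1)])
  have "S \<notin> left_perp C {S}"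
  proof
    assume "S \<in> left_perp C {S}"
    then have "null_arr C (Ident C S)" by (intro left_perp_null [of _ "{S}"]) (use SO in simp_all)
    then show False using S' SO by (simp add: zero_obj_iff)
  qed
  then have "?U \<subset> T" using ST by auto
  moreover have False if V: "V \<in> tors C" "?U \<subset> V" "V \<subset> T" for V
  proof -
    \<comment> \<open>An object of \<open>V\<close> outside \<open>?U\<close> has a nonzero map to
      \<open>S\<close>. This map is epic and puts \<open>S\<close> into \<open>V\<close>, so
      \<open>V\<close> is all of \<open>T\<close>.\<close>
    obtain Y where Y: "Y \<in> V" "Y \<notin> left_perp C {S}" "Y \<in> T" using V by auto
    then obtain f where f: "f \<in> Arr C" "Dom C f = Y" "Cod C f = S" "\<not> null_arr C f"
      using tors_Obj [OF T] by (auto simp: left_perp_iff [OF SO(1)])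
    have "epic C f" by (rule simple_left_wide_epic [OF T]) (use f S Y in simp_all)
    then have "S \<in> V" using tors_factor [OF V(1), of f] f Y by simp
    then have "T \<subseteq> V" using simple_left_wide_generates [OF T S V(1)] V(2) by blast
    then show False using V by simp
  qed
  ultimately show ?thesis using U T unfolding hasse_arrows_def by blast
qed

text \<open>A nonzero map from \<open>X\<close> to \<open>S\<close> is epic. If it is invertible,
  its inverse serves; otherwise its kernel is a shorter nonzero object of the same kind, and a map
  from \<open>S\<close> found there is composed with the inclusion.\<close>

lemma simple_left_wide_embeds:
  assumes T: "T \<in> tors C" and S: "simple_obj (full_sub C (left_wide C T)) S"
    and X: "X \<in> right_perp C (T \<inter> left_perp C {S}) \<inter> T" "\<not> zero_obj C X"
  obtains h where "h \<in> Arr C" "Dom C h = S" "Cod C h = X" "\<not> null_arr C h"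
proof -
  let ?U = "T \<inter> left_perp C {S}"
  have S': "S \<in> left_wide C T" "\<not> zero_obj C S" using S simple_left_wide_iff [OF T] by simp_all
  have SO: "{S} \<subseteq> Obj C" using S' left_wide_Obj [OF T] by auto
  have UO: "?U \<subseteq> Obj C" using tors_Obj [OF T] by auto
  have "\<exists>h \<in> Arr C. Dom C h = S \<and> Cod C h = X \<and> \<not> null_arr C h"
    using X
  proof (induction "obj_length C X" arbitrary: X rule: less_induct)
    case less
    have XO: "X \<in> Obj C" using less tors_Obj [OF T] by auto
    have "X \<notin> left_perp C {S}"
    proof
      assume "X \<in> left_perp C {S}"
      then have "null_arr C (Ident C X)" by (intro right_perp_null [of _ ?U]) (use less XO in simp_all)
      then show False using less XO by (simp add: zero_obj_iff)
    qed
    then obtain f where f: "f \<in> Arr C" "Dom C f = X" "Cod C f = S" "\<not> null_arr C f"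
      using XO by (auto simp: left_perp_iff [OF SO])
    have ef: "epic C f" by (rule simple_left_wide_epic [OF T]) (use f S less in simp_all)
    then obtain k where k: "short_exact C k f" by (rule ex_short_exact_epic)
    note K = short_exactD [OF k]
    show ?case
    proof (cases "zero_obj C (Dom C k)")
      case True
      then have "null_arr C k" by (rule null_if_zero_Dom) (rule K)
      then have "monic C f" by (rule monic_if_null_kernel [OF K(1)])
      then have "iso_arr C f" using ef by (rule iso_monic_epic)
      then obtain g where g: "iso_arr C g" "Dom C g = Cod C f" "Cod C g = Dom C f"
        by (rule iso_inverse)
      have ge: "epic C g" by (rule iso_epic [OF g(1)])
      have "\<not> null_arr C g"
      proof
        assume "null_arr C g"
        then have "zero_obj C (Cod C g)" by (rule null_epic_zero [OF ge])
        then show False using less g f by simp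
      qed
      then show ?thesis using epic_Arr [OF ge] g f by (intro bexI [of _ g]) simp_all
    next
      case False
      have "Dom C k \<in> T" by (rule left_wideD(2) [OF S'(1) f(1) _ f(3) K(1)]) (use f less in simp)
      moreover have "Dom C k \<in> right_perp C ?U" by (rule right_perp_sub [OF UO K(3)]) (use K f less in simp)
      moreover have "obj_length C (Dom C k) < obj_length C X" using obj_length_less(1) [OF k] K f S' by simp
      ultimately obtain h where h: "h \<in> Arr C" "Dom C h = S" "Cod C h = Dom C k" "\<not> null_arr C h"
        using less.hyps [of "Dom C k"] False by auto
      have "\<not> null_arr C (k \<cdot> h)"
      proof
        assume "null_arr C (k \<cdot> h)"
        then have "null_arr C h" by (intro monic_null [OF K(3), of h]) (use h in simp_all)
        then show False using h by simp
      qed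
      then show ?thesis using h K f by (intro bexI [of _ "k \<cdot> h"]) simp_all
    qed
  qed
  then show ?thesis using that by auto
qed

text \<open>There are nonzero maps \<open>h\<close> from \<open>S\<close> to \<open>B\<close> and
  \<open>f\<close> from \<open>B\<close> to \<open>S\<close>. Since \<open>f\<close> is epic,
  \<open>h \<cdot> f\<close> is a nonzero endomorphism of the brick and hence invertible, so
  \<open>f\<close> is also monic.\<close>

lemma simple_left_wide_unique_brick:
  assumes T: "T \<in> tors C" and S: "simple_obj (full_sub C (left_wide C T)) S"
    and B: "B \<in> right_perp C (T \<inter> left_perp C {S}) \<inter> T" "brick C B"
  shows "isomorphic C B S"
proof -
  let ?U = "T \<inter> left_perp C {S}"
  have S': "S \<in> left_wide C T" "\<not> zero_obj C S" using S simple_left_wide_iff [OF T] by simp_all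
  have SO: "{S} \<subseteq> Obj C" using S' left_wide_Obj [OF T] by auto
  have B': "B \<in> Obj C" "\<not> zero_obj C B"
    "\<And>f. f \<in> Arr C \<Longrightarrow> Dom C f = B \<Longrightarrow> Cod C f = B \<Longrightarrow> \<not> null_arr C f \<Longrightarrow> iso_arr C f"
    using B(2) by (simp_all add: brick_iff)
  obtain h where h: "h \<in> Arr C" "Dom C h = S" "Cod C h = B" "\<not> null_arr C h"
    using simple_left_wide_embeds [OF T S B(1) B'(2)] .
  have "B \<notin> left_perp C {S}"
  proof
    assume "B \<in> left_perp C {S}"
    then have "null_arr C (Ident C B)" by (intro right_perp_null [of _ ?U]) (use B B' in simp_all)
    then show False using B' by (simp add: zero_obj_iff)
  qed
  then obtain f where f: "f \<in> Arr C" "Dom C f = B" "Cod C f = S" "\<not> null_arr C f"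
    using B' by (auto simp: left_perp_iff [OF SO])
  have ef: "epic C f" by (rule simple_left_wide_epic [OF T]) (use f S B in simp_all)
  have "\<not> null_arr C (h \<cdot> f)"
  proof
    assume "null_arr C (h \<cdot> f)"
    then have "null_arr C h" by (intro epic_null [OF ef, of h]) (use h f in simp_all)
    then show False using h by simp
  qed
  then have "iso_arr C (h \<cdot> f)" by (intro B'(3)) (use h f in simp_all)
  then have "monic C f" by (intro monic_right_factor [of h f] iso_monic) (use h f in simp_all)
  then have "iso_arr C f" using ef by (rule iso_monic_epic)
  then show ?thesis using f by (auto simp: isomorphic_iff)
qed

lemma brick_label_simple:
  assumes T: "T \<in> tors C" and S: "simple_obj (full_sub C (left_wide C T)) S"
  shows "brick_label C (T, T \<inter> left_perp C {S}) = iso_class C S"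
proof -
  let ?U = "T \<inter> left_perp C {S}"
  have SA: "S \<in> left_wide C T" using S simple_left_wide_iff [OF T] by simp
  have ST: "S \<in> T" "S \<in> Obj C" using left_wideD(1) [OF SA] left_wide_Obj [OF T] SA by auto
  have UO: "?U \<subseteq> Obj C" using tors_Obj [OF T] by auto
  have "null_arr C f" if "f \<in> Arr C" "Dom C f \<in> ?U" "Cod C f = S" for f
    by (rule left_perp_null [of f "{S}"]) (use that in simp_all)
  then have "S \<in> right_perp C ?U" using ST by (simp add: right_perp_iff [OF UO])
  then have 1: "\<exists>B. brick C B \<and> B \<in> right_perp C ?U \<inter> T \<and> iso_class C S = iso_class C B"
    using simple_left_wide_brick [OF T S] ST by blast
  have 2: "L = iso_class C S" if "\<exists>B. brick C B \<and> B \<in> right_perp C ?U \<inter> T \<and> L = iso_class C B" for L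
    using that
  proof (elim exE conjE)
    fix B assume B: "brick C B" "B \<in> right_perp C ?U \<inter> T" "L = iso_class C B"
    show ?thesis using iso_class_eq [OF simple_left_wide_unique_brick [OF T S B(2,1)]] B(3) by simp
  qed
  show ?thesis unfolding brick_label_def fst_conv snd_conv by (rule the_equality) (rule 1, erule 2)
qed

section \<open>Hasse arrows\<close>

text \<open>\<open>T \<inter> left_perp C {Y}\<close> is a torsion class between \<open>U\<close>
  and \<open>T\<close>. The identity of \<open>Y\<close> keeps \<open>Y\<close> out of it, so it is
  not \<open>T\<close>.\<close>

lemma hasse_arrow_left_perp:
  assumes TU: "(T, U) \<in> hasse_arrows C" and Y: "Y \<in> right_perp C U \<inter> T" "\<not> zero_obj C Y"
  shows "U = T \<inter> left_perp C {Y}"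
proof -
  have T: "T \<in> tors C" and U: "U \<in> tors C" and sub: "U \<subset> T"
    and no: "\<not> (\<exists>V \<in> tors C. U \<subset> V \<and> V \<subset> T)"
    using TU by (auto simp: hasse_arrows_def)
  have YO: "Y \<in> Obj C" "{Y} \<subseteq> Obj C" using Y tors_Obj [OF T] by auto
  let ?V = "T \<inter> left_perp C {Y}"
  have V: "?V \<in> tors C" by (rule left_perp_tors [OF T YO(2)])
  have "Y \<notin> left_perp C {Y}"
  proof
    assume "Y \<in> left_perp C {Y}"
    then have "null_arr C (Ident C Y)" by (intro left_perp_null [of _ "{Y}"]) (use YO in simp_all)
    then show False using Y YO by (simp add: zero_obj_iff)
  qed
  then have "?V \<subset> T" using Y by auto
  moreover have "U \<subseteq> ?V"
  proof
    fix X assume X: "X \<in> U"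
    then have "X \<in> T" "X \<in> Obj C" using sub tors_Obj [OF U] by auto
    moreover have "null_arr C f" if "f \<in> Arr C" "Dom C f = X" "Cod C f = Y" for f
      by (rule right_perp_null [of f U]) (use that X Y in simp_all)
    ultimately show "X \<in> ?V" by (simp add: left_perp_iff [OF YO(2)])
  qed
  ultimately show ?thesis using no V by blast
qed

lemma right_perp_antimono: "U \<subseteq> T \<Longrightarrow> right_perp C T \<subseteq> right_perp C U"
  by (auto simp: right_perp_def)

lemma tors_perp_zero:
  assumes U: "U \<in> tors C" and X: "X \<in> U" "X \<in> right_perp C U"
  shows "zero_obj C X"
proof -
  have "X \<in> Obj C" using tors_Obj [OF U] X by auto
  moreover from this have "null_arr C (Ident C X)" by (intro right_perp_null [of _ U]) (use X in simp_all)
  ultimately show ?thesis by (simp add: zero_obj_iff)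
qed

lemma iso_if_zero_coker:
  assumes "short_exact C m e" "zero_obj C (Cod C e)"
  shows "iso_arr C m"
proof -
  note E = short_exactD [OF assms(1)]
  have "null_arr C e" by (rule null_if_zero_Cod) (use assms E in simp_all)
  then have "epic C m" by (rule epic_if_null_cokernel [OF E(2)])
  then show ?thesis by (rule iso_monic_epic [OF E(3)])
qed

text \<open>If \<^term>\<open>f \<cdot> h\<close> is invertible, then the kernel of \<^term>\<open>f\<close> is a complement of the image
  of \<^term>\<open>h\<close> and hence a factor object.\<close>

lemma kernel_iso_coker_section:
  assumes k: "short_exact C l f" and c: "short_exact C h q" and hf: "Cod C h = Dom C f"
    and iso: "iso_arr C (f \<cdot> h)"
  shows "isomorphic C (Dom C l) (Cod C q)"
proof -
  note K = short_exactD [OF k] and H = short_exactD [OF c]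
  have d: "Cod C l = Dom C f" "Dom C q = Dom C f" using K H hf by simp_all
  have a: "q \<cdot> l \<in> Arr C" "Dom C (q \<cdot> l) = Dom C l" "Cod C (q \<cdot> l) = Cod C q" using K H d by simp_all
  have "epic C (q \<cdot> l)"
  proof (rule epicI)
    fix u assume u: "u \<in> Arr C" "Dom C u = Cod C (q \<cdot> l)" "null_arr C (u \<cdot> (q \<cdot> l))"
    then have u': "u \<cdot> q \<in> Arr C" "Dom C (u \<cdot> q) = Cod C l" "null_arr C ((u \<cdot> q) \<cdot> l)"
      using a K(5) H(6) d by simp_all
    obtain v where v: "v \<in> Arr C" "Dom C v = Cod C f" "Cod C v = Cod C (u \<cdot> q)" "v \<cdot> f = u \<cdot> q"
      using cokernel_lift [OF K(2) u'] .
    have "v \<cdot> (f \<cdot> h) = (u \<cdot> q) \<cdot> h" by (rule comp_left [OF v(4)]) (use v K H hf in simp_all)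
    also have "\<dots> = u \<cdot> (q \<cdot> h)" using u a H d hf by simp
    finally have eq: "v \<cdot> (f \<cdot> h) = u \<cdot> (q \<cdot> h)" .
    have "null_arr C (u \<cdot> (q \<cdot> h))" by (rule null_comp_right [OF H(8)]) (use u a H in simp_all)
    then have "null_arr C (v \<cdot> (f \<cdot> h))" using eq by simp
    then have "null_arr C v" by (intro epic_null [OF iso_epic [OF iso], of v]) (use v K H hf in simp_all)
    then have "null_arr C (v \<cdot> f)" by (rule null_comp_left) (use v K in simp_all)
    then have "null_arr C (u \<cdot> q)" using v by simp
    then show "null_arr C u" by (intro epic_null [OF H(4), of u]) (use u a in simp_all)
  qed (rule a)
  moreover have "monic C (q \<cdot> l)"
  proof (rule monicI)
    fix x assume x: "x \<in> Arr C" "Cod C x = Dom C (q \<cdot> l)" "null_arr C ((q \<cdot> l) \<cdot> x)"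
    then have x': "l \<cdot> x \<in> Arr C" "Cod C (l \<cdot> x) = Dom C q" "null_arr C (q \<cdot> (l \<cdot> x))"
      using a K(5) H(6) d by simp_all
    obtain y where y: "y \<in> Arr C" "Dom C y = Dom C (l \<cdot> x)" "Cod C y = Dom C h" "h \<cdot> y = l \<cdot> x"
      using kernel_lift [OF H(1) x'] .
    have "null_arr C ((f \<cdot> l) \<cdot> x)" by (rule null_comp_left [OF K(8)]) (use x a K d in simp_all)
    then have "null_arr C (f \<cdot> (l \<cdot> x))" using x a K d by simp
    then have "null_arr C ((f \<cdot> h) \<cdot> y)" using y K(6) H(5) hf by simp
    then have "null_arr C y" by (intro monic_null [OF iso_monic [OF iso], of y]) (use y K(6) H(5) hf in simp_all)
    then have "null_arr C (h \<cdot> y)" by (rule null_comp_right) (use y H in simp_all)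
    then have "null_arr C (l \<cdot> x)" using y by simp
    then show "null_arr C x" by (intro monic_null [OF K(3), of x]) (use x a in simp_all)
  qed (rule a)
  ultimately have "iso_arr C (q \<cdot> l)" by (intro iso_monic_epic)
  then show ?thesis using a by (auto simp: isomorphic_iff)
qed

text \<open>Minimal length enters through the local fact \<open>epic\<close>, which serves three
  times: for \<open>f\<close> itself, for the endomorphism \<open>f' \<cdot> h\<close> of
  \<open>S\<close>, and for simplicity.\<close>

lemma hasse_arrow_simple:
  assumes TU: "(T, U) \<in> hasse_arrows C"
  obtains S where "simple_obj (full_sub C (left_wide C T)) S" "U = T \<inter> left_perp C {S}"
proof -
  have T: "T \<in> tors C" and U: "U \<in> tors C" and sub: "U \<subset> T"
    using TU by (auto simp: hasse_arrows_def)
  note TO = tors_Obj [OF T] and UO = tors_Obj [OF U]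
  let ?F = "\<lambda>X. X \<in> right_perp C U \<inter> T \<and> \<not> zero_obj C X"
  have "\<exists>X. ?F X"
  proof -
    \<comment> \<open>An object of \<open>T\<close> outside \<open>U\<close> has a nonzero
      torsion-free factor for \<open>U\<close>, and this factor is again in
      \<open>T\<close>.\<close>
    obtain X where X: "X \<in> T" "X \<notin> U" "X \<in> Obj C" using sub TO by auto
    obtain m e where me: "short_exact C m e" "Cod C m = X" "Dom C m \<in> U" "Cod C e \<in> right_perp C U"
      using torsion_sequence [OF U X(3)] .
    note M = short_exactD [OF me(1)]
    have "\<not> zero_obj C (Cod C e)"
    proof
      assume "zero_obj C (Cod C e)"
      then have "iso_arr C m" by (rule iso_if_zero_coker [OF me(1)])
      then have "Cod C m \<in> U" by (intro tors_factor [OF U] iso_epic me(3))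
      then show False using X me by simp
    qed
    moreover have "Cod C e \<in> T" using tors_factor [OF T M(4)] M me X by simp
    ultimately show ?thesis using me by blast
  qed
  then obtain S where S: "?F S" and min: "\<And>Y. ?F Y \<Longrightarrow> obj_length C S \<le> obj_length C Y"
    using ex_has_least_nat [of ?F _ "obj_length C"] by blast
  have SO: "S \<in> Obj C" using S TO by auto
  have epic: "epic C f" if f: "f \<in> Arr C" "Dom C f \<in> T" "Cod C f = S" "\<not> null_arr C f" for f
  proof -
    obtain e m where em: "epic C e" "monic C m" "Dom C e = Dom C f" "Cod C e = Dom C m"
      "Cod C m = Cod C f" "m \<cdot> e = f" using image [OF f(1)] .
    \<comment> \<open>The image is a nonzero object of \<open>right_perp C U \<inter> T\<close>, so
      it is not shorter than \<open>S\<close> and must fill it.\<close>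
    have "Dom C m \<in> T" using tors_factor [OF T em(1)] em f by simp
    moreover have "Dom C m \<in> right_perp C U" by (rule right_perp_sub [OF UO em(2)]) (use em f S in simp)
    moreover have "\<not> zero_obj C (Dom C m)" using image_zero [OF em(1,2,4)] em f by auto
    ultimately have le: "obj_length C S \<le> obj_length C (Dom C m)" using min by blast
    obtain c where c: "short_exact C m c" using ex_short_exact_monic [OF em(2)] .
    have "zero_obj C (Cod C c)"
    proof (rule ccontr)
      assume "\<not> zero_obj C (Cod C c)"
      then show False using obj_length_less(1) [OF c] le em f by simp
    qed
    then have "iso_arr C m" by (rule iso_if_zero_coker [OF c])
    then have "epic C (m \<cdot> e)" by (rule epic_comp [OF iso_epic em(1,4)])
    then show ?thesis using em by simp
  qed
  have kernel: "Dom C k \<in> T"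
    if f: "f \<in> Arr C" "Dom C f \<in> T" "Cod C f = S" "\<not> null_arr C f" and k: "is_kernel C k f" for f k
  proof -
    note ka = is_kernel_Arr [OF k]
    \<comment> \<open>The torsion part is taken for \<open>T\<close>, not for \<open>U\<close>, so
      that the kernel of the induced map \<open>f'\<close> admits no nonzero map from
      \<open>S\<close>.\<close>
    obtain t r where tr: "short_exact C t r" "Cod C t = Dom C k" "Dom C t \<in> T" "Cod C r \<in> right_perp C T"
      using torsion_sequence [OF T, of "Dom C k"] ka by auto
    note R = short_exactD [OF tr(1)]
    have kt: "k \<cdot> t \<in> Arr C" "Dom C (k \<cdot> t) = Dom C t" "Cod C (k \<cdot> t) = Dom C f" using ka R tr by simp_all
    have "monic C (k \<cdot> t)" by (rule monic_comp [OF kernel_monic [OF k] R(3) tr(2)])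
    then obtain c where c: "short_exact C (k \<cdot> t) c" by (rule ex_short_exact_monic)
    note Cc = short_exactD [OF c]
    have cf: "Dom C c = Dom C f" using Cc kt by simp
    have "null_arr C ((f \<cdot> k) \<cdot> t)" by (rule null_comp_left [OF ka(4)]) (use ka R tr in simp_all)
    then have "null_arr C (f \<cdot> (k \<cdot> t))" using ka R(5) tr by simp
    then obtain f' where f': "f' \<in> Arr C" "Dom C f' = Cod C c" "Cod C f' = Cod C f" "f' \<cdot> c = f"
      using cokernel_lift [OF Cc(2) f(1)] kt by auto
    have cT: "Cod C c \<in> T" using tors_factor [OF T Cc(4)] cf f by simp
    have "epic C (f' \<cdot> c)" using epic [OF f] f' by simp
    then have "epic C f'" by (rule epic_left_factor) (use f' Cc in simp_all)
    then obtain l where l: "short_exact C l f'" by (rule ex_short_exact_epic)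
    note L = short_exactD [OF l]
    have "is_kernel C k (f' \<cdot> c)" using k f' by simp
    then obtain j p where jp: "short_exact C j p" "Dom C j = Dom C (k \<cdot> t)" "Cod C j = Dom C k"
      "Cod C p = Dom C l" "k \<cdot> j = k \<cdot> t"
      by (rule kernel_comp_exact [OF Cc(4) f'(1,2) Cc(1) L(1)])
    note J = short_exactD [OF jp(1)]
    \<comment> \<open>Cancelling \<open>k\<close> identifies \<open>j\<close> with the torsion part,
      so the kernel of \<open>f'\<close> is isomorphic to the torsion-free factor
      \<open>Cod C r\<close>.\<close>
    have "j = t" by (rule monic_cancel [OF kernel_monic [OF k]]) (use jp J R tr kt in simp_all)
    then have rp: "isomorphic C (Cod C r) (Cod C p)" using cokernel_unique [OF R(2)] J(2) by simp
    then have rl: "isomorphic C (Dom C l) (Cod C r)" using isomorphic_sym jp by simp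
    then obtain i where i: "iso_arr C i" "Dom C i = Dom C l" "Cod C i = Cod C r"
      by (auto simp: isomorphic_iff)
    have lT: "Dom C l \<in> right_perp C T" using right_perp_sub [OF TO iso_monic [OF i(1)]] i tr by simp
    have "Dom C l \<in> right_perp C U" using right_perp_antimono [of U T] lT sub by auto
    then have "Cod C l \<in> right_perp C U" by (intro right_perp_ext [OF UO l]) (use S f' f in simp_all)
    then have cU: "Cod C c \<in> right_perp C U" using L f' by simp
    have "\<not> zero_obj C (Cod C c)"
    proof
      assume "zero_obj C (Cod C c)"
      then have "null_arr C c" by (rule null_if_zero_Cod) (rule Cc)
      then have "null_arr C (f' \<cdot> c)" by (rule null_comp_right) (use f' in simp_all)
      then show False using f f' by simp
    qed
    then have Uc: "U = T \<inter> left_perp C {Cod C c}" using hasse_arrow_left_perp [OF TU] cT cU by simp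
    have cO: "{Cod C c} \<subseteq> Obj C" using cT TO by auto
    \<comment> \<open>\<open>S\<close> is nonzero in \<open>right_perp C U\<close> and therefore
      outside \<open>U\<close>; the description of \<open>U\<close> by \<open>Cod C c\<close> turns
      this into a nonzero map \<open>h\<close>.\<close>
    have "S \<notin> left_perp C {Cod C c}"
    proof
      assume "S \<in> left_perp C {Cod C c}"
      then have "S \<in> U" using Uc S by simp
      then show False using tors_perp_zero [OF U, of S] S by simp
    qed
    then obtain h where h: "h \<in> Arr C" "Dom C h = S" "Cod C h = Cod C c" "\<not> null_arr C h"
      using SO by (auto simp: left_perp_iff [OF cO])
    \<comment> \<open>Otherwise \<open>h\<close> would factor through the kernel of
      \<open>f'\<close>, which receives no nonzero map from \<open>T\<close>.\<close>
    have "\<not> null_arr C (f' \<cdot> h)"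
    proof
      assume "null_arr C (f' \<cdot> h)"
      then obtain s where s: "s \<in> Arr C" "Dom C s = Dom C h" "Cod C s = Dom C l" "l \<cdot> s = h"
        using kernel_lift [OF L(1) h(1)] h f' by auto
      have "null_arr C s" by (rule right_perp_null [of s T]) (use s h lT S in simp_all)
      then have "null_arr C (l \<cdot> s)" by (rule null_comp_right) (use s L in simp_all)
      then show False using h s by simp
    qed
    then have "epic C (f' \<cdot> h)" by (intro epic) (use f' h f S in simp_all)
    then have iso: "iso_arr C (f' \<cdot> h)" by (rule epic_endo_iso) (use f' h f in simp)
    have "monic C h" by (rule monic_right_factor [OF iso_monic [OF iso]]) (use f' h in simp_all)
    then obtain q where q: "short_exact C h q" by (rule ex_short_exact_monic)
    note Q = short_exactD [OF q]
    \<comment> \<open>The kernel of \<open>f'\<close> becomes a factor of \<open>Cod C c\<close> and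
      so lies in \<open>T\<close> as well as in \<open>right_perp C T\<close>. It is zero, and the
      torsion part is the whole kernel of \<open>f\<close>.\<close>
    have "isomorphic C (Dom C l) (Cod C q)"
      by (rule kernel_iso_coker_section [OF l q _ iso]) (use h f' in simp)
    moreover have "Cod C q \<in> T" using tors_factor [OF T Q(4)] Q(7) h cT by simp
    ultimately have "Dom C l \<in> T" using tors_iso [OF T _ isomorphic_sym] by blast
    then have "zero_obj C (Dom C l)" using tors_perp_zero [OF T] lT by blast
    then have "zero_obj C (Cod C r)" using zero_obj_isomorphic rl by blast
    then have "iso_arr C t" by (rule iso_if_zero_coker [OF tr(1)])
    then have "Cod C t \<in> T" by (intro tors_factor [OF T] iso_epic tr(3))
    then show ?thesis using tr by simp
  qed
  have "S \<in> left_wide C T"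
  proof (rule left_wideI)
    fix g k assume g: "g \<in> Arr C" "Dom C g \<in> T" "Cod C g = S" and k: "is_kernel C k g"
    show "Dom C k \<in> T"
    proof (cases "null_arr C g")
      case True
      \<comment> \<open>The kernel of a null map is its whole domain; the fact \<open>kernel\<close>
        covers nonzero maps only.\<close>
      then have "iso_arr C k" by (rule kernel_null_iso [OF k])
      then have "isomorphic C (Dom C k) (Dom C g)" using is_kernel_Arr [OF k] by (auto simp: isomorphic_iff)
      then show ?thesis using tors_iso [OF T g(2) isomorphic_sym] by simp
    next
      case False
      then show ?thesis using kernel [OF g _ k] by simp
    qed
  qed (use S in simp)
  moreover have "zero_obj C (Dom C m) \<or> iso_arr C m"
    if m: "monic C m" "Cod C m = S" "Dom C m \<in> left_wide C T" for m
  proof (cases "null_arr C m")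
    case True
    then show ?thesis using null_monic_zero [OF m(1)] by simp
  next
    case False
    have "epic C m" by (rule epic) (use False m monic_Arr left_wideD(1) [OF m(3)] in simp_all)
    then show ?thesis using iso_monic_epic [OF m(1)] by simp
  qed
  ultimately have "simple_obj (full_sub C (left_wide C T)) S"
    using S by (simp add: simple_left_wide_iff [OF T])
  moreover have "U = T \<inter> left_perp C {S}" using hasse_arrow_left_perp [OF TU] S by simp
  ultimately show ?thesis by (rule that)
qed

theorem brick_label_bij:
  assumes T: "T \<in> tors C"
  shows "bij_betw (brick_label C) {a \<in> hasse_arrows C. fst a = T} (sim C (left_wide C T))"
  unfolding bij_betw_def
proof
  let ?H = "{a \<in> hasse_arrows C. fst a = T}" and ?s = "simple_obj (full_sub C (left_wide C T))"
  \<comment> \<open>Every arrow from \<open>T\<close> is brought into the form given by a simple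
    object, where its label is known.\<close>
  have arrow: "\<exists>S. ?s S \<and> S \<in> Obj C \<and> a = (T, T \<inter> left_perp C {S}) \<and> brick_label C a = iso_class C S"
    if "a \<in> ?H" for a
  proof -
    have a: "a = (T, snd a)" "(T, snd a) \<in> hasse_arrows C" using that by (simp_all add: prod_eq_iff) (metis prod.collapse)
    obtain S where S: "?s S" "snd a = T \<inter> left_perp C {S}" using hasse_arrow_simple [OF a(2)] .
    then show ?thesis using a brick_label_simple [OF T S(1)] simple_left_wide_iff [OF T] left_wide_Obj [OF T]
      by (intro exI [of _ S]) auto
  qed
  show "inj_on (brick_label C) ?H"
  proof (rule inj_onI)
    fix a b assume "a \<in> ?H" "b \<in> ?H" and eq: "brick_label C a = brick_label C b"
    then obtain R S where R: "R \<in> Obj C" "a = (T, T \<inter> left_perp C {R})" "brick_label C a = iso_class C R"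
      and S: "S \<in> Obj C" "b = (T, T \<inter> left_perp C {S})" "brick_label C b = iso_class C S"
      using arrow by meson
    then have "isomorphic C R S" using iso_class_eqD eq by simp
    \<comment> \<open>Isomorphic simple objects have the same left perpendicular, so the two arrows
      share their lower end.\<close>
    then have "left_perp C {R} = left_perp C {S}"
      using left_perp_single_iso isomorphic_sym R(1) S(1) by blast
    then show "a = b" using R S by simp
  qed
  have sim: "sim C (left_wide C T) = iso_class C ` {S. ?s S}"
    unfolding sim_def
  proof (rule image_cong [OF refl])
    fix S assume "S \<in> {S. ?s S}"
    then have "S \<in> left_wide C T" by (simp add: simple_left_wide_iff [OF T])
    then show "iso_class (full_sub C (left_wide C T)) S = iso_class C S" by (rule iso_class_full_sub [OF T])
  qed
  show "brick_label C ` ?H = sim C (left_wide C T)"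
  proof (intro equalityI subsetI)
    fix L assume "L \<in> brick_label C ` ?H"
    then obtain a where "a \<in> ?H" "L = brick_label C a" by blast
    then show "L \<in> sim C (left_wide C T)" using arrow [of a] sim by auto
  next
    fix L assume "L \<in> sim C (left_wide C T)"
    then obtain S where S: "?s S" "L = iso_class C S" using sim by blast
    then have "L = brick_label C (T, T \<inter> left_perp C {S})" using brick_label_simple [OF T] by simp
    moreover have "(T, T \<inter> left_perp C {S}) \<in> ?H" using simple_left_wide_hasse [OF T S(1)] by simp
    ultimately show "L \<in> brick_label C ` ?H" by blast
  qed
qed

end

theorem theorem1p7:
  fixes A :: "('o, 'm) ab_category" and T :: "'o set"
  assumes "abelian_length_category A"
    and "T \<in> tors A"
  shows "bij_betw (brick_label A) {a \<in> hasse_arrows A. fst a = T} (sim A (left_wide A T)) \<and>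
    bij_betw (\<lambda>W. T \<inter> left_perp A W) (Serre A (left_wide A T))
      {U \<in> tors A. wide_interval A U T}"
proof -
  interpret abelian_length_category A by (rule assms(1))
  show ?thesis using brick_label_bij [OF assms(2)] Serre_wide_interval_bij [OF assms(2)] by simp
qed

end
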